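(* Let $p\in(0,\infty)$ and, for $i=1,2$, let $\mathfrak M_i=\mathfrak N_i\otimes M_2(\mathbb C)$, where $\mathfrak N_i$ is a finite factor. If $\phi$ is a surjective $L^p$-isometry from $\mathscr P_{1/2}(\mathfrak M_1)$ to $\mathscr P_{1/2}(\mathfrak M_2)$ satisfying $\phi(I\otimes E_{11})=I\otimes E_{11}$, then there exists a surjective $L^p$-isometry $\psi:\mathscr U(\mathfrak N_1)\to\mathscr U(\mathfrak N_2)$ such that $$\phi\Big(\tfrac12\big(I\otimes(E_{11}+E_{22})+V\otimes E_{12}+V^*\otimes E_{21}\big)\Big)=\tfrac12\big(I\otimes(E_{11}+E_{22})+\psi(V)\otimes E_{12}+\psi(V)^*\otimes E_{21}\big)$$ for every unitary $V\in\mathfrak N_1$.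
   Context: $\{E_{ij}\}$ are the canonical matrix units of $M_2(\mathbb C)$. A finite factor is a von Neumann algebra factor admitting a (unique, faithful, normal) tracial state, i.e. $M_n(\mathbb C)$ or a $\mathrm{II}_1$ factor. For a finite factor with tracial state $\tau$, $\|A\|_p:=\tau(|A|^p)^{1/p}$, $\mathscr U(\cdot)$ denotes the unitary group, and $\mathscr P_{1/2}(\cdot)$ the set of projections of trace $1/2$. A map $f$ between subsets of finite factors is an $L^p$-isometry if $\|A-B\|_p=\|f(A)-f(B)\|_p$ for all $A,B$ in its domain, each side computed with the tracial state of the respective factor. *)

theory Defs
  imports "HOL-Analysis.Analysis" "HOL-Computational_Algebra.Polynomial"
begin

section \<open>Complex Hilbert spaces\<close>

text \<open>The inner product is linear in its first argument. The norm and real scalar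
  multiplication are those of the underlying real Banach space.\<close>

class chilbert = banach +
  fixes scaleC :: "complex \<Rightarrow> 'a \<Rightarrow> 'a"  (infixr \<open>*\<^sub>C\<close> 75)
    and cinner :: "'a \<Rightarrow> 'a \<Rightarrow> complex"
  assumes scaleC_add_right: "c *\<^sub>C (x + y) = c *\<^sub>C x + c *\<^sub>C y"
    and scaleC_add_left: "(c + d) *\<^sub>C x = c *\<^sub>C x + d *\<^sub>C x"
    and scaleC_scaleC: "c *\<^sub>C d *\<^sub>C x = (c * d) *\<^sub>C x"
    and scaleC_one: "1 *\<^sub>C x = x"
    and scaleR_scaleC: "r *\<^sub>R x = complex_of_real r *\<^sub>C x"
    and cinner_add_left: "cinner (x + y) z = cinner x z + cinner y z"
    and cinner_scaleC_left: "cinner (c *\<^sub>C x) y = c * cinner x y"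
    and cinner_commute: "cinner x y = cnj (cinner y x)"
    and cinner_self: "cinner x x = complex_of_real ((norm x)\<^sup>2)"
begin

lemma cinner_scaleC_right: "cinner x (c *\<^sub>C y) = cnj c * cinner x y"
  by (metis cinner_commute cinner_scaleC_left complex_cnj_mult)

lemma norm_scaleC: "norm (c *\<^sub>C x) = cmod c * norm x"
proof -
  have "complex_of_real ((norm (c *\<^sub>C x))\<^sup>2) = (c * cnj c) * cinner x x"
    by (simp only: cinner_self[symmetric] cinner_scaleC_left cinner_scaleC_right mult.assoc mult.left_commute)
  also have "\<dots> = complex_of_real ((cmod c * norm x)\<^sup>2)"
    by (simp only: cinner_self complex_norm_square[symmetric] power_mult_distrib of_real_mult)
  finally have "(norm (c *\<^sub>C x))\<^sup>2 = (cmod c * norm x)\<^sup>2"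
    by (simp only: of_real_eq_iff)
  then show ?thesis by (simp add: power2_eq_iff_nonneg)
qed

end

lemma bounded_linear_scaleC: "bounded_linear (scaleC c :: 'a::chilbert \<Rightarrow> 'a)"
proof (rule bounded_linear_intro)
  show "norm (c *\<^sub>C x) \<le> norm x * cmod c" for x :: 'a
    by (simp add: norm_scaleC mult.commute)
qed (simp_all add: scaleC_add_right scaleR_scaleC scaleC_scaleC mult.commute)

instantiation complex :: chilbert
begin

definition scaleC_complex :: "complex \<Rightarrow> complex \<Rightarrow> complex" where
  "scaleC_complex c x = c * x"

definition cinner_complex :: "complex \<Rightarrow> complex \<Rightarrow> complex" where
  "cinner_complex x y = x * cnj y"

instance
proof
  show "cinner x x = complex_of_real ((norm x)\<^sup>2)" for x :: complex
    unfolding cinner_complex_def by (rule complex_norm_square[symmetric])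
qed (simp_all add: scaleC_complex_def cinner_complex_def distrib_left distrib_right
    mult.assoc scaleR_conv_of_real)

end

instantiation vec :: (chilbert, finite) chilbert
begin

definition scaleC_vec :: "complex \<Rightarrow> 'a ^ 'b \<Rightarrow> 'a ^ 'b" where
  "c *\<^sub>C x = (\<chi> i. c *\<^sub>C x $ i)"

definition cinner_vec :: "'a ^ 'b \<Rightarrow> 'a ^ 'b \<Rightarrow> complex" where
  "cinner x y = (\<Sum>i\<in>UNIV. cinner (x $ i) (y $ i))"

instance
proof
  fix x y :: "'a ^ 'b"
  show "cinner x y = cnj (cinner y x)"
    unfolding cinner_vec_def by (subst cinner_commute) simp
  show "cinner x x = complex_of_real ((norm x)\<^sup>2)"
    by (simp add: cinner_vec_def cinner_self norm_vec_def L2_set_def sum_nonneg)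
qed (simp_all add: vec_eq_iff scaleC_vec_def cinner_vec_def scaleC_add_right scaleC_add_left
    scaleC_scaleC scaleC_one scaleR_scaleC cinner_add_left cinner_scaleC_left
    sum.distrib sum_distrib_left)

end


section \<open>Bounded operators\<close>

text \<open>\<open>'a \<Rightarrow>\<^sub>L 'a\<close> consists of the bounded \<^emph>\<open>real\<close>-linear maps; the bounded operators on the
  complex Hilbert space are the complex-linear ones among them.\<close>

definition bop :: "('a::chilbert \<Rightarrow>\<^sub>L 'a) set" where
  "bop = {T. \<forall>c x. blinfun_apply T (c *\<^sub>C x) = c *\<^sub>C blinfun_apply T x}"

lift_definition scaleC_op :: "complex \<Rightarrow> ('a::chilbert \<Rightarrow>\<^sub>L 'a) \<Rightarrow> ('a \<Rightarrow>\<^sub>L 'a)"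
  is "\<lambda>c T x. c *\<^sub>C T x"
  by (rule bounded_linear_compose[OF bounded_linear_scaleC])

definition adj :: "('a::chilbert \<Rightarrow>\<^sub>L 'a) \<Rightarrow> ('a \<Rightarrow>\<^sub>L 'a)" where
  "adj T = (THE S. \<forall>x y. cinner (blinfun_apply T x) y = cinner x (blinfun_apply S y))"

definition op_le :: "('a::chilbert \<Rightarrow>\<^sub>L 'a) \<Rightarrow> ('a \<Rightarrow>\<^sub>L 'a) \<Rightarrow> bool" where
  "op_le A B \<longleftrightarrow> (\<forall>x. cinner (blinfun_apply (B - A) x) x \<in> \<real>\<^sub>\<ge>\<^sub>0)"

definition modulus :: "('a::chilbert \<Rightarrow>\<^sub>L 'a) \<Rightarrow> ('a \<Rightarrow>\<^sub>L 'a)" where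
  "modulus A = (THE B. B \<in> bop \<and> op_le 0 B \<and> B o\<^sub>L B = adj A o\<^sub>L A)"

definition op_power :: "('a::chilbert \<Rightarrow>\<^sub>L 'a) \<Rightarrow> nat \<Rightarrow> ('a \<Rightarrow>\<^sub>L 'a)" where
  "op_power T n = ((o\<^sub>L) T ^^ n) id_blinfun"

definition op_poly :: "real poly \<Rightarrow> ('a::chilbert \<Rightarrow>\<^sub>L 'a) \<Rightarrow> ('a \<Rightarrow>\<^sub>L 'a)" where
  "op_poly q T = (\<Sum>i\<le>degree q. coeff q i *\<^sub>R op_power T i)"

text \<open>The real part of the spectrum, which for a self-adjoint operator is all of it.\<close>

definition real_spectrum :: "('a::chilbert \<Rightarrow>\<^sub>L 'a) \<Rightarrow> real set" where
  "real_spectrum T = {t. \<not> (\<exists>S. S o\<^sub>L (T - t *\<^sub>R id_blinfun) = id_blinfun \<and>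
                              (T - t *\<^sub>R id_blinfun) o\<^sub>L S = id_blinfun)}"

text \<open>Continuous functional calculus \<open>f(T)\<close> of a self-adjoint operator \<open>T\<close>, for \<open>f\<close>
  continuous on the spectrum of \<open>T\<close>: the common norm limit of \<open>q\<^sub>n(T)\<close>, for polynomials
  \<open>q\<^sub>n\<close> converging to \<open>f\<close> uniformly on the spectrum.\<close>

definition cfc :: "(real \<Rightarrow> real) \<Rightarrow> ('a::chilbert \<Rightarrow>\<^sub>L 'a) \<Rightarrow> ('a \<Rightarrow>\<^sub>L 'a)" where
  "cfc f T = (THE B. \<forall>q :: nat \<Rightarrow> real poly.
     uniform_limit (real_spectrum T) (\<lambda>n. poly (q n)) f sequentially \<longrightarrow>
     (\<lambda>n. op_poly (q n) T) \<longlonglongrightarrow> B)"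


section \<open>Finite factors\<close>

definition commutant :: "('a::chilbert \<Rightarrow>\<^sub>L 'a) set \<Rightarrow> ('a \<Rightarrow>\<^sub>L 'a) set" where
  "commutant N = {S \<in> bop. \<forall>T\<in>N. S o\<^sub>L T = T o\<^sub>L S}"

definition von_neumann_algebra :: "('a::chilbert \<Rightarrow>\<^sub>L 'a) set \<Rightarrow> bool" where
  "von_neumann_algebra N \<longleftrightarrow>
     N \<subseteq> bop \<and> (\<forall>A\<in>N. adj A \<in> N) \<and> commutant (commutant N) = N"

definition factor :: "('a::chilbert \<Rightarrow>\<^sub>L 'a) set \<Rightarrow> bool" where
  "factor N \<longleftrightarrow> von_neumann_algebra N \<and>
     N \<inter> commutant N = range (\<lambda>c. scaleC_op c id_blinfun)"

text \<open>States are extensional so that a state on \<open>N\<close> is determined by its values on \<open>N\<close>.\<close>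

definition tracial_state ::
  "('a::chilbert \<Rightarrow>\<^sub>L 'a) set \<Rightarrow> (('a \<Rightarrow>\<^sub>L 'a) \<Rightarrow> complex) \<Rightarrow> bool" where
  "tracial_state N \<tau> \<longleftrightarrow> \<tau> \<in> extensional N \<and>
     (\<forall>A\<in>N. \<forall>B\<in>N. \<tau> (A + B) = \<tau> A + \<tau> B) \<and>
     (\<forall>c. \<forall>A\<in>N. \<tau> (scaleC_op c A) = c * \<tau> A) \<and>
     (\<forall>A\<in>N. op_le 0 A \<longrightarrow> \<tau> A \<in> \<real>\<^sub>\<ge>\<^sub>0) \<and>
     \<tau> id_blinfun = 1 \<and>
     (\<forall>A\<in>N. \<forall>B\<in>N. \<tau> (A o\<^sub>L B) = \<tau> (B o\<^sub>L A))"

definition faithful_state ::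
  "('a::chilbert \<Rightarrow>\<^sub>L 'a) set \<Rightarrow> (('a \<Rightarrow>\<^sub>L 'a) \<Rightarrow> complex) \<Rightarrow> bool" where
  "faithful_state N \<tau> \<longleftrightarrow> (\<forall>A\<in>N. op_le 0 A \<and> \<tau> A = 0 \<longrightarrow> A = 0)"

definition normal_state ::
  "('a::chilbert \<Rightarrow>\<^sub>L 'a) set \<Rightarrow> (('a \<Rightarrow>\<^sub>L 'a) \<Rightarrow> complex) \<Rightarrow> bool" where
  "normal_state N \<tau> \<longleftrightarrow> (\<forall>D S.
     D \<subseteq> N \<and> D \<noteq> {} \<and> (\<forall>A\<in>D. op_le 0 A) \<and>
     (\<forall>A\<in>D. \<forall>B\<in>D. \<exists>C\<in>D. op_le A C \<and> op_le B C) \<and>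
     S \<in> N \<and> (\<forall>A\<in>D. op_le A S) \<and> (\<forall>R\<in>N. (\<forall>A\<in>D. op_le A R) \<longrightarrow> op_le S R) \<longrightarrow>
     Re (\<tau> S) = (SUP A\<in>D. Re (\<tau> A)))"

definition trace_of :: "('a::chilbert \<Rightarrow>\<^sub>L 'a) set \<Rightarrow> ('a \<Rightarrow>\<^sub>L 'a) \<Rightarrow> complex" where
  "trace_of N = (THE \<tau>. tracial_state N \<tau>)"

definition finite_factor :: "('a::chilbert \<Rightarrow>\<^sub>L 'a) set \<Rightarrow> bool" where
  "finite_factor N \<longleftrightarrow> factor N \<and> (\<exists>!\<tau>. tracial_state N \<tau>) \<and>
     faithful_state N (trace_of N) \<and> normal_state N (trace_of N)"

definition Lp_norm :: "('a::chilbert \<Rightarrow>\<^sub>L 'a) set \<Rightarrow> real \<Rightarrow> ('a \<Rightarrow>\<^sub>L 'a) \<Rightarrow> real" where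
  "Lp_norm N p A = Re (trace_of N (cfc (\<lambda>t. t powr p) (modulus A))) powr (1 / p)"

definition unitary_group :: "('a::chilbert \<Rightarrow>\<^sub>L 'a) set \<Rightarrow> ('a \<Rightarrow>\<^sub>L 'a) set" where
  "unitary_group N = {U \<in> N. adj U o\<^sub>L U = id_blinfun \<and> U o\<^sub>L adj U = id_blinfun}"

definition half_projections :: "('a::chilbert \<Rightarrow>\<^sub>L 'a) set \<Rightarrow> ('a \<Rightarrow>\<^sub>L 'a) set" where
  "half_projections N = {P \<in> N. adj P = P \<and> P o\<^sub>L P = P \<and> trace_of N P = 1 / 2}"

definition surj_Lp_isometry ::
  "real \<Rightarrow> ('a::chilbert \<Rightarrow>\<^sub>L 'a) set \<Rightarrow> ('b::chilbert \<Rightarrow>\<^sub>L 'b) set \<Rightarrow>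
   ('a \<Rightarrow>\<^sub>L 'a) set \<Rightarrow> ('b \<Rightarrow>\<^sub>L 'b) set \<Rightarrow> (('a \<Rightarrow>\<^sub>L 'a) \<Rightarrow> ('b \<Rightarrow>\<^sub>L 'b)) \<Rightarrow> bool" where
  "surj_Lp_isometry p N1 N2 X Y f \<longleftrightarrow> f ` X = Y \<and>
     (\<forall>A\<in>X. \<forall>B\<in>X. Lp_norm N1 p (A - B) = Lp_norm N2 p (f A - f B))"


section \<open>Tensor products with matrix algebras\<close>

text \<open>\<open>H \<otimes> \<complex>\<^sup>n\<close> is identified with \<open>H\<^sup>n\<close>.\<close>

lift_definition op_tensor ::
  "('a::chilbert \<Rightarrow>\<^sub>L 'a) \<Rightarrow> complex ^ 'n ^ 'n \<Rightarrow> (('a ^ 'n) \<Rightarrow>\<^sub>L ('a ^ 'n))"  (infixr \<open>\<otimes>\<^sub>M\<close> 72)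
  is "\<lambda>A X v. \<chi> i. \<Sum>j\<in>UNIV. X $ i $ j *\<^sub>C A (v $ j)"
proof -
  fix A :: "'a \<Rightarrow> 'a" and X :: "complex ^ 'n ^ 'n"
  assume A: "bounded_linear A"
  define g where "g i v = (\<Sum>j\<in>UNIV. X $ i $ j *\<^sub>C A (v $ j))" for i and v :: "'a ^ 'n"
  have g: "bounded_linear (g i)" for i
    unfolding g_def
    by (intro bounded_linear_sum bounded_linear_compose[OF bounded_linear_scaleC]
        bounded_linear_compose[OF A] bounded_linear_vec_nth)
  have "bounded_linear (\<lambda>v. \<chi> i. g i v)"
  proof (rule bounded_linear_intro)
    fix v :: "'a ^ 'n"
    have "norm (\<chi> i. g i v) \<le> (\<Sum>i\<in>UNIV. norm (g i v))"
      by (simp add: norm_vec_def L2_set_le_sum)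
    also have "\<dots> \<le> (\<Sum>i\<in>UNIV. norm v * onorm (g i))"
      by (intro sum_mono) (metis g mult.commute onorm)
    finally show "norm (\<chi> i. g i v) \<le> norm v * (\<Sum>i\<in>UNIV. onorm (g i))"
      by (simp add: sum_distrib_left)
  qed (simp_all add: vec_eq_iff linear_add[OF bounded_linear.linear[OF g]]
      linear_scale[OF bounded_linear.linear[OF g]])
  then show "bounded_linear (\<lambda>v. \<chi> i. \<Sum>j\<in>UNIV. X $ i $ j *\<^sub>C A (v $ j))"
    by (simp add: g_def)
qed

definition matrix_unit :: "'n \<Rightarrow> 'n \<Rightarrow> complex ^ 'n ^ 'n" where
  "matrix_unit i j = (\<chi> k l. if k = i \<and> l = j then 1 else 0)"

text \<open>The von Neumann algebra tensor product \<open>N \<otimes> M\<^sub>2(\<complex>)\<close>, i.e. the von Neumann algebra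
  generated by the elementary tensors.\<close>

definition tensor_M2 :: "('a::chilbert \<Rightarrow>\<^sub>L 'a) set \<Rightarrow> (('a ^ 2) \<Rightarrow>\<^sub>L ('a ^ 2)) set" where
  "tensor_M2 N = commutant (commutant {A \<otimes>\<^sub>M X | A X. A \<in> N})"

end

theory Submission
  imports Defs "HOL-Computational_Algebra.Fundamental_Theorem_Algebra"
begin

text \<open>
  Put \<open>E = I \<otimes> E\<^sub>1\<^sub>1\<close>. A projection \<open>P\<close> of trace \<open>1/2\<close> has the form
  \<open>(I \<otimes> I + V \<otimes> E\<^sub>1\<^sub>2 + V\<^sup>* \<otimes> E\<^sub>2\<^sub>1) / 2\<close> with \<open>V\<close> unitary iff \<open>(P - E)\<^sup>2 = 1/2\<close>, and this equation can be
  expressed by distances alone. As \<open>a = (P - E)\<^sup>2\<close> satisfies \<open>(P - (1 - E))\<^sup>2 = 1 - a\<close>, the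
  \<open>p\<close>-th powers of the distances of \<open>P\<close> to \<open>E\<close> and \<open>1 - E\<close> are the traces of \<open>a\<close> and \<open>1 - a\<close> raised to
  the power \<open>p/2\<close>. For \<open>p \<noteq> 2\<close>, strict convexity or concavity of \<open>t \<mapsto> t\<^bsup>p/2\<^esup>\<close> and
  faithfulness of the trace force \<open>a = 1/2\<close> once both equal \<open>2\<^bsup>-p/2\<^esup>\<close>; moreover \<open>1 - E\<close> is the only
  projection of trace \<open>1/2\<close> at distance \<open>1\<close> from \<open>E\<close>, hence also preserved. For \<open>p = 2\<close>, \<open>a = 1/2\<close> means that the
  normalized sum of the symmetries \<open>2E - 1\<close> and \<open>2P - 1\<close> is again a symmetry, and the inner products that
  identify it are given by distances. Finally, the distance between the projections of \<open>V\<close> and \<open>W\<close> is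
  half the distance between \<open>V\<close> and \<open>W\<close>.
\<close>

section \<open>Hilbert space operators\<close>

text \<open>\<open>adj\<close>, \<open>modulus\<close>, \<open>cfc\<close> and
  \<open>trace_of\<close> are definite descriptions, so existence and uniqueness must precede any
  computation with them. Spectral integrals are replaced by one estimate: for self-adjoint
  \<open>T\<close>, the norm of \<open>op_poly q T\<close> is at most the supremum of
  \<open>\<bar>q\<bar>\<close> on the spectrum. Powers, positivity and the equality cases of trace
  inequalities are then treated with polynomials, followed by a limit.

  The equation for \<open>P - E\<close> singles out unitaries because, for a projection
  \<open>P\<close> with diagonal blocks \<open>a\<close> and \<open>d\<close>, the square of
  \<open>P - E\<close> is block diagonal with entries \<open>1 - a\<close> and \<open>d\<close>.
  Hence it forces \<open>a = d = 1/2\<close>, and idempotence of \<open>P\<close> makes twice the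
  off-diagonal block unitary.

  The exponent 2 is exceptional because there the powers of the two distances always add up to 1;
  this is why a third projection enters. The final comparison of distances rests on the equality of
  the traces of \<open>f (D o\<^sub>L adj D)\<close> and \<open>f (adj D o\<^sub>L D)\<close>, the
  two diagonal blocks that arise there.\<close>

lemma cinner_add_right: "cinner x (y + z) = cinner x y + cinner x (z :: 'a::chilbert)"
  by (metis cinner_add_left cinner_commute complex_cnj_add)

lemma scaleC_zero_left [simp]: "0 *\<^sub>C x = (0 :: 'a::chilbert)"
  using scaleC_add_left[of 0 0 x] by simp

lemma scaleC_zero_right [simp]: "c *\<^sub>C 0 = (0 :: 'a::chilbert)"
  using scaleC_add_right[of c 0 "0::'a"] by simp

lemma scaleC_minus_right: "c *\<^sub>C (- x) = - (c *\<^sub>C (x :: 'a::chilbert))"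
  using scaleC_add_right[of c x "-x"] by (simp add: eq_neg_iff_add_eq_0 add.commute)

lemma scaleC_diff_right: "c *\<^sub>C (x - y) = c *\<^sub>C x - c *\<^sub>C (y :: 'a::chilbert)"
  using scaleC_add_right[of c x "-y"] by (simp add: scaleC_minus_right)

lemma scaleC_scaleR: "c *\<^sub>C (r *\<^sub>R x) = r *\<^sub>R (c *\<^sub>C (x :: 'a::chilbert))"
  by (simp add: scaleR_scaleC scaleC_scaleC mult.commute)

lemma cinner_zero_left [simp]: "cinner 0 (x :: 'a::chilbert) = 0"
  using cinner_add_left[of 0 0 x] by simp

lemma cinner_zero_right [simp]: "cinner (x :: 'a::chilbert) 0 = 0"
  using cinner_add_right[of x 0 0] by simp

lemma cinner_minus_left: "cinner (- x) (y :: 'a::chilbert) = - cinner x y"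
  using cinner_add_left[of x "-x" y] by (simp add: eq_neg_iff_add_eq_0 add.commute)

lemma cinner_minus_right: "cinner x (- y :: 'a::chilbert) = - cinner x y"
  using cinner_add_right[of x y "-y"] by (simp add: eq_neg_iff_add_eq_0 add.commute)

lemma cinner_diff_left: "cinner (x - y) (z :: 'a::chilbert) = cinner x z - cinner y z"
  using cinner_add_left[of x "-y" z] by (simp add: cinner_minus_left)

lemma cinner_diff_right: "cinner x (y - z :: 'a::chilbert) = cinner x y - cinner x z"
  using cinner_add_right[of x y "-z"] by (simp add: cinner_minus_right)

lemma cinner_scaleR_left: "cinner (r *\<^sub>R x) (y :: 'a::chilbert) = r * cinner x y"
  by (simp only: scaleR_scaleC cinner_scaleC_left)

lemma cinner_scaleR_right: "cinner x (r *\<^sub>R y :: 'a::chilbert) = r * cinner x y"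
  by (simp only: scaleR_scaleC cinner_scaleC_right complex_cnj_complex_of_real)

lemmas cinner_simps = cinner_add_left cinner_add_right cinner_diff_left cinner_diff_right
  cinner_minus_left cinner_minus_right cinner_scaleR_left cinner_scaleR_right
  cinner_scaleC_left cinner_scaleC_right

section \<open>Cauchy-Schwarz inequality and Riesz representation\<close>

lemma norm_sq_cinner: "(norm (x :: 'a::chilbert))\<^sup>2 = Re (cinner x x)"
  by (simp add: cinner_self)

lemma Re_cinner_commute: "Re (cinner x y) = Re (cinner y (x :: 'a::chilbert))"
  by (subst cinner_commute) simp

lemma norm_add_sq: "(norm (x + y :: 'a::chilbert))\<^sup>2 = (norm x)\<^sup>2 + 2 * Re (cinner x y) + (norm y)\<^sup>2"
  by (simp add: norm_sq_cinner cinner_simps Re_cinner_commute[of y x])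

lemma norm_diff_sq: "(norm (x - y :: 'a::chilbert))\<^sup>2 = (norm x)\<^sup>2 - 2 * Re (cinner x y) + (norm y)\<^sup>2"
  by (simp add: norm_sq_cinner cinner_simps Re_cinner_commute[of y x])

lemma cinner_eqI:
  assumes "\<And>x. cinner x y = cinner x (z :: 'a::chilbert)"
  shows "y = z"
proof -
  have "cinner (y - z) (y - z) = 0"
    using assms[of "y - z"] by (simp add: cinner_diff_right)
  then show ?thesis by (simp add: cinner_self)
qed

text \<open>Expanding the square of \<open>norm y *\<^sub>R x - norm x *\<^sub>R y\<close> gives the
  inequality multiplied by \<open>norm x * norm y\<close>, so only a vanishing product needs
  separate care.\<close>

lemma Cauchy_Schwarz_Re: "Re (cinner x y) \<le> norm x * norm (y :: 'a::chilbert)"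
proof -
  have "0 \<le> (norm (norm y *\<^sub>R x - norm x *\<^sub>R y))\<^sup>2" by simp
  also have "\<dots> = 2 * (norm x * norm y) * (norm x * norm y - Re (cinner x y))"
    unfolding norm_diff_sq by (simp add: cinner_simps power_mult_distrib algebra_simps power2_eq_square)
  finally have *: "0 \<le> (norm x * norm y) * (norm x * norm y - Re (cinner x y))" by simp
  show ?thesis
  proof (cases "norm x * norm y = 0")
    case True
    then show ?thesis by auto
  next
    case False
    then have "norm x * norm y > 0" by simp
    then show ?thesis using * by (simp add: zero_le_mult_iff)
  qed
qed

lemma Cauchy_Schwarz_abs_Re: "\<bar>Re (cinner x y)\<bar> \<le> norm x * norm (y :: 'a::chilbert)"
  using Cauchy_Schwarz_Re[of x y] Cauchy_Schwarz_Re[of "-x" y] by (simp add: cinner_minus_left)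

text \<open>If \<open>z\<close> represents \<open>f\<close>, then
  \<open>(norm x)\<^sup>2 - 2 * f x\<close> equals
  \<open>(norm (x - z))\<^sup>2 - (norm z)\<^sup>2\<close>. So \<open>z\<close> is found as the
  minimizer of this functional, which exists by completeness.\<close>

lemma Riesz_representation:
  fixes f :: "'a::chilbert \<Rightarrow> real"
  assumes f: "bounded_linear f"
  obtains z where "\<And>x. f x = Re (cinner x z)"
proof -
  interpret bounded_linear f by fact
  obtain K where K: "\<And>x. \<bar>f x\<bar> \<le> norm x * K" using bounded by auto
  define J where "J x = (norm x)\<^sup>2 - 2 * f x" for x
  have "J x \<ge> - K\<^sup>2" for x
  proof -
    have "0 \<le> (norm x - K)\<^sup>2" by simp
    then show ?thesis using K[of x] by (simp add: J_def power2_diff)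
  qed
  then have bdd: "bdd_below (range J)" by (auto intro!: bdd_belowI)
  define m where "m = Inf (range J)"
  have m: "m \<le> J x" for x
    unfolding m_def using bdd by (intro cInf_lower) auto
  have "\<exists>x. J x < m + 1 / Suc n" for n :: nat
  proof -
    have "m < m + 1 / Suc n" by simp
    then show ?thesis unfolding m_def using cInf_lessD[of "range J"] by auto
  qed
  then obtain X where X: "\<And>n::nat. J (X n) < m + 1 / Suc n" by metis
  \<comment> \<open>By the parallelogram identity a minimizing sequence of \<open>J\<close> is Cauchy.\<close>
  have par: "(norm (x - y))\<^sup>2 \<le> 2 * (J x + J y - 2 * m)" for x y
  proof -
    have "(norm (x - y))\<^sup>2 = 2 * (J x + J y - 2 * J ((1/2) *\<^sub>R (x + y)))"
      by (simp add: J_def norm_diff_sq scaleR add power_divide norm_add_sq cinner_simps field_simps)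
    then show ?thesis using m[of "(1/2) *\<^sub>R (x + y)"] by simp
  qed
  have "Cauchy X"
  proof (rule metric_CauchyI)
    fix e :: real assume "e > 0"
    then obtain n0 :: nat where n0: "inverse (Suc n0) < e\<^sup>2 / 4"
      using reals_Archimedean[of "e\<^sup>2 / 4"] by auto
    show "\<exists>M. \<forall>i\<ge>M. \<forall>j\<ge>M. dist (X i) (X j) < e"
    proof (intro exI allI impI)
      fix i j assume "i \<ge> n0" "j \<ge> n0"
      then have "1 / Suc i \<le> inverse (Suc n0)" "1 / Suc j \<le> inverse (Suc n0)"
        by (simp_all add: field_simps)
      then have "J (X i) < m + e\<^sup>2 / 4" "J (X j) < m + e\<^sup>2 / 4"
        using X[of i] X[of j] n0 by linarith+
      then have "(norm (X i - X j))\<^sup>2 < e\<^sup>2"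
        using par[of "X i" "X j"] by argo
      then show "dist (X i) (X j) < e"
        using \<open>e > 0\<close> by (simp add: dist_norm power_less_imp_less_base)
    qed
  qed
  then obtain z where z: "X \<longlonglongrightarrow> z" using Cauchy_convergent_iff convergent_def by blast
  have "(\<lambda>n. J (X n)) \<longlonglongrightarrow> J z"
    unfolding J_def by (intro tendsto_intros z tendsto)
  moreover have "(\<lambda>n. m + 1 / Suc n) \<longlonglongrightarrow> m + 0"
    by (intro tendsto_intros lim_1_over_n[THEN LIMSEQ_Suc])
  ultimately have Jz: "J z \<le> m"
    using X by (intro LIMSEQ_le[of "\<lambda>n. J (X n)" "J z" "\<lambda>n. m + 1 / Suc n" m]) (auto intro: less_imp_le)
  have "f x = Re (cinner x z)" for x
  proof -
    have q: "0 \<le> t\<^sup>2 * (norm x)\<^sup>2 + 2 * t * (Re (cinner x z) - f x)" for t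
    proof -
      have "J (z + t *\<^sub>R x) = J z + t\<^sup>2 * (norm x)\<^sup>2 + 2 * t * (Re (cinner x z) - f x)"
        by (simp add: J_def norm_add_sq cinner_simps add scaleR power_mult_distrib algebra_simps
            Re_cinner_commute[of z x])
      then show ?thesis using m[of "z + t *\<^sub>R x"] Jz by linarith
    qed
    define d where "d = Re (cinner x z) - f x"
    \<comment> \<open>The quadratic in \<open>t\<close> is tested at \<open>- d / N\<close> instead
      of its minimizer; the summand 1 keeps the denominator positive also for
      \<open>x = 0\<close>.\<close>
    define N where "N = (norm x)\<^sup>2 + 1"
    have "N > 0" by (simp add: N_def add_nonneg_pos)
    have "0 \<le> (d / N)\<^sup>2 * (norm x)\<^sup>2 - 2 * (d / N) * d"
      using q[of "- d / N"] unfolding d_def[symmetric] by simp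
    also have "\<dots> \<le> (d / N)\<^sup>2 * N - 2 * (d / N) * d"
      by (intro diff_right_mono mult_left_mono) (auto simp: N_def)
    also have "\<dots> = - (d\<^sup>2 / N)"
      using \<open>N > 0\<close> by (simp add: power2_eq_square field_simps)
    finally have "d\<^sup>2 \<le> 0" using \<open>N > 0\<close> by (simp add: divide_le_0_iff)
    then show ?thesis by (simp add: d_def)
  qed
  then show ?thesis using that by blast
qed

section \<open>Existence and calculus of adjoints\<close>

lemma bopD: "T \<in> bop \<Longrightarrow> blinfun_apply T (c *\<^sub>C x) = c *\<^sub>C blinfun_apply T x"
  by (simp add: bop_def)

lemma adj_eqI:
  assumes "\<And>x y. cinner (blinfun_apply T x) y = cinner x (blinfun_apply S y)"
  shows "adj T = S"
  unfolding adj_def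
proof (rule the_equality)
  fix S' assume "\<forall>x y. cinner (blinfun_apply T x) y = cinner x (blinfun_apply S' y)"
  then have "cinner x (blinfun_apply S' y) = cinner x (blinfun_apply S y)" for x y
    using assms by metis
  then show "S' = S" by (intro blinfun_eqI) (rule cinner_eqI)
qed (use assms in blast)

text \<open>This is the existence half for the description in \<open>adj\<close>: Riesz applied to
  the real functional \<open>Re (cinner (T x) y)\<close> yields the candidate vector for each
  \<open>y\<close>.\<close>

lemma cinner_adj_right:
  fixes T :: "'a::chilbert \<Rightarrow>\<^sub>L 'a"
  assumes T: "T \<in> bop"
  shows "cinner (blinfun_apply T x) y = cinner x (blinfun_apply (adj T) y)"
proof -
  have "\<exists>z. \<forall>x. Re (cinner (blinfun_apply T x) y) = Re (cinner x z)" for y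
  proof -
    have "bounded_linear (\<lambda>x. Re (cinner (blinfun_apply T x) y))"
    proof (rule bounded_linear_intro)
      show "norm (Re (cinner (blinfun_apply T x) y)) \<le> norm x * (norm T * norm y)" for x
        using Cauchy_Schwarz_abs_Re[of "blinfun_apply T x" y]
          mult_right_mono[OF norm_blinfun[of T x], of "norm y"] by (simp add: ac_simps)
    qed (simp_all add: blinfun.bilinear_simps cinner_simps)
    then show ?thesis using Riesz_representation by metis
  qed
  then obtain S where S: "\<And>x y. Re (cinner (blinfun_apply T x) y) = Re (cinner x (S y))" by metis
  \<comment> \<open>The real identity at \<open>\<i> *\<^sub>C x\<close> is the identity of
    imaginary parts at \<open>x\<close>, since \<open>T\<close> is complex linear.\<close>
  have S': "cinner (blinfun_apply T x) y = cinner x (S y)" for x y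
    using S[of x y] S[of "\<i> *\<^sub>C x" y] by (simp add: bopD[OF T] cinner_scaleC_left complex_eq_iff)
  have "bounded_linear S"
  proof (rule bounded_linear_intro)
    show "S (x + y) = S x + S y" for x y
      by (rule cinner_eqI) (simp add: cinner_simps flip: S')
    show "S (r *\<^sub>R x) = r *\<^sub>R S x" for r x
      by (rule cinner_eqI) (simp add: cinner_simps flip: S')
    show "norm (S y) \<le> norm y * norm T" for y
    proof -
      have "(norm (S y))\<^sup>2 = Re (cinner (blinfun_apply T (S y)) y)"
        by (simp add: norm_sq_cinner S)
      also have "\<dots> \<le> norm (blinfun_apply T (S y)) * norm y" by (rule Cauchy_Schwarz_Re)
      also have "\<dots> \<le> (norm T * norm (S y)) * norm y" by (intro mult_right_mono norm_blinfun) auto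
      finally have "norm (S y) * norm (S y) \<le> norm (S y) * (norm y * norm T)"
        by (simp add: power2_eq_square ac_simps)
      then show ?thesis by (cases "norm (S y) = 0") (auto simp: mult_le_cancel_left)
    qed
  qed
  then have "adj T = Blinfun S"
    by (intro adj_eqI) (simp add: bounded_linear_Blinfun_apply S')
  then show ?thesis using S' \<open>bounded_linear S\<close> by (simp add: bounded_linear_Blinfun_apply)
qed

lemma cinner_adj_left:
  "T \<in> bop \<Longrightarrow> cinner (blinfun_apply (adj T) x) y = cinner x (blinfun_apply T y)"
  by (subst (1 2) cinner_commute) (simp add: cinner_adj_right)

lemma adj_bop:
  assumes T: "T \<in> bop" shows "adj T \<in> bop"
proof -
  have "blinfun_apply (adj T) (c *\<^sub>C x) = c *\<^sub>C blinfun_apply (adj T) x" for c x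
    by (rule cinner_eqI) (simp add: cinner_scaleC_right flip: cinner_adj_right[OF T])
  then show ?thesis by (simp add: bop_def)
qed

lemma adj_adj: "T \<in> bop \<Longrightarrow> adj (adj T) = T"
  by (rule adj_eqI) (rule cinner_adj_left)

lemma blinfun_compose_assoc: "(A o\<^sub>L B) o\<^sub>L C = A o\<^sub>L (B o\<^sub>L C)"
  by (rule blinfun_eqI) simp

lemma id_blinfun_compose [simp]: "id_blinfun o\<^sub>L A = A" "A o\<^sub>L id_blinfun = A"
  by (auto intro: blinfun_eqI)

lemmas compose_add_left = bounded_bilinear.add_left[OF bounded_bilinear_blinfun_compose]
lemmas compose_add_right = bounded_bilinear.add_right[OF bounded_bilinear_blinfun_compose]
lemmas compose_diff_left = bounded_bilinear.diff_left[OF bounded_bilinear_blinfun_compose]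
lemmas compose_diff_right = bounded_bilinear.diff_right[OF bounded_bilinear_blinfun_compose]
lemmas compose_minus_left = bounded_bilinear.minus_left[OF bounded_bilinear_blinfun_compose]
lemmas compose_minus_right = bounded_bilinear.minus_right[OF bounded_bilinear_blinfun_compose]
lemmas compose_scaleR_left = bounded_bilinear.scaleR_left[OF bounded_bilinear_blinfun_compose]
lemmas compose_scaleR_right = bounded_bilinear.scaleR_right[OF bounded_bilinear_blinfun_compose]
lemmas compose_simps = compose_add_left compose_add_right compose_diff_left compose_diff_right
  compose_minus_left compose_minus_right compose_scaleR_left compose_scaleR_right

lemma bop_id: "id_blinfun \<in> bop" by (simp add: bop_def)
lemma bop_zero: "0 \<in> bop" by (simp add: bop_def)
lemma bop_compose: "A \<in> bop \<Longrightarrow> B \<in> bop \<Longrightarrow> A o\<^sub>L B \<in> bop" by (simp add: bop_def)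
lemma bop_add: "A \<in> bop \<Longrightarrow> B \<in> bop \<Longrightarrow> A + B \<in> bop"
  by (simp add: bop_def blinfun.bilinear_simps scaleC_add_right)
lemma bop_diff: "A \<in> bop \<Longrightarrow> B \<in> bop \<Longrightarrow> A - B \<in> bop"
  by (simp add: bop_def blinfun.bilinear_simps scaleC_diff_right)
lemma bop_scaleR: "A \<in> bop \<Longrightarrow> r *\<^sub>R A \<in> bop"
  by (simp add: bop_def blinfun.bilinear_simps scaleC_scaleR)

lemma adj_compose: "A \<in> bop \<Longrightarrow> B \<in> bop \<Longrightarrow> adj (A o\<^sub>L B) = adj B o\<^sub>L adj A"
  by (rule adj_eqI) (simp add: cinner_adj_right)
lemma adj_add: "A \<in> bop \<Longrightarrow> B \<in> bop \<Longrightarrow> adj (A + B) = adj A + adj B"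
  by (rule adj_eqI) (simp add: cinner_simps blinfun.bilinear_simps cinner_adj_right)
lemma adj_diff: "A \<in> bop \<Longrightarrow> B \<in> bop \<Longrightarrow> adj (A - B) = adj A - adj B"
  by (rule adj_eqI) (simp add: cinner_simps blinfun.bilinear_simps cinner_adj_right)
lemma adj_scaleR: "A \<in> bop \<Longrightarrow> adj (r *\<^sub>R A) = r *\<^sub>R adj A"
  by (rule adj_eqI) (simp add: cinner_simps blinfun.bilinear_simps cinner_adj_right)
lemma adj_id [simp]: "adj id_blinfun = id_blinfun"
  by (rule adj_eqI) simp

text \<open>Membership in \<open>bop\<close> is included because the existence of
  \<open>adj T\<close> is established only for complex-linear \<open>T\<close>.\<close>

definition selfadjoint :: "('a::chilbert \<Rightarrow>\<^sub>L 'a) \<Rightarrow> bool" where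
  "selfadjoint T \<longleftrightarrow> T \<in> bop \<and> adj T = T"

lemma selfadjoint_bop: "selfadjoint T \<Longrightarrow> T \<in> bop" by (simp add: selfadjoint_def)

lemma selfadjoint_cinner:
  "selfadjoint T \<Longrightarrow> cinner (blinfun_apply T x) y = cinner x (blinfun_apply T y)"
  by (metis selfadjoint_def cinner_adj_right)

lemma selfadjointI:
  "T \<in> bop \<Longrightarrow> (\<And>x y. cinner (blinfun_apply T x) y = cinner x (blinfun_apply T y)) \<Longrightarrow> selfadjoint T"
  unfolding selfadjoint_def by (blast intro: adj_eqI)

lemma selfadjoint_id: "selfadjoint id_blinfun" by (simp add: selfadjoint_def bop_id)
lemma selfadjoint_zero: "selfadjoint 0" by (rule selfadjointI) (auto simp: bop_zero)
lemma selfadjoint_add: "selfadjoint A \<Longrightarrow> selfadjoint B \<Longrightarrow> selfadjoint (A + B)"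
  by (simp add: selfadjoint_def adj_add bop_add)
lemma selfadjoint_diff: "selfadjoint A \<Longrightarrow> selfadjoint B \<Longrightarrow> selfadjoint (A - B)"
  by (simp add: selfadjoint_def adj_diff bop_diff)
lemma selfadjoint_scaleR: "selfadjoint A \<Longrightarrow> selfadjoint (r *\<^sub>R A)"
  by (simp add: selfadjoint_def adj_scaleR bop_scaleR)
lemma selfadjoint_square: "selfadjoint A \<Longrightarrow> selfadjoint (A o\<^sub>L A)"
  by (simp add: selfadjoint_def adj_compose bop_compose)

section \<open>Quadratic forms of self-adjoint operators\<close>

lemma selfadjoint_Im_cinner:
  assumes "selfadjoint T"
  shows "Im (cinner (blinfun_apply T x) x) = 0"
proof -
  have "cinner (blinfun_apply T x) x = cnj (cinner (blinfun_apply T x) x)"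
    using selfadjoint_cinner[OF assms, of x x] cinner_commute[of x "blinfun_apply T x"] by (rule trans)
  from arg_cong[OF this, of Im] show ?thesis by simp
qed

lemma op_le_iff_selfadjoint:
  assumes "selfadjoint A" "selfadjoint B"
  shows "op_le A B \<longleftrightarrow> (\<forall>x. Re (cinner (blinfun_apply A x) x) \<le> Re (cinner (blinfun_apply B x) x))"
  using selfadjoint_Im_cinner[OF selfadjoint_diff[OF assms(2,1)]]
  by (simp add: op_le_def complex_nonneg_Reals_iff blinfun.bilinear_simps cinner_simps)

lemma op_le_zero_adj_compose: "A \<in> bop \<Longrightarrow> op_le 0 (adj A o\<^sub>L A)"
  by (simp add: op_le_def cinner_adj_left cinner_self)

text \<open>Polarization: a form that is real at \<open>x\<close>, \<open>y\<close>,
  \<open>x + y\<close> and \<open>x + \<i> *\<^sub>C y\<close> is hermitian in \<open>x\<close> and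
  \<open>y\<close>.\<close>

lemma selfadjoint_of_positive:
  fixes T :: "'a::chilbert \<Rightarrow>\<^sub>L 'a"
  assumes T: "T \<in> bop" and pos: "op_le 0 T"
  shows "selfadjoint T"
proof (rule selfadjointI[OF T])
  fix x y
  have im: "Im (cinner (blinfun_apply T z) z) = 0" for z
    using pos by (simp add: op_le_def complex_nonneg_Reals_iff)
  have "cinner (blinfun_apply T x) y = cnj (cinner (blinfun_apply T y) x)"
    using im[of x] im[of y] im[of "x + y"] im[of "x + \<i> *\<^sub>C y"]
    by (simp add: cinner_simps blinfun.bilinear_simps bopD[OF T] complex_eq_iff)
  then show "cinner (blinfun_apply T x) y = cinner x (blinfun_apply T y)"
    by (subst (2) cinner_commute)
qed

text \<open>Polarization turns the bound on the quadratic form into a bound on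
  \<open>cinner (T x) y\<close>, which is then used with \<open>y\<close> parallel to
  \<open>T x\<close>.\<close>

lemma norm_le_numerical_radius:
  fixes T :: "'a::chilbert \<Rightarrow>\<^sub>L 'a"
  assumes T: "selfadjoint T" and "k \<ge> 0"
    and k: "\<And>x. \<bar>Re (cinner (blinfun_apply T x) x)\<bar> \<le> k * (norm x)\<^sup>2"
  shows "norm T \<le> k"
proof (rule norm_blinfun_bound[OF \<open>k \<ge> 0\<close>])
  fix x
  let ?y = "blinfun_apply T x"
  have polar: "4 * Re (cinner (blinfun_apply T x) y) \<le> 2 * k * ((norm x)\<^sup>2 + (norm y)\<^sup>2)" for x y
  proof -
    have "4 * Re (cinner (blinfun_apply T x) y) =
      Re (cinner (blinfun_apply T (x + y)) (x + y)) - Re (cinner (blinfun_apply T (x - y)) (x - y))"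
      by (simp add: blinfun.bilinear_simps cinner_simps selfadjoint_cinner[OF T, of y x]
          Re_cinner_commute[of y "blinfun_apply T x"])
    also have "\<dots> \<le> k * (norm (x + y))\<^sup>2 + k * (norm (x - y))\<^sup>2"
      using k[of "x + y"] k[of "x - y"] by linarith
    finally show ?thesis by (simp add: norm_add_sq norm_diff_sq algebra_simps)
  qed
  show "norm ?y \<le> k * norm x"
  proof (cases "?y = 0 \<or> x = 0")
    case True then show ?thesis using \<open>k \<ge> 0\<close> by auto
  next
    case False
    \<comment> \<open>Giving \<open>z\<close> the length of \<open>x\<close> makes the sum of
      squares in \<open>polar\<close> equal to twice \<open>(norm x)\<^sup>2\<close>, so no constant
      is lost.\<close>
    define z where "z = (norm x / norm ?y) *\<^sub>R ?y"
    have "norm z = norm x" using False by (simp add: z_def)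
    moreover have "Re (cinner ?y z) = norm x * norm ?y"
      using False by (simp add: z_def cinner_simps cinner_self power2_eq_square)
    ultimately have "norm x * norm ?y \<le> norm x * (k * norm x)"
      using polar[of x z] by (simp add: power2_eq_square ac_simps)
    then show ?thesis using False by (simp add: mult_le_cancel_left)
  qed
qed

section \<open>Invertibility of coercive operators\<close>

definition op_invertible :: "('a::chilbert \<Rightarrow>\<^sub>L 'a) \<Rightarrow> bool" where
  "op_invertible T \<longleftrightarrow> (\<exists>S. S o\<^sub>L T = id_blinfun \<and> T o\<^sub>L S = id_blinfun)"

lemma op_invertible_compose:
  assumes "op_invertible A" "op_invertible B"
  shows "op_invertible (A o\<^sub>L B)"
proof -
  obtain A' B' where "A' o\<^sub>L A = id_blinfun" "A o\<^sub>L A' = id_blinfun"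
    "B' o\<^sub>L B = id_blinfun" "B o\<^sub>L B' = id_blinfun"
    using assms unfolding op_invertible_def by blast
  then have "(B' o\<^sub>L A') o\<^sub>L (A o\<^sub>L B) = id_blinfun" "(A o\<^sub>L B) o\<^sub>L (B' o\<^sub>L A') = id_blinfun"
    by (metis blinfun_compose_assoc id_blinfun_compose(1))+
  then show ?thesis unfolding op_invertible_def by blast
qed

text \<open>Solving \<open>B x = y\<close> is a fixed point problem for
  \<open>x \<mapsto> K x + y / C\<close> with \<open>K = 1 - B / C\<close>. The choice of
  \<open>C\<close> places \<open>B / C\<close> between \<open>c / C\<close> and 1 as a form, so this
  is a contraction; coercivity also bounds the inverse.\<close>

lemma op_invertible_coercive:
  fixes B :: "'a::chilbert \<Rightarrow>\<^sub>L 'a"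
  assumes B: "selfadjoint B" and "c > 0"
    and coercive: "\<And>x. c * (norm x)\<^sup>2 \<le> Re (cinner (blinfun_apply B x) x)"
  shows "op_invertible B"
proof -
  define C where "C = norm B + c"
  have "C > 0" using \<open>c > 0\<close> by (simp add: C_def add_nonneg_pos)
  define K where "K = id_blinfun - (1 / C) *\<^sub>R B"
  have K: "norm K \<le> 1 - c / C"
  proof (rule norm_le_numerical_radius)
    show "selfadjoint K" unfolding K_def by (intro selfadjoint_diff selfadjoint_id selfadjoint_scaleR B)
    show "0 \<le> 1 - c / C" using \<open>C > 0\<close> by (simp add: C_def)
    fix x
    have eq: "Re (cinner (blinfun_apply K x) x) = (norm x)\<^sup>2 - Re (cinner (blinfun_apply B x) x) / C"
      by (simp add: K_def blinfun.bilinear_simps cinner_simps cinner_self)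
    have "Re (cinner (blinfun_apply B x) x) \<le> norm B * (norm x)\<^sup>2"
      using Cauchy_Schwarz_Re[of "blinfun_apply B x" x] mult_right_mono[OF norm_blinfun[of B x], of "norm x"]
      by (simp add: power2_eq_square)
    also have "\<dots> \<le> C * (norm x)\<^sup>2" using \<open>c > 0\<close> by (intro mult_right_mono) (auto simp: C_def)
    finally have "Re (cinner (blinfun_apply B x) x) / C \<le> (norm x)\<^sup>2"
      using \<open>C > 0\<close> by (simp add: field_simps)
    moreover have "c / C * (norm x)\<^sup>2 \<le> Re (cinner (blinfun_apply B x) x) / C"
      using coercive[of x] \<open>C > 0\<close> by (simp add: field_simps)
    ultimately show "\<bar>Re (cinner (blinfun_apply K x) x)\<bar> \<le> (1 - c / C) * (norm x)\<^sup>2"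
      unfolding eq by (simp add: algebra_simps)
  qed
  have ex1: "\<exists>!x. blinfun_apply B x = y" for y
  proof -
    have "\<exists>!x. blinfun_apply K x + (1 / C) *\<^sub>R y = x"
    proof (rule banach_fix_type[of "1 - c / C"])
      show "0 \<le> 1 - c / C" "1 - c / C < 1" using \<open>C > 0\<close> \<open>c > 0\<close> by (simp_all add: C_def)
      show "\<forall>x z. dist (blinfun_apply K x + (1 / C) *\<^sub>R y) (blinfun_apply K z + (1 / C) *\<^sub>R y)
          \<le> (1 - c / C) * dist x z"
        using order_trans[OF norm_blinfun[of K] mult_right_mono[OF K norm_ge_zero]]
        by (simp add: dist_norm flip: blinfun.diff_right)
    qed
    moreover have "blinfun_apply K x + (1 / C) *\<^sub>R y = x \<longleftrightarrow> blinfun_apply B x = y" for x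
      using \<open>C > 0\<close> by (auto simp: K_def blinfun.bilinear_simps)
    ultimately show ?thesis by simp
  qed
  define S where "S y = (THE x. blinfun_apply B x = y)" for y
  have BS: "blinfun_apply B (S y) = y" for y
    unfolding S_def by (rule theI') (rule ex1)
  have SB: "S (blinfun_apply B x) = x" for x
    using ex1[of "blinfun_apply B x"] BS by blast
  have "bounded_linear S"
  proof (rule bounded_linear_intro)
    show "S (x + y) = S x + S y" for x y
      by (metis BS SB blinfun.add_right)
    show "S (r *\<^sub>R x) = r *\<^sub>R S x" for r x
      by (metis BS SB blinfun.scaleR_right)
    show "norm (S y) \<le> norm y * (1 / c)" for y
    proof -
      have "c * (norm (S y))\<^sup>2 \<le> norm y * norm (S y)"
        using coercive[of "S y"] Cauchy_Schwarz_Re[of y "S y"] by (simp add: BS)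
      then have "norm (S y) * (c * norm (S y)) \<le> norm (S y) * norm y"
        by (simp add: power2_eq_square ac_simps)
      then have "c * norm (S y) \<le> norm y" by (cases "norm (S y) = 0") (auto simp: mult_le_cancel_left)
      then show ?thesis using \<open>c > 0\<close> by (simp add: field_simps)
    qed
  qed
  then have "Blinfun S o\<^sub>L B = id_blinfun" "B o\<^sub>L Blinfun S = id_blinfun"
    by (auto intro!: blinfun_eqI simp: bounded_linear_Blinfun_apply SB BS)
  then show ?thesis unfolding op_invertible_def by blast
qed

section \<open>Polynomial and continuous functional calculus\<close>

lemma op_power_0 [simp]: "op_power T 0 = id_blinfun" by (simp add: op_power_def)
lemma op_power_Suc [simp]: "op_power T (Suc n) = T o\<^sub>L op_power T n" by (simp add: op_power_def)

lemma op_poly_altdef: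
  assumes "degree q \<le> n"
  shows "op_poly q T = (\<Sum>i\<le>n. coeff q i *\<^sub>R op_power T i)"
  unfolding op_poly_def
  by (rule sum.mono_neutral_left) (use assms in \<open>auto simp: coeff_eq_0\<close>)

lemma op_poly_0 [simp]: "op_poly 0 T = 0" by (simp add: op_poly_def)

text \<open>The Horner form makes \<open>op_poly\<close> accessible to induction on polynomials,
  which its definition by coefficients is not.\<close>

lemma op_poly_pCons: "op_poly (pCons c q) T = c *\<^sub>R id_blinfun + (T o\<^sub>L op_poly q T)"
proof -
  have "op_poly (pCons c q) T = (\<Sum>i\<le>Suc (degree q). coeff (pCons c q) i *\<^sub>R op_power T i)"
    by (rule op_poly_altdef) (rule degree_pCons_le)
  also have "\<dots> = c *\<^sub>R id_blinfun + (\<Sum>i\<le>degree q. coeff q i *\<^sub>R (T o\<^sub>L op_power T i))"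
    by (subst sum.atMost_Suc_shift) simp
  also have "(\<Sum>i\<le>degree q. coeff q i *\<^sub>R (T o\<^sub>L op_power T i)) = T o\<^sub>L op_poly q T"
    by (simp add: op_poly_def bounded_bilinear.sum_right[OF bounded_bilinear_blinfun_compose] compose_simps)
  finally show ?thesis .
qed

lemma op_poly_add: "op_poly (q + r) T = op_poly q T + op_poly r T"
proof -
  let ?n = "max (degree q) (degree r)"
  have "op_poly (q + r) T = (\<Sum>i\<le>?n. coeff (q + r) i *\<^sub>R op_power T i)"
    by (rule op_poly_altdef) (rule degree_add_le_max)
  then show ?thesis
    by (simp add: op_poly_altdef[of q ?n] op_poly_altdef[of r ?n] sum.distrib scaleR_left_distrib)
qed

lemma op_poly_smult: "op_poly (smult c q) T = c *\<^sub>R op_poly q T"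
  using op_poly_altdef[of "smult c q" "degree q" T]
  by (simp add: degree_smult_le scaleR_sum_right op_poly_def)

lemma op_poly_minus: "op_poly (- q) T = - op_poly q T"
  using op_poly_smult[of "-1" q T] by simp

lemma op_poly_diff: "op_poly (q - r) T = op_poly q T - op_poly r T"
  using op_poly_add[of q "-r" T] by (simp add: op_poly_minus)

lemma op_poly_mult: "op_poly (q * r) T = op_poly q T o\<^sub>L op_poly r T"
  by (induction q)
    (simp_all add: op_poly_pCons op_poly_add op_poly_smult compose_simps blinfun_compose_assoc)

lemma op_poly_const: "op_poly [:c:] T = c *\<^sub>R id_blinfun"
  by (simp add: op_poly_pCons)

lemma op_poly_X: "op_poly [:0, 1:] T = T"
  by (simp add: op_poly_pCons compose_simps)

lemma op_poly_pcompose: "op_poly (pcompose q r) T = op_poly q (op_poly r T)"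
  by (induction q) (simp_all add: pcompose_pCons op_poly_pCons op_poly_add op_poly_mult)

lemmas op_poly_simps = op_poly_add op_poly_diff op_poly_minus op_poly_smult op_poly_mult
  op_poly_const op_poly_X

lemma op_poly_commute:
  assumes "S o\<^sub>L T = T o\<^sub>L S"
  shows "S o\<^sub>L op_poly q T = op_poly q T o\<^sub>L S"
proof (induction q)
  case (pCons c q)
  have "S o\<^sub>L (T o\<^sub>L op_poly q T) = (T o\<^sub>L op_poly q T) o\<^sub>L S"
    by (metis assms pCons.IH blinfun_compose_assoc)
  then show ?case by (simp add: op_poly_pCons compose_simps)
qed simp

lemma selfadjoint_op_poly:
  assumes T: "selfadjoint T"
  shows "selfadjoint (op_poly q T)"
proof (induction q)
  case 0
  then show ?case by (simp add: selfadjoint_zero)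
next
  case (pCons c q)
  have "T \<in> bop" "op_poly q T \<in> bop" "adj T = T" "adj (op_poly q T) = op_poly q T"
    using T pCons by (auto simp: selfadjoint_def)
  then have "adj (T o\<^sub>L op_poly q T) = T o\<^sub>L op_poly q T"
    by (simp add: adj_compose op_poly_commute[of T T q])
  then have "selfadjoint (T o\<^sub>L op_poly q T)"
    using \<open>T \<in> bop\<close> \<open>op_poly q T \<in> bop\<close> by (simp add: selfadjoint_def bop_compose)
  then show ?case
    by (simp add: op_poly_pCons selfadjoint_add selfadjoint_scaleR selfadjoint_id)
qed

section \<open>Spectral mapping and the norm bound for polynomials\<close>

lemma real_spectrum_iff: "t \<notin> real_spectrum T \<longleftrightarrow> op_invertible (T - t *\<^sub>R id_blinfun)"
  by (simp add: real_spectrum_def op_invertible_def)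

lemma poly_complex_of_real_add:
  "poly (map_poly complex_of_real (p + q)) z =
    poly (map_poly complex_of_real p) z + poly (map_poly complex_of_real q) z"
  by (induction p q rule: poly_induct2) (simp_all add: map_poly_pCons algebra_simps)

lemma poly_complex_of_real_mult:
  "poly (map_poly complex_of_real (p * q)) z =
    poly (map_poly complex_of_real p) z * poly (map_poly complex_of_real q) z"
proof (induction p)
  case (pCons c p)
  have "poly (map_poly complex_of_real (smult c q)) z = of_real c * poly (map_poly complex_of_real q) z"
    by (induction q) (simp_all add: map_poly_pCons algebra_simps)
  then show ?case
    using pCons by (simp add: poly_complex_of_real_add map_poly_pCons algebra_simps)
qed simp

lemma poly_complex_of_real_of_real:
  "poly (map_poly complex_of_real p) (of_real t) = of_real (poly p t)"
  by (induction p) (simp_all add: map_poly_pCons)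

text \<open>The quadratic is the product of \<open>X - z\<close> and \<open>X - cnj z\<close>. The
  remainder modulo it is real, of degree below 2 and zero at the nonreal \<open>z\<close>, hence
  zero.\<close>

lemma quadratic_dvd_of_nonreal_root:
  fixes r :: "real poly" and z :: complex
  assumes root: "poly (map_poly of_real r) z = 0" and "Im z \<noteq> 0"
  shows "[:(cmod z)\<^sup>2, - 2 * Re z, 1:] dvd r"
proof -
  define m where "m = [:(cmod z)\<^sup>2, - 2 * Re z, 1:]"
  have "degree m = 2" by (simp add: m_def)
  then have "m \<noteq> 0" by auto
  have mz: "poly (map_poly of_real m) z = 0"
    by (simp add: m_def map_poly_pCons complex_eq_iff cmod_power2 algebra_simps) (simp add: power2_eq_square)
  define s where "s = r mod m"
  have "degree s < 2"
    using degree_mod_less[OF \<open>m \<noteq> 0\<close>, of r] \<open>degree m = 2\<close> by (auto simp: s_def)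
  then have s: "s = [:coeff s 0, coeff s 1:]"
    by (intro poly_eqI) (auto simp: coeff_pCons coeff_eq_0 split: nat.splits)
  have "r = m * (r div m) + s" by (simp add: s_def)
  then have "poly (map_poly of_real r) z = poly (map_poly complex_of_real s) z"
    using mz by (metis poly_complex_of_real_add poly_complex_of_real_mult mult_zero_left add_0)
  then have "poly (map_poly complex_of_real s) z = 0"
    using root by simp
  then have "poly (map_poly complex_of_real [:coeff s 0, coeff s 1:]) z = 0"
    using s by simp
  then have "coeff s 1 = 0" "coeff s 0 = 0"
    using \<open>Im z \<noteq> 0\<close> by (auto simp: map_poly_pCons complex_eq_iff)
  then have "s = 0" using s by simp
  then have "r mod m = 0" by (simp add: s_def)
  then show ?thesis by (simp add: m_def mod_eq_0_iff_dvd)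
qed

text \<open>One inclusion of the spectral mapping theorem, by splitting \<open>r\<close> into real
  linear and quadratic factors. A linear factor is invertible because its root, being a root of
  \<open>r\<close>, lies outside the spectrum.\<close>

lemma op_invertible_op_poly:
  fixes T :: "'a::chilbert \<Rightarrow>\<^sub>L 'a"
  assumes T: "selfadjoint T"
  shows "r \<noteq> 0 \<Longrightarrow> (\<And>t. t \<in> real_spectrum T \<Longrightarrow> poly r t \<noteq> 0) \<Longrightarrow> op_invertible (op_poly r T)"
proof (induction "degree r" arbitrary: r rule: less_induct)
  case less
  show ?case
  proof (cases "degree r = 0")
    case True
    then obtain c where c: "r = [:c:]" by (rule degree_eq_zeroE)
    have "op_poly r T = c *\<^sub>R id_blinfun" by (simp add: c op_poly_const)
    moreover have "c \<noteq> 0" using c less.prems by auto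
    ultimately have "((1/c) *\<^sub>R id_blinfun) o\<^sub>L op_poly r T = id_blinfun"
      "op_poly r T o\<^sub>L ((1/c) *\<^sub>R id_blinfun) = id_blinfun"
      by (simp_all add: compose_simps)
    then show ?thesis unfolding op_invertible_def by blast
  next
    case False
    \<comment> \<open>It suffices to split off one nonconstant factor with invertible value; the
      induction hypothesis handles the cofactor.\<close>
    have factor: "op_invertible (op_poly r T)"
      if "m dvd r" "degree m > 0" "op_invertible (op_poly m T)" for m
    proof -
      obtain s where s: "r = m * s" using \<open>m dvd r\<close> by blast
      then have "s \<noteq> 0" "m \<noteq> 0" using less.prems by auto
      then have "degree s < degree r" using s that by (simp add: degree_mult_eq)
      moreover have "poly s t \<noteq> 0" if "t \<in> real_spectrum T" for t
        using less.prems(2)[OF that] s by simp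
      ultimately have "op_invertible (op_poly s T)" using less.hyps \<open>s \<noteq> 0\<close> by blast
      then show ?thesis using that by (simp add: s op_poly_mult op_invertible_compose)
    qed
    have "\<not> constant (poly (map_poly complex_of_real r))"
      using False by (simp add: constant_degree degree_map_poly)
    then obtain z where z: "poly (map_poly complex_of_real r) z = 0"
      using fundamental_theorem_of_algebra by blast
    show ?thesis
    proof (cases "Im z = 0")
      case True
      then have "z = of_real (Re z)" by (simp add: complex_eq_iff)
      then have root: "poly r (Re z) = 0"
        using z by (metis of_real_eq_0_iff poly_complex_of_real_of_real)
      have "op_invertible (op_poly [:- Re z, 1:] T)"
        using less.prems(2)[of "Re z"] root real_spectrum_iff[of "Re z" T]
        by (auto simp: op_poly_pCons compose_simps)
      then show ?thesis using root factor[of "[:- Re z, 1:]"] by (simp add: poly_eq_0_iff_dvd)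
    next
      case False
      \<comment> \<open>A quadratic factor without real roots is a square plus a positive constant, hence coercive.\<close>
      define m where "m = [:(cmod z)\<^sup>2, - 2 * Re z, 1:]"
      define U where "U = T - Re z *\<^sub>R id_blinfun"
      have U: "selfadjoint U" unfolding U_def by (intro selfadjoint_diff selfadjoint_scaleR selfadjoint_id T)
      have "(2 * Re z) *\<^sub>R T = Re z *\<^sub>R T + Re z *\<^sub>R T"
        by (metis mult_2 scaleR_left_distrib)
      then have "(U o\<^sub>L U) = (T o\<^sub>L T) - (2 * Re z) *\<^sub>R T + (Re z)\<^sup>2 *\<^sub>R id_blinfun"
        by (simp add: U_def compose_simps power2_eq_square algebra_simps)
      moreover have "op_poly m T = (T o\<^sub>L T) - (2 * Re z) *\<^sub>R T + ((Re z)\<^sup>2 + (Im z)\<^sup>2) *\<^sub>R id_blinfun"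
        by (simp add: m_def op_poly_pCons compose_simps flip: cmod_power2)
      ultimately have "op_poly m T = (U o\<^sub>L U) + (Im z)\<^sup>2 *\<^sub>R id_blinfun"
        by (simp add: scaleR_left_distrib)
      moreover have "op_invertible ((U o\<^sub>L U) + (Im z)\<^sup>2 *\<^sub>R id_blinfun)"
      proof (rule op_invertible_coercive)
        show "selfadjoint ((U o\<^sub>L U) + (Im z)\<^sup>2 *\<^sub>R id_blinfun)"
          by (intro selfadjoint_add selfadjoint_square selfadjoint_scaleR selfadjoint_id U)
        show "(Im z)\<^sup>2 > 0" using False by simp
        show "(Im z)\<^sup>2 * (norm x)\<^sup>2 \<le> Re (cinner (blinfun_apply ((U o\<^sub>L U) + (Im z)\<^sup>2 *\<^sub>R id_blinfun) x) x)" for x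
          by (simp add: blinfun.bilinear_simps cinner_simps selfadjoint_cinner[OF U] cinner_self)
      qed
      ultimately show ?thesis
        using factor[of m] quadratic_dvd_of_nonreal_root[OF z False] by (simp add: m_def)
    qed
  qed
qed

text \<open>Where the norm of \<open>A x\<close> is close to \<open>N * norm x\<close>, the vector
  \<open>A (A x) - N\<^sup>2 x\<close> is small. A bounded inverse excludes this uniformly, so the
  norm of \<open>A\<close> would drop below \<open>N\<close>.\<close>

lemma not_op_invertible_square_minus_norm:
  fixes A :: "'a::chilbert \<Rightarrow>\<^sub>L 'a"
  assumes A: "selfadjoint A" and "norm A > 0"
  shows "\<not> op_invertible ((A o\<^sub>L A) - (norm A)\<^sup>2 *\<^sub>R id_blinfun)"
proof
  define N where "N = norm A"
  assume "op_invertible ((A o\<^sub>L A) - (norm A)\<^sup>2 *\<^sub>R id_blinfun)"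
  then obtain S where S: "S o\<^sub>L ((A o\<^sub>L A) - N\<^sup>2 *\<^sub>R id_blinfun) = id_blinfun"
    unfolding op_invertible_def N_def by blast
  define K where "K = (norm S)\<^sup>2 + 1"
  have "K > 0" by (simp add: K_def add_nonneg_pos)
  have "N > 0" using assms by (simp add: N_def)
  have bd: "(norm (blinfun_apply A x))\<^sup>2 \<le> N\<^sup>2 * (norm x)\<^sup>2" for x
    using power_mono[OF norm_blinfun[of A x], of 2] by (simp add: N_def power_mult_distrib)
  have key: "(norm x)\<^sup>2 \<le> K * (2 * N^4 * (norm x)\<^sup>2 - 2 * N\<^sup>2 * (norm (blinfun_apply A x))\<^sup>2)" for x
  proof -
    let ?y = "blinfun_apply A (blinfun_apply A x) - N\<^sup>2 *\<^sub>R x"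
    have "x = blinfun_apply S ?y"
      using arg_cong[OF S, of "\<lambda>T. blinfun_apply T x"] by (simp add: blinfun.bilinear_simps)
    then have "norm x \<le> norm S * norm ?y" using norm_blinfun by metis
    then have "(norm x)\<^sup>2 \<le> (norm S)\<^sup>2 * (norm ?y)\<^sup>2"
      using power_mono[of "norm x" "norm S * norm ?y" 2] by (simp add: power_mult_distrib)
    also have "\<dots> \<le> K * (norm ?y)\<^sup>2" by (intro mult_right_mono) (auto simp: K_def)
    also have "(norm ?y)\<^sup>2 = (norm (blinfun_apply A (blinfun_apply A x)))\<^sup>2
        - 2 * N\<^sup>2 * (norm (blinfun_apply A x))\<^sup>2 + N^4 * (norm x)\<^sup>2"
      by (simp add: norm_diff_sq cinner_simps selfadjoint_cinner[OF A, of "blinfun_apply A x"] cinner_self power_mult_distrib)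
    also have "\<dots> \<le> 2 * N^4 * (norm x)\<^sup>2 - 2 * N\<^sup>2 * (norm (blinfun_apply A x))\<^sup>2"
      using bd[of "blinfun_apply A x"] mult_left_mono[OF bd[of x], of "N\<^sup>2"]
      by (simp add: power4_eq_xxxx power2_eq_square ac_simps)
    finally show ?thesis using \<open>K > 0\<close> by simp
  qed
  \<comment> \<open>Solving \<open>key\<close> for the square of the norm of \<open>A x\<close>
    gives the factor \<open>M < N\<^sup>2\<close>; the maximum with 0 below covers negative
    \<open>M\<close>.\<close>
  define M where "M = N\<^sup>2 - 1 / (2 * N\<^sup>2 * K)"
  have le: "(norm (blinfun_apply A x))\<^sup>2 \<le> M * (norm x)\<^sup>2" for x
  proof -
    have M: "2 * N\<^sup>2 * K * M = 2 * N^4 * K - 1"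
      using \<open>N > 0\<close> \<open>K > 0\<close> by (simp add: M_def field_simps power4_eq_xxxx power2_eq_square)
    have "2 * N\<^sup>2 * K * (M * (norm x)\<^sup>2) = (2 * N^4 * K - 1) * (norm x)\<^sup>2"
      by (simp flip: M)
    then have "2 * N\<^sup>2 * K * (norm (blinfun_apply A x))\<^sup>2 \<le> 2 * N\<^sup>2 * K * (M * (norm x)\<^sup>2)"
      using key[of x] by (simp add: algebra_simps)
    then show ?thesis using \<open>N > 0\<close> \<open>K > 0\<close> by (simp add: mult_le_cancel_left)
  qed
  have "norm A \<le> sqrt (max M 0)"
  proof (rule norm_blinfun_bound)
    fix x
    have "(norm (blinfun_apply A x))\<^sup>2 \<le> max M 0 * (norm x)\<^sup>2"
      using le[of x] mult_right_mono[of M "max M 0" "(norm x)\<^sup>2"] by simp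
    then show "norm (blinfun_apply A x) \<le> sqrt (max M 0) * norm x"
      using real_le_rsqrt real_sqrt_mult by fastforce
  qed simp
  then have "N\<^sup>2 \<le> max M 0"
    using power_mono[of N "sqrt (max M 0)" 2] by (simp add: N_def)
  moreover have "M < N\<^sup>2" using \<open>N > 0\<close> \<open>K > 0\<close> by (simp add: M_def)
  ultimately show False using \<open>N > 0\<close> by (auto simp: max_def split: if_splits)
qed

text \<open>If the norm \<open>n\<close> of \<open>q(T)\<close> exceeded \<open>e\<close>, then
  \<open>q\<^sup>2 - n\<^sup>2\<close> would have no zero on the spectrum, so
  \<open>q(T)\<^sup>2 - n\<^sup>2\<close> would be invertible. The zero polynomial must be excluded
  here, which is why an empty spectrum is a separate case.\<close>

lemma norm_op_poly_le:
  fixes T :: "'a::chilbert \<Rightarrow>\<^sub>L 'a"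
  assumes T: "selfadjoint T" and "e \<ge> 0"
    and bd: "\<And>t. t \<in> real_spectrum T \<Longrightarrow> \<bar>poly q t\<bar> \<le> e"
  shows "norm (op_poly q T) \<le> e"
proof (rule ccontr)
  have gen: False if e: "\<forall>t\<in>real_spectrum T. \<bar>poly q t\<bar> \<le> e" and "e \<ge> 0" and "norm (op_poly q T) > e"
    and nz: "q * q - [:(norm (op_poly q T))\<^sup>2:] \<noteq> 0" for e q
  proof -
    define N where "N = norm (op_poly q T)"
    have "poly (q * q - [:N\<^sup>2:]) t \<noteq> 0" if "t \<in> real_spectrum T" for t
    proof -
      have "\<bar>poly q t\<bar> < N" using e that \<open>norm (op_poly q T) > e\<close> by (force simp: N_def)
      then have "(poly q t)\<^sup>2 < N\<^sup>2"
        using power_strict_mono[of "\<bar>poly q t\<bar>" N 2] by simp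
      then show ?thesis by (simp add: power2_eq_square)
    qed
    then have "op_invertible (op_poly (q * q - [:N\<^sup>2:]) T)"
      using nz by (intro op_invertible_op_poly[OF T]) (auto simp: N_def)
    then have "op_invertible ((op_poly q T o\<^sub>L op_poly q T) - N\<^sup>2 *\<^sub>R id_blinfun)"
      by (simp only: op_poly_simps)
    then show False
      using not_op_invertible_square_minus_norm[OF selfadjoint_op_poly[OF T, of q]]
        le_less_trans[OF that(2,3)] unfolding N_def by blast
  qed
  assume "\<not> norm (op_poly q T) \<le> e"
  then have N: "norm (op_poly q T) > e" by simp
  show False
  proof (cases "real_spectrum T = {}")
    case False
    then obtain t where t: "t \<in> real_spectrum T" by blast
    have "q * q - [:(norm (op_poly q T))\<^sup>2:] \<noteq> 0"
    proof
      assume "q * q - [:(norm (op_poly q T))\<^sup>2:] = 0"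
      then have "poly (q * q - [:(norm (op_poly q T))\<^sup>2:]) t = 0" by simp
      then have "(poly q t)\<^sup>2 = (norm (op_poly q T))\<^sup>2" by (simp add: power2_eq_square)
      then have "\<bar>poly q t\<bar> = norm (op_poly q T)" by (metis abs_norm_cancel power2_eq_iff abs_minus_cancel)
      then show False using bd[OF t] N by simp
    qed
    then show False using gen[of q e] bd \<open>e \<ge> 0\<close> N by blast
  next
    case True
    \<comment> \<open>For empty spectrum the argument applied to the polynomial \<open>X\<close>
      gives \<open>T = 0\<close>; as 0 is then no spectral value, the zero operator is invertible
      and the space is trivial.\<close>
    have "T = 0"
    proof (rule ccontr)
      assume "T \<noteq> 0"
      have "[:0, 1:] * [:0, 1:] - [:(norm T)\<^sup>2:] \<noteq> (0 :: real poly)" by simp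
      then show False using gen[of "[:0, 1:]" 0] \<open>T \<noteq> 0\<close> True by (simp add: op_poly_X)
    qed
    have "op_invertible T"
      using True real_spectrum_iff[of 0 T] by auto
    then have "id_blinfun = (0 :: 'a \<Rightarrow>\<^sub>L 'a)"
      unfolding op_invertible_def \<open>T = 0\<close> by auto
    then have "op_poly q T = 0" by (metis blinfun_compose_zero(1) id_blinfun_compose(1))
    then show False using N \<open>e \<ge> 0\<close> by simp
  qed
qed

section \<open>Continuous functional calculus as a limit of polynomials\<close>

lemma op_poly_convergent:
  fixes T :: "'a::chilbert \<Rightarrow>\<^sub>L 'a"
  assumes T: "selfadjoint T"
    and lim: "uniform_limit (real_spectrum T) (\<lambda>n. poly (q n)) f sequentially"
  shows "convergent (\<lambda>n. op_poly (q n) T)"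
proof -
  have "Cauchy (\<lambda>n. op_poly (q n) T)"
  proof (rule metric_CauchyI)
    fix e :: real assume "e > 0"
    then obtain n0 where n0: "\<And>n t. n \<ge> n0 \<Longrightarrow> t \<in> real_spectrum T \<Longrightarrow> dist (poly (q n) t) (f t) < e / 4"
      using lim[unfolded uniform_limit_iff eventually_sequentially, rule_format, of "e/4"] by auto
    show "\<exists>M. \<forall>m\<ge>M. \<forall>n\<ge>M. dist (op_poly (q m) T) (op_poly (q n) T) < e"
    proof (intro exI allI impI)
      fix m n assume "m \<ge> n0" "n \<ge> n0"
      have "norm (op_poly (q m - q n) T) \<le> e / 2"
      proof (rule norm_op_poly_le[OF T])
        show "\<bar>poly (q m - q n) t\<bar> \<le> e / 2" if "t \<in> real_spectrum T" for t
          using n0[OF \<open>m \<ge> n0\<close> that] n0[OF \<open>n \<ge> n0\<close> that] unfolding dist_real_def poly_diff by argo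
      qed (use \<open>e > 0\<close> in simp)
      then show "dist (op_poly (q m) T) (op_poly (q n) T) < e"
        using \<open>e > 0\<close> by (simp add: dist_norm op_poly_diff)
    qed
  qed
  then show ?thesis by (simp add: Cauchy_convergent_iff)
qed

text \<open>Two approximating sequences differ by polynomials tending to 0 uniformly on the
  spectrum. This independence of the sequence is what the description in \<open>cfc\<close>
  requires.\<close>

lemma op_poly_limit_unique:
  fixes T :: "'a::chilbert \<Rightarrow>\<^sub>L 'a"
  assumes T: "selfadjoint T"
    and q: "uniform_limit (real_spectrum T) (\<lambda>n. poly (q n)) f sequentially"
    and r: "uniform_limit (real_spectrum T) (\<lambda>n. poly (r n)) f sequentially"
    and B: "(\<lambda>n. op_poly (q n) T) \<longlonglongrightarrow> B"
  shows "(\<lambda>n. op_poly (r n) T) \<longlonglongrightarrow> B"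
proof -
  have "(\<lambda>n. op_poly (r n) T - op_poly (q n) T) \<longlonglongrightarrow> 0"
  proof (rule metric_LIMSEQ_I)
    fix e :: real assume "e > 0"
    have "uniform_limit (real_spectrum T) (\<lambda>n t. poly (r n) t - poly (q n) t) (\<lambda>t. f t - f t) sequentially"
      by (intro uniform_limit_intros q r)
    then obtain n0 where "\<forall>n\<ge>n0. \<forall>t\<in>real_spectrum T. dist (poly (r n) t - poly (q n) t) (f t - f t) < e / 2"
      using half_gt_zero[OF \<open>e > 0\<close>] unfolding uniform_limit_iff eventually_sequentially by blast
    then have n0: "\<bar>poly (r n) t - poly (q n) t\<bar> < e / 2" if "n \<ge> n0" "t \<in> real_spectrum T" for n t
      using that unfolding dist_real_def by simp
    show "\<exists>n0. \<forall>n\<ge>n0. dist (op_poly (r n) T - op_poly (q n) T) 0 < e"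
    proof (intro exI allI impI)
      fix n assume "n \<ge> n0"
      then have "norm (op_poly (r n - q n) T) \<le> e / 2"
        using n0 \<open>e > 0\<close> by (intro norm_op_poly_le[OF T]) (auto intro: less_imp_le)
      then show "dist (op_poly (r n) T - op_poly (q n) T) 0 < e"
        using \<open>e > 0\<close> by (simp add: op_poly_diff)
    qed
  qed
  from tendsto_add[OF this B] show ?thesis by simp
qed

lemma cfc_eqI:
  fixes T :: "'a::chilbert \<Rightarrow>\<^sub>L 'a"
  assumes T: "selfadjoint T"
    and q: "uniform_limit (real_spectrum T) (\<lambda>n. poly (q n)) f sequentially"
    and B: "(\<lambda>n. op_poly (q n) T) \<longlonglongrightarrow> B"
  shows "cfc f T = B"
  unfolding cfc_def
proof (rule the_equality)
  show "\<forall>q. uniform_limit (real_spectrum T) (\<lambda>n. poly (q n)) f sequentially \<longrightarrow> (\<lambda>n. op_poly (q n) T) \<longlonglongrightarrow> B"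
    using op_poly_limit_unique[OF T q _ B] by blast
  fix B' assume "\<forall>q. uniform_limit (real_spectrum T) (\<lambda>n. poly (q n)) f sequentially \<longrightarrow> (\<lambda>n. op_poly (q n) T) \<longlonglongrightarrow> B'"
  then show "B' = B" using q B LIMSEQ_unique by blast
qed

lemma tendsto_cfc:
  fixes T :: "'a::chilbert \<Rightarrow>\<^sub>L 'a"
  assumes T: "selfadjoint T"
    and q: "uniform_limit (real_spectrum T) (\<lambda>n. poly (q n)) f sequentially"
  shows "(\<lambda>n. op_poly (q n) T) \<longlonglongrightarrow> cfc f T"
  using op_poly_convergent[OF T q] cfc_eqI[OF T q] by (auto simp: convergent_def)

text \<open>For \<open>t\<close> outside the interval, \<open>T - t\<close> or \<open>t - T\<close>
  is coercive.\<close>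

lemma real_spectrum_positive_subset:
  fixes T :: "'a::chilbert \<Rightarrow>\<^sub>L 'a"
  assumes T: "T \<in> bop" "op_le 0 T" "op_le T (R *\<^sub>R id_blinfun)"
  shows "real_spectrum T \<subseteq> {0..R}"
proof -
  have sa: "selfadjoint T" using T selfadjoint_of_positive by blast
  have lower: "0 \<le> Re (cinner (blinfun_apply T x) x)" for x
    using T(2) by (simp add: op_le_iff_selfadjoint[OF selfadjoint_zero sa])
  have upper: "Re (cinner (blinfun_apply T x) x) \<le> R * (norm x)\<^sup>2" for x
    using T(3) by (simp add: op_le_iff_selfadjoint[OF sa] selfadjoint_scaleR selfadjoint_id
        blinfun.bilinear_simps cinner_simps cinner_self)
  have "t \<notin> real_spectrum T" if "t < 0" for t
    unfolding real_spectrum_iff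
  proof (rule op_invertible_coercive)
    show "selfadjoint (T - t *\<^sub>R id_blinfun)" by (intro selfadjoint_diff selfadjoint_scaleR selfadjoint_id sa)
    show "- t > 0" using that by simp
    show "- t * (norm x)\<^sup>2 \<le> Re (cinner (blinfun_apply (T - t *\<^sub>R id_blinfun) x) x)" for x
      using lower[of x] by (simp add: blinfun.bilinear_simps cinner_simps cinner_self)
  qed
  moreover have "t \<notin> real_spectrum T" if "t > R" for t
  proof -
    have "op_invertible (t *\<^sub>R id_blinfun - T)"
    proof (rule op_invertible_coercive)
      show "selfadjoint (t *\<^sub>R id_blinfun - T)" by (intro selfadjoint_diff selfadjoint_scaleR selfadjoint_id sa)
      show "t - R > 0" using that by simp
      show "(t - R) * (norm x)\<^sup>2 \<le> Re (cinner (blinfun_apply (t *\<^sub>R id_blinfun - T) x) x)" for x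
        using upper[of x] by (simp add: blinfun.bilinear_simps cinner_simps cinner_self algebra_simps)
    qed
    then obtain S where "S o\<^sub>L (t *\<^sub>R id_blinfun - T) = id_blinfun" "(t *\<^sub>R id_blinfun - T) o\<^sub>L S = id_blinfun"
      unfolding op_invertible_def by blast
    then have "(- S) o\<^sub>L (T - t *\<^sub>R id_blinfun) = id_blinfun" "(T - t *\<^sub>R id_blinfun) o\<^sub>L (- S) = id_blinfun"
      by (simp_all add: compose_simps)
    then show ?thesis unfolding real_spectrum_iff op_invertible_def by blast
  qed
  ultimately show ?thesis by (meson atLeastAtMost_iff not_le subsetI)
qed

text \<open>If \<open>0 \<le> q \<le> m\<close> on the spectrum, then
  \<open>\<bar>q - m\<bar> \<le> m\<close> there. So \<open>q(T)\<close> differs from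
  \<open>m\<close> by an operator of norm at most \<open>m\<close>, and its form cannot be
  negative.\<close>

lemma op_poly_nonneg:
  fixes T :: "'a::chilbert \<Rightarrow>\<^sub>L 'a"
  assumes T: "T \<in> bop" "op_le 0 T" "op_le T (R *\<^sub>R id_blinfun)"
    and q: "\<And>t. t \<in> {0..R} \<Longrightarrow> poly q t \<ge> 0"
  shows "op_le 0 (op_poly q T)"
proof -
  have sa: "selfadjoint T" using T selfadjoint_of_positive by blast
  have saq: "selfadjoint (op_poly q T)" by (rule selfadjoint_op_poly[OF sa])
  have "bounded (poly q ` {0..R})"
    by (intro compact_imp_bounded compact_continuous_image continuous_intros) auto
  then obtain m where "m > 0" and bd: "\<forall>y\<in>poly q ` {0..R}. norm y \<le> m"
    unfolding bounded_pos by blast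
  have m: "\<bar>poly q t\<bar> \<le> m" if "t \<in> {0..R}" for t
    using bd that by auto
  have "norm (op_poly (q - [:m:]) T) \<le> m"
  proof (rule norm_op_poly_le[OF sa])
    show "\<bar>poly (q - [:m:]) t\<bar> \<le> m" if "t \<in> real_spectrum T" for t
    proof -
      have "t \<in> {0..R}" using real_spectrum_positive_subset[OF T] that by blast
      then show ?thesis using m[of t] q[of t] \<open>m > 0\<close> by auto
    qed
  qed (use \<open>m > 0\<close> in simp)
  then have le: "norm (op_poly q T - m *\<^sub>R id_blinfun) \<le> m" by (simp add: op_poly_simps)
  have "0 \<le> Re (cinner (blinfun_apply (op_poly q T) x) x)" for x
  proof -
    have "\<bar>Re (cinner (blinfun_apply (op_poly q T - m *\<^sub>R id_blinfun) x) x)\<bar> \<le> norm (blinfun_apply (op_poly q T - m *\<^sub>R id_blinfun) x) * norm x"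
      by (rule Cauchy_Schwarz_abs_Re)
    also have "\<dots> \<le> (m * norm x) * norm x"
      by (intro mult_right_mono order_trans[OF norm_blinfun] le) auto
    finally show ?thesis
      by (simp add: blinfun.bilinear_simps cinner_simps cinner_self power2_eq_square)
  qed
  then show ?thesis by (simp add: op_le_iff_selfadjoint[OF selfadjoint_zero saq])
qed

text \<open>Weierstrass approximation; \<open>s > 0\<close> gives continuity at 0, where
  \<open>0 powr s = 0\<close>.\<close>

lemma powr_polynomial_approximation:
  fixes s R :: real
  assumes "s > 0"
  obtains g :: "nat \<Rightarrow> real poly" where
    "uniform_limit {0..R} (\<lambda>n. poly (g n)) (\<lambda>t. t powr s) sequentially"
proof -
  have cont: "continuous_on {0..R} (\<lambda>t. t powr s)"
    using assms by (intro continuous_on_powr' continuous_intros) auto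
  have "\<exists>g. \<forall>t\<in>{0..R}. \<bar>poly g t - t powr s\<bar> < 1 / Suc n" for n
  proof -
    obtain h where h: "real_polynomial_function h" "\<And>t. t \<in> {0..R} \<Longrightarrow> \<bar>t powr s - h t\<bar> < 1 / Suc n"
      using Stone_Weierstrass_real_polynomial_function[OF compact_Icc cont, of "1 / Suc n"] by auto
    then obtain a k where "h = (\<lambda>x. \<Sum>i\<le>k. a i * x ^ i)"
      using real_polynomial_function_iff_sum by auto
    then have "poly (\<Sum>i\<le>k. monom (a i) i) = h"
      by (simp add: fun_eq_iff poly_sum poly_monom)
    then have "\<forall>t\<in>{0..R}. \<bar>poly (\<Sum>i\<le>k. monom (a i) i) t - t powr s\<bar> < 1 / Suc n"
      using h(2) by (simp add: abs_minus_commute)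
    then show ?thesis by blast
  qed
  then obtain g where g: "\<And>n t. t \<in> {0..R} \<Longrightarrow> \<bar>poly (g n) t - t powr s\<bar> < 1 / Suc n" by metis
  have "uniform_limit {0..R} (\<lambda>n. poly (g n)) (\<lambda>t. t powr s) sequentially"
    unfolding uniform_limit_iff eventually_sequentially
  proof (intro allI impI)
    fix e :: real assume "e > 0"
    then obtain n0 :: nat where n0: "inverse (Suc n0) < e" using reals_Archimedean by blast
    have "dist (poly (g n) t) (t powr s) < e" if "n \<ge> n0" "t \<in> {0..R}" for n t
    proof -
      have "1 / Suc n \<le> inverse (Suc n0)" using that by (simp add: field_simps)
      then show ?thesis using g[OF that(2), of n] n0 by (simp add: dist_real_def)
    qed
    then show "\<exists>N. \<forall>n\<ge>N. \<forall>t\<in>{0..R}. dist (poly (g n) t) (t powr s) < e" by blast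
  qed
  then show ?thesis using that by blast
qed

subsection \<open>Powers and the modulus\<close>

lemma op_le_norm:
  fixes T :: "'a::chilbert \<Rightarrow>\<^sub>L 'a"
  assumes T: "selfadjoint T" and "norm T \<le> R"
  shows "op_le T (R *\<^sub>R id_blinfun)"
proof -
  have "Re (cinner (blinfun_apply T x) x) \<le> R * (norm x)\<^sup>2" for x
  proof -
    have "Re (cinner (blinfun_apply T x) x) \<le> norm (blinfun_apply T x) * norm x"
      by (rule Cauchy_Schwarz_Re)
    also have "\<dots> \<le> (norm T * norm x) * norm x" by (intro mult_right_mono norm_blinfun) auto
    also have "\<dots> \<le> (R * norm x) * norm x" using assms by (intro mult_right_mono) auto
    finally show ?thesis by (simp add: power2_eq_square)
  qed
  then show ?thesis
    by (simp add: op_le_iff_selfadjoint[OF T] selfadjoint_scaleR selfadjoint_id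
        blinfun.bilinear_simps cinner_simps cinner_self)
qed

lemma bop_limit:
  assumes "\<And>n. X n \<in> bop" "X \<longlonglongrightarrow> B" shows "B \<in> bop"
proof -
  have "blinfun_apply B (c *\<^sub>C x) = c *\<^sub>C blinfun_apply B x" for c x
  proof (rule LIMSEQ_unique)
    show "(\<lambda>n. blinfun_apply (X n) (c *\<^sub>C x)) \<longlonglongrightarrow> blinfun_apply B (c *\<^sub>C x)"
      by (intro tendsto_intros assms)
    have "(\<lambda>n. c *\<^sub>C blinfun_apply (X n) x) \<longlonglongrightarrow> c *\<^sub>C blinfun_apply B x"
      by (intro bounded_linear.tendsto[OF bounded_linear_scaleC] tendsto_intros assms)
    then show "(\<lambda>n. blinfun_apply (X n) (c *\<^sub>C x)) \<longlonglongrightarrow> c *\<^sub>C blinfun_apply B x"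
      using assms by (simp add: bopD)
  qed
  then show ?thesis by (simp add: bop_def)
qed

text \<open>Symmetry is passed to the limit through the continuous functionals
  \<open>Re (cinner _ y)\<close>; complex linearity of the limit then restores the imaginary
  part.\<close>

lemma selfadjoint_limit:
  fixes X :: "nat \<Rightarrow> ('a::chilbert \<Rightarrow>\<^sub>L 'a)"
  assumes X: "\<And>n. selfadjoint (X n)" and lim: "X \<longlonglongrightarrow> B" shows "selfadjoint B"
proof -
  have B: "B \<in> bop" using X lim bop_limit selfadjoint_bop by blast
  have re: "Re (cinner (blinfun_apply B x) y) = Re (cinner x (blinfun_apply B y))" for x y
  proof (rule LIMSEQ_unique)
    have l: "bounded_linear (\<lambda>x. Re (cinner x y))" for y :: 'a
      by (rule bounded_linear_intro[of _ "norm y"])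
        (simp_all add: cinner_simps Cauchy_Schwarz_abs_Re)
    show "(\<lambda>n. Re (cinner (blinfun_apply (X n) x) y)) \<longlonglongrightarrow> Re (cinner (blinfun_apply B x) y)"
      by (intro bounded_linear.tendsto[OF l] tendsto_intros lim)
    have "(\<lambda>n. Re (cinner (blinfun_apply (X n) y) x)) \<longlonglongrightarrow> Re (cinner (blinfun_apply B y) x)"
      by (intro bounded_linear.tendsto[OF l] tendsto_intros lim)
    then show "(\<lambda>n. Re (cinner (blinfun_apply (X n) x) y)) \<longlonglongrightarrow> Re (cinner x (blinfun_apply B y))"
      by (simp add: selfadjoint_cinner[OF X] Re_cinner_commute[of x])
  qed
  show ?thesis
  proof (rule selfadjointI[OF B])
    show "cinner (blinfun_apply B x) y = cinner x (blinfun_apply B y)" for x y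
      using re[of x y] re[of "\<i> *\<^sub>C x" y] by (simp add: bopD[OF B] cinner_scaleC_left complex_eq_iff)
  qed
qed

abbreviation op_powr :: "('a::chilbert \<Rightarrow>\<^sub>L 'a) \<Rightarrow> real \<Rightarrow> ('a \<Rightarrow>\<^sub>L 'a)" where
  "op_powr T s \<equiv> cfc (\<lambda>t. t powr s) T"

lemma tendsto_op_powr:
  assumes T: "T \<in> bop" "op_le 0 T" "op_le T (R *\<^sub>R id_blinfun)"
    and g: "uniform_limit {0..R} (\<lambda>n. poly (g n)) (\<lambda>t. t powr s) sequentially"
  shows "(\<lambda>n. op_poly (g n) T) \<longlonglongrightarrow> op_powr T s"
  using tendsto_cfc[OF selfadjoint_of_positive[OF T(1,2)]
      uniform_limit_on_subset[OF g real_spectrum_positive_subset[OF T]]] .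

lemma positive_le_norm:
  assumes T: "T \<in> bop" "op_le 0 T"
  shows "op_le T (norm T *\<^sub>R id_blinfun)"
  using op_le_norm[OF selfadjoint_of_positive[OF T]] by simp

lemma selfadjoint_op_powr:
  assumes T: "T \<in> bop" "op_le 0 T" and "s > 0"
  shows "selfadjoint (op_powr T s)"
proof -
  obtain g where g: "uniform_limit {0..norm T} (\<lambda>n. poly (g n)) (\<lambda>t. t powr s) sequentially"
    using powr_polynomial_approximation[OF \<open>s > 0\<close>] by blast
  show ?thesis
    by (rule selfadjoint_limit[OF _ tendsto_op_powr[OF T positive_le_norm[OF T] g]])
      (rule selfadjoint_op_poly[OF selfadjoint_of_positive[OF T]])
qed

lemma op_powr_compose:
  fixes T :: "'a::chilbert \<Rightarrow>\<^sub>L 'a"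
  assumes T: "T \<in> bop" "op_le 0 T" and "s > 0" "r > 0"
  shows "op_powr T s o\<^sub>L op_powr T r = op_powr T (s + r)"
proof -
  have bdd: "bounded ((\<lambda>t. t powr s) ` {0..norm T})" if "s > 0" for s
    using that by (intro compact_imp_bounded compact_continuous_image continuous_on_powr' continuous_intros) auto
  obtain g where g: "uniform_limit {0..norm T} (\<lambda>n. poly (g n)) (\<lambda>t. t powr s) sequentially"
    using powr_polynomial_approximation[OF \<open>s > 0\<close>] by blast
  obtain h where h: "uniform_limit {0..norm T} (\<lambda>n. poly (h n)) (\<lambda>t. t powr r) sequentially"
    using powr_polynomial_approximation[OF \<open>r > 0\<close>] by blast
  have "uniform_limit {0..norm T} (\<lambda>n t. poly (g n) t * poly (h n) t) (\<lambda>t. t powr s * t powr r) sequentially"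
    by (rule uniform_lim_mult[OF g h bdd[OF \<open>s > 0\<close>] bdd[OF \<open>r > 0\<close>]])
  then have "uniform_limit {0..norm T} (\<lambda>n. poly (g n * h n)) (\<lambda>t. t powr (s + r)) sequentially"
    by (simp add: powr_add poly_mult[abs_def])
  then have "(\<lambda>n. op_poly (g n * h n) T) \<longlonglongrightarrow> op_powr T (s + r)"
    by (rule tendsto_op_powr[OF T positive_le_norm[OF T]])
  moreover have "(\<lambda>n. op_poly (g n * h n) T) \<longlonglongrightarrow> (op_powr T s o\<^sub>L op_powr T r)"
    unfolding op_poly_mult
    by (intro bounded_bilinear.tendsto[OF bounded_bilinear_blinfun_compose]
        tendsto_op_powr[OF T positive_le_norm[OF T]] g h)
  ultimately show ?thesis using LIMSEQ_unique by blast
qed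

lemma op_powr_1:
  assumes T: "T \<in> bop" "op_le 0 T"
  shows "op_powr T 1 = T"
proof -
  have "uniform_limit {0..norm T} (\<lambda>n. poly [:0, 1:]) (\<lambda>t. t powr 1) sequentially"
    by (simp add: uniform_limit_iff)
  from tendsto_op_powr[OF T positive_le_norm[OF T] this] have "(\<lambda>n. T) \<longlonglongrightarrow> op_powr T 1"
    by (simp only: op_poly_X)
  then show ?thesis using LIMSEQ_unique tendsto_const by blast
qed

lemma op_powr_nonneg:
  assumes T: "T \<in> bop" "op_le 0 T" and "s > 0"
  shows "op_le 0 (op_powr T s)"
proof -
  have sa: "selfadjoint (op_powr T (s/2))" using selfadjoint_op_powr[OF T, of "s/2"] \<open>s > 0\<close> by simp
  have "op_powr T s = adj (op_powr T (s/2)) o\<^sub>L op_powr T (s/2)"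
    using op_powr_compose[OF T, of "s/2" "s/2"] \<open>s > 0\<close> sa by (simp add: selfadjoint_def)
  then show ?thesis using op_le_zero_adj_compose selfadjoint_bop[OF sa] by metis
qed

text \<open>Substituting the square of \<open>t\<close> into polynomials that approximate
  \<open>t powr s\<close> gives polynomials that approximate \<open>t powr (2 * s)\<close>.
  Uniqueness of positive square roots will follow.\<close>

lemma op_powr_square:
  fixes T :: "'a::chilbert \<Rightarrow>\<^sub>L 'a"
  assumes T: "T \<in> bop" "op_le 0 T" and "s > 0"
  shows "op_powr (T o\<^sub>L T) s = op_powr T (2 * s)"
proof -
  let ?R = "(norm T)\<^sup>2"
  have sa: "selfadjoint T" by (rule selfadjoint_of_positive[OF T])
  have TT: "T o\<^sub>L T \<in> bop" "op_le 0 (T o\<^sub>L T)" "op_le (T o\<^sub>L T) (?R *\<^sub>R id_blinfun)"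
    using op_le_zero_adj_compose[OF T(1)] sa
      op_le_norm[OF selfadjoint_square[OF sa], of ?R] norm_blinfun_compose[of T T]
    by (auto simp: selfadjoint_def bop_compose power2_eq_square)
  obtain g where g: "uniform_limit {0..?R} (\<lambda>n. poly (g n)) (\<lambda>t. t powr s) sequentially"
    using powr_polynomial_approximation[OF \<open>s > 0\<close>] by blast
  have "uniform_limit {0..norm T} (\<lambda>n. poly (pcompose (g n) [:0, 0, 1:])) (\<lambda>t. t powr (2 * s)) sequentially"
    unfolding uniform_limit_iff
  proof (intro allI impI)
    fix e :: real assume "e > 0"
    with g have "\<forall>\<^sub>F n in sequentially. \<forall>t\<in>{0..?R}. dist (poly (g n) t) (t powr s) < e"
      unfolding uniform_limit_iff by blast
    then show "\<forall>\<^sub>F n in sequentially. \<forall>t\<in>{0..norm T}. dist (poly (pcompose (g n) [:0, 0, 1:]) t) (t powr (2 * s)) < e"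
    proof eventually_elim
      case (elim n)
      show ?case
      proof
        fix t assume t: "t \<in> {0..norm T}"
        then have "t * t \<in> {0..?R}" by (auto simp: power2_eq_square intro: mult_mono)
        moreover have "(t * t) powr s = t powr (2 * s)"
          using t powr_powr[of t 2 s] by (cases "t = 0") (auto simp: power2_eq_square)
        ultimately show "dist (poly (pcompose (g n) [:0, 0, 1:]) t) (t powr (2 * s)) < e"
          using elim[rule_format, of "t * t"] by (simp add: poly_pcompose)
      qed
    qed
  qed
  from tendsto_op_powr[OF T positive_le_norm[OF T] this]
  have "(\<lambda>n. op_poly (g n) (T o\<^sub>L T)) \<longlonglongrightarrow> op_powr T (2 * s)"
    by (simp add: op_poly_pcompose op_poly_pCons compose_simps)
  then show ?thesis using tendsto_op_powr[OF TT g] LIMSEQ_unique by blast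
qed

text \<open>Uniqueness: a positive \<open>B\<close> with the required square satisfies
  \<open>B = op_powr B 1 = op_powr (B o\<^sub>L B) (1/2)\<close>, which depends on the square
  alone.\<close>

lemma modulus_eq:
  fixes A :: "'a::chilbert \<Rightarrow>\<^sub>L 'a"
  assumes A: "A \<in> bop"
  shows "modulus A = op_powr (adj A o\<^sub>L A) (1/2)"
  unfolding modulus_def
proof (rule the_equality)
  have AA: "adj A o\<^sub>L A \<in> bop" "op_le 0 (adj A o\<^sub>L A)"
    using A by (auto simp: bop_compose adj_bop op_le_zero_adj_compose)
  show "op_powr (adj A o\<^sub>L A) (1/2) \<in> bop \<and> op_le 0 (op_powr (adj A o\<^sub>L A) (1/2)) \<and>
      op_powr (adj A o\<^sub>L A) (1/2) o\<^sub>L op_powr (adj A o\<^sub>L A) (1/2) = adj A o\<^sub>L A"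
    using selfadjoint_op_powr[OF AA, of "1/2"] op_powr_nonneg[OF AA, of "1/2"]
      op_powr_compose[OF AA, of "1/2" "1/2"] op_powr_1[OF AA] by (simp add: selfadjoint_def)
  fix B assume B: "B \<in> bop \<and> op_le 0 B \<and> B o\<^sub>L B = adj A o\<^sub>L A"
  then show "B = op_powr (adj A o\<^sub>L A) (1/2)"
    using op_powr_square[of B "1/2"] op_powr_1[of B] by simp
qed

text \<open>This removes the modulus from the \<open>p\<close>-norm; only powers of
  \<open>adj A o\<^sub>L A\<close> remain.\<close>

lemma op_powr_modulus:
  fixes A :: "'a::chilbert \<Rightarrow>\<^sub>L 'a"
  assumes A: "A \<in> bop" and "p > 0"
  shows "op_powr (modulus A) p = op_powr (adj A o\<^sub>L A) (p / 2)"
proof -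
  have AA: "adj A o\<^sub>L A \<in> bop" "op_le 0 (adj A o\<^sub>L A)"
    using A by (auto simp: bop_compose adj_bop op_le_zero_adj_compose)
  have M: "modulus A \<in> bop" "op_le 0 (modulus A)" "modulus A o\<^sub>L modulus A = adj A o\<^sub>L A"
    using selfadjoint_op_powr[OF AA, of "1/2"] op_powr_nonneg[OF AA, of "1/2"]
      op_powr_compose[OF AA, of "1/2" "1/2"] op_powr_1[OF AA]
    by (simp_all add: selfadjoint_def modulus_eq[OF A])
  show ?thesis using op_powr_square[OF M(1,2), of "p/2"] \<open>p > 0\<close> by (simp add: M(3))
qed

lemma selfadjoint_square_eq_zero:
  assumes A: "selfadjoint A" and "A o\<^sub>L A = 0"
  shows "A = 0"
proof -
  have "blinfun_apply A (blinfun_apply A x) = 0" for x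
    by (metis assms(2) blinfun_apply_blinfun_compose zero_blinfun.rep_eq)
  then have "cinner (blinfun_apply A x) (blinfun_apply A x) = 0" for x
    by (simp add: selfadjoint_cinner[OF A, of x])
  then show ?thesis by (intro blinfun_eqI) (simp add: cinner_self)
qed

section \<open>Von Neumann algebras with a trace\<close>

lemma scaleC_op_of_real: "scaleC_op (complex_of_real r) A = r *\<^sub>R A"
  by (rule blinfun_eqI) (simp only: scaleC_op.rep_eq scaleR_blinfun.rep_eq scaleR_scaleC)

lemma commutant_add: "A \<in> commutant X \<Longrightarrow> B \<in> commutant X \<Longrightarrow> A + B \<in> commutant X"
  by (auto simp: commutant_def bop_add compose_simps)

lemma commutant_diff: "A \<in> commutant X \<Longrightarrow> B \<in> commutant X \<Longrightarrow> A - B \<in> commutant X"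
  by (auto simp: commutant_def bop_diff compose_simps)

lemma commutant_compose: "A \<in> commutant X \<Longrightarrow> B \<in> commutant X \<Longrightarrow> A o\<^sub>L B \<in> commutant X"
  by (auto simp: commutant_def bop_compose) (metis blinfun_compose_assoc)

lemma commutant_id: "id_blinfun \<in> commutant X"
  by (simp add: commutant_def bop_id)

lemma commutant_scaleC:
  assumes "X \<subseteq> bop" "A \<in> commutant X" shows "scaleC_op c A \<in> commutant X"
proof -
  have A: "A \<in> bop" "\<And>T. T \<in> X \<Longrightarrow> A o\<^sub>L T = T o\<^sub>L A" using assms by (auto simp: commutant_def)
  have "scaleC_op c A o\<^sub>L T = T o\<^sub>L scaleC_op c A" if "T \<in> X" for T
  proof (rule blinfun_eqI)
    fix x
    have "T \<in> bop" using that assms by blast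
    then show "blinfun_apply (scaleC_op c A o\<^sub>L T) x = blinfun_apply (T o\<^sub>L scaleC_op c A) x"
      using arg_cong[OF A(2)[OF that], of "\<lambda>S. blinfun_apply S x"]
      by (simp add: scaleC_op.rep_eq bopD)
  qed
  moreover have "scaleC_op c A \<in> bop"
    using A(1) by (simp add: bop_def scaleC_op.rep_eq scaleC_scaleC mult.commute)
  ultimately show ?thesis by (simp add: commutant_def)
qed

lemma commutant_limit:
  assumes "\<And>n. X n \<in> commutant N" "X \<longlonglongrightarrow> B" shows "B \<in> commutant N"
proof -
  have "B \<in> bop" using assms bop_limit[of X B] by (auto simp: commutant_def)
  moreover have "B o\<^sub>L T = T o\<^sub>L B" if "T \<in> N" for T
  proof (rule LIMSEQ_unique)
    show "(\<lambda>n. X n o\<^sub>L T) \<longlonglongrightarrow> (B o\<^sub>L T)"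
      by (intro bounded_bilinear.tendsto[OF bounded_bilinear_blinfun_compose] assms tendsto_const)
    have "(\<lambda>n. T o\<^sub>L X n) \<longlonglongrightarrow> (T o\<^sub>L B)"
      by (intro bounded_bilinear.tendsto[OF bounded_bilinear_blinfun_compose] assms tendsto_const)
    then show "(\<lambda>n. X n o\<^sub>L T) \<longlonglongrightarrow> (T o\<^sub>L B)"
      using assms(1) that by (simp add: commutant_def)
  qed
  ultimately show ?thesis by (simp add: commutant_def)
qed

text \<open>The trace is a parameter, so that the same facts serve a finite factor with
  \<open>trace_of\<close> and its tensor product with the two-by-two matrices.\<close>

locale traced_algebra =
  fixes M :: "('a::chilbert \<Rightarrow>\<^sub>L 'a) set" and \<tau> :: "('a \<Rightarrow>\<^sub>L 'a) \<Rightarrow> complex"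
  assumes vN: "von_neumann_algebra M"
    and trace: "tracial_state M \<tau>"
    and faithful: "faithful_state M \<tau>"
begin

lemma M_eq: "M = commutant (commutant M)" and M_bop: "A \<in> M \<Longrightarrow> A \<in> bop"
  and adj_M: "A \<in> M \<Longrightarrow> adj A \<in> M"
  using vN by (auto simp: von_neumann_algebra_def)

lemma commutant_bop: "commutant M \<subseteq> bop" by (auto simp: commutant_def)

text \<open>Here and below, closure properties are inherited from commutants, since \<open>M\<close>
  is the commutant of its own commutant.\<close>

lemma add_M: "A \<in> M \<Longrightarrow> B \<in> M \<Longrightarrow> A + B \<in> M" by (subst M_eq) (metis M_eq commutant_add)
lemma diff_M: "A \<in> M \<Longrightarrow> B \<in> M \<Longrightarrow> A - B \<in> M" by (subst M_eq) (metis M_eq commutant_diff)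
lemma compose_M: "A \<in> M \<Longrightarrow> B \<in> M \<Longrightarrow> A o\<^sub>L B \<in> M" by (subst M_eq) (metis M_eq commutant_compose)
lemma id_M: "id_blinfun \<in> M" by (subst M_eq) (rule commutant_id)
lemma scaleC_M: "A \<in> M \<Longrightarrow> scaleC_op c A \<in> M"
  by (subst M_eq) (metis M_eq commutant_scaleC commutant_bop)
lemma scaleR_M: "A \<in> M \<Longrightarrow> r *\<^sub>R A \<in> M"
  using scaleC_M[of A "complex_of_real r"] by (simp add: scaleC_op_of_real)
lemma zero_M: "0 \<in> M" using diff_M[OF id_M id_M] by simp
lemma limit_M: "(\<And>n. X n \<in> M) \<Longrightarrow> X \<longlonglongrightarrow> B \<Longrightarrow> B \<in> M"
  by (subst M_eq) (metis M_eq commutant_limit)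

lemmas M_intros = add_M diff_M compose_M id_M scaleC_M scaleR_M zero_M adj_M

lemma op_poly_M: "A \<in> M \<Longrightarrow> op_poly q A \<in> M"
  by (induction q) (auto simp: op_poly_pCons intro!: M_intros)

lemma op_powr_M:
  assumes T: "T \<in> M" "op_le 0 T" and "s > 0"
  shows "op_powr T s \<in> M"
proof -
  have b: "T \<in> bop" using T M_bop by blast
  obtain g where g: "uniform_limit {0..norm T} (\<lambda>n. poly (g n)) (\<lambda>t. t powr s) sequentially"
    using powr_polynomial_approximation[OF \<open>s > 0\<close>] by blast
  show ?thesis
    by (rule limit_M[OF op_poly_M[OF T(1)] tendsto_op_powr[OF b T(2) positive_le_norm[OF b T(2)] g]])
qed

lemma trace_add: "A \<in> M \<Longrightarrow> B \<in> M \<Longrightarrow> \<tau> (A + B) = \<tau> A + \<tau> B"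
  and trace_scaleC: "A \<in> M \<Longrightarrow> \<tau> (scaleC_op c A) = c * \<tau> A"
  and trace_pos: "A \<in> M \<Longrightarrow> op_le 0 A \<Longrightarrow> \<tau> A \<in> \<real>\<^sub>\<ge>\<^sub>0"
  and trace_id: "\<tau> id_blinfun = 1"
  and trace_commute: "A \<in> M \<Longrightarrow> B \<in> M \<Longrightarrow> \<tau> (A o\<^sub>L B) = \<tau> (B o\<^sub>L A)"
  using trace by (auto simp: tracial_state_def)

lemma trace_scaleR: "A \<in> M \<Longrightarrow> \<tau> (r *\<^sub>R A) = r * \<tau> A"
  using trace_scaleC[of A "complex_of_real r"] by (simp add: scaleC_op_of_real)

lemma trace_diff: "A \<in> M \<Longrightarrow> B \<in> M \<Longrightarrow> \<tau> (A - B) = \<tau> A - \<tau> B"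
  using trace_add[of A "(-1) *\<^sub>R B"] trace_scaleR[of B "-1"] scaleR_M[of B "-1"] by simp

lemma trace_mono: "A \<in> M \<Longrightarrow> B \<in> M \<Longrightarrow> op_le A B \<Longrightarrow> Re (\<tau> A) \<le> Re (\<tau> B)"
  using trace_pos[of "B - A"] diff_M[of B A] trace_diff[of B A]
  by (auto simp: op_le_def complex_nonneg_Reals_iff)

lemma Re_trace_le_norm:
  assumes "A \<in> M" "selfadjoint A" shows "Re (\<tau> A) \<le> norm A"
  using trace_mono[OF assms(1) scaleR_M[OF id_M] op_le_norm[OF assms(2) order_refl]]
  by (simp add: trace_scaleR id_M trace_id)

text \<open>Norm continuity comes from positivity alone: a self-adjoint \<open>A\<close> lies below
  \<open>norm A\<close> times the identity, so its trace is at most \<open>norm A\<close>.\<close>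

lemma tendsto_Re_trace:
  assumes X: "\<And>n. X n \<in> M" "\<And>n. selfadjoint (X n)" and lim: "X \<longlonglongrightarrow> B"
  shows "(\<lambda>n. Re (\<tau> (X n))) \<longlonglongrightarrow> Re (\<tau> B)"
proof -
  have B: "B \<in> M" "selfadjoint B" using X lim limit_M selfadjoint_limit by blast+
  have "\<bar>Re (\<tau> (X n)) - Re (\<tau> B)\<bar> \<le> norm (X n - B)" for n
    using Re_trace_le_norm[OF diff_M[OF X(1)[of n] B(1)] selfadjoint_diff[OF X(2)[of n] B(2)]]
      Re_trace_le_norm[OF diff_M[OF B(1) X(1)[of n]] selfadjoint_diff[OF B(2) X(2)[of n]]]
    by (simp add: trace_diff X B norm_minus_commute)
  then have "\<forall>\<^sub>F n in sequentially. norm (Re (\<tau> (X n)) - Re (\<tau> B)) \<le> norm (X n - B)"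
    by simp
  moreover have "(\<lambda>n. norm (X n - B)) \<longlonglongrightarrow> 0"
    using lim by (simp add: LIM_zero_iff tendsto_norm_zero)
  ultimately have "(\<lambda>n. Re (\<tau> (X n)) - Re (\<tau> B)) \<longlonglongrightarrow> 0"
    by (rule Lim_null_comparison)
  then show ?thesis by (simp add: LIM_zero_iff)
qed

lemma tendsto_Re_trace_op_powr:
  assumes T: "T \<in> M" "op_le 0 T" "op_le T (R *\<^sub>R id_blinfun)"
    and g: "uniform_limit {0..R} (\<lambda>n. poly (g n)) (\<lambda>t. t powr s) sequentially"
  shows "(\<lambda>n. Re (\<tau> (op_poly (g n) T))) \<longlonglongrightarrow> Re (\<tau> (op_powr T s))"
  by (rule tendsto_Re_trace[OF _ _ tendsto_op_powr[OF M_bop[OF T(1)] T(2,3) g]])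
    (intro op_poly_M selfadjoint_op_poly selfadjoint_of_positive M_bop T)+

lemma Re_trace_op_powr_nonneg:
  assumes "T \<in> M" "op_le 0 T" "s > 0"
  shows "0 \<le> Re (\<tau> (op_powr T s))"
  using trace_pos[OF op_powr_M[OF assms] op_powr_nonneg[OF M_bop assms(2,3)]] assms(1)
  by (auto simp: complex_nonneg_Reals_iff)

lemma faithful_square:
  assumes "A \<in> M" "selfadjoint A" "Re (\<tau> (A o\<^sub>L A)) \<le> 0"
  shows "A = 0"
proof -
  have AA: "A o\<^sub>L A \<in> M" "op_le 0 (A o\<^sub>L A)"
    using assms op_le_zero_adj_compose[OF selfadjoint_bop[OF assms(2)]]
    by (auto simp: compose_M selfadjoint_def)
  then have "\<tau> (A o\<^sub>L A) = 0"
    using trace_pos[OF AA] assms(3) by (simp add: complex_nonneg_Reals_iff complex_eq_iff)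
  then have "A o\<^sub>L A = 0" using faithful AA by (simp add: faithful_state_def)
  then show ?thesis by (rule selfadjoint_square_eq_zero[OF assms(2)])
qed

text \<open>A function that is nonnegative with a single zero \<open>t\<^sub>0\<close> dominates, up to arbitrarily small
  errors, a multiple of \<open>(t - t\<^sub>0)\<^sup>2\<close>, which the faithful trace detects.\<close>

lemma scalar_of_trace_eq_zero:
  fixes h :: "real \<Rightarrow> real"
  assumes T: "T \<in> M" "op_le 0 T" "op_le T id_blinfun"
    and lim: "uniform_limit {0..1} (\<lambda>n. poly (q n)) h sequentially"
    and h: "continuous_on {0..1} h" "\<And>t. t \<in> {0..1} \<Longrightarrow> h t \<ge> 0" "\<And>t. t \<in> {0..1} \<Longrightarrow> h t = 0 \<Longrightarrow> t = t0"
    and tr: "(\<lambda>n. Re (\<tau> (op_poly (q n) T))) \<longlonglongrightarrow> 0" and t0: "t0 \<in> {0..1}"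
  shows "T = t0 *\<^sub>R id_blinfun"
proof -
  define D where "D = T - t0 *\<^sub>R id_blinfun"
  have sa: "selfadjoint T" using T M_bop selfadjoint_of_positive by blast
  have D: "D \<in> M" "selfadjoint D"
    unfolding D_def using T sa by (auto intro!: M_intros selfadjoint_diff selfadjoint_scaleR selfadjoint_id)
  define r where "r = [:- t0, 1:] * [:- t0, 1:]"
  have r: "op_poly r T = D o\<^sub>L D"
    unfolding r_def op_poly_mult by (simp add: op_poly_pCons D_def compose_scaleR_right)
  have "Re (\<tau> (D o\<^sub>L D)) \<le> \<epsilon>" if "\<epsilon> > 0" for \<epsilon>
  proof -
    \<comment> \<open>On the compact set \<open>K\<close>, \<open>h\<close> has a positive lower
      bound \<open>m\<close>. Off \<open>K\<close> the parabola
      \<open>(t - t0)\<^sup>2 - \<epsilon>\<close> is negative, and it never exceeds 1, so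
      \<open>m\<close> times it stays below \<open>h\<close> on the whole interval.\<close>
    define K where "K = {t \<in> {0..1}. \<epsilon> \<le> (t - t0)\<^sup>2}"
    have "K = {0..1} \<inter> {t. \<epsilon> \<le> (t - t0)\<^sup>2}" by (auto simp: K_def)
    then have "compact K"
      by (auto intro!: compact_Int_closed closed_Collect_le continuous_intros)
    have "\<exists>m>0. \<forall>t\<in>K. m \<le> h t"
    proof (cases "K = {}")
      case True
      then show ?thesis by (auto intro: exI[of _ 1])
    next
      case False
      have "continuous_on K h" using h(1) by (rule continuous_on_subset) (auto simp: K_def)
      then obtain u where u: "u \<in> K" "\<forall>t\<in>K. h u \<le> h t"
        using continuous_attains_inf[OF \<open>compact K\<close> False] by blast
      have "h u \<noteq> 0" using h(3)[of u] u(1) \<open>\<epsilon> > 0\<close> by (auto simp: K_def)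
      then have "h u > 0" using h(2)[of u] u(1) by (auto simp: K_def less_le)
      then show ?thesis using u by blast
    qed
    then obtain m where m: "m > 0" "\<And>t. t \<in> K \<Longrightarrow> m \<le> h t" by blast
    have low: "m * ((t - t0)\<^sup>2 - \<epsilon>) \<le> h t" if t: "t \<in> {0..1}" for t
    proof (cases "t \<in> K")
      case True
      have "(t - t0)\<^sup>2 \<le> 1"
        using t t0 power_mono[of "\<bar>t - t0\<bar>" 1 2] by auto
      then have "m * ((t - t0)\<^sup>2 - \<epsilon>) \<le> m * 1" using m(1) \<open>\<epsilon> > 0\<close> by (intro mult_left_mono) auto
      then show ?thesis using m(2)[OF True] by simp
    next
      case False
      then have "m * ((t - t0)\<^sup>2 - \<epsilon>) \<le> 0"
        using t m(1) by (intro mult_nonneg_nonpos) (auto simp: K_def)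
      then show ?thesis using h(2)[OF t] by simp
    qed
    have "m * (Re (\<tau> (D o\<^sub>L D)) - \<epsilon>) \<le> 0 + \<eta>" if "\<eta> > 0" for \<eta>
    proof -
      have "\<forall>\<^sub>F n in sequentially. m * (Re (\<tau> (D o\<^sub>L D)) - \<epsilon>) - \<eta> \<le> Re (\<tau> (op_poly (q n) T))"
        using uniform_limitD[OF lim \<open>\<eta> > 0\<close>]
      proof eventually_elim
        case (elim n)
        \<comment> \<open>The constant \<open>\<eta>\<close> absorbs the error of \<open>q n\<close>
          against \<open>h\<close>, so \<open>k\<close> is nonnegative on the interval and
          \<open>k(T)\<close> has nonnegative trace.\<close>
        define k where "k = q n - smult m (r - [:\<epsilon>:]) + [:\<eta>:]"
        have "op_le 0 (op_poly k T)"
        proof (rule op_poly_nonneg)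
          show "T \<in> bop" "op_le 0 T" "op_le T (1 *\<^sub>R id_blinfun)" using T M_bop by auto
          fix t :: real assume t: "t \<in> {0..1}"
          then have "\<bar>poly (q n) t - h t\<bar> < \<eta>" using elim by (auto simp: dist_real_def)
          then show "poly k t \<ge> 0"
            using low[OF t] by (simp add: k_def r_def power2_eq_square algebra_simps)
        qed
        then have "0 \<le> Re (\<tau> (op_poly k T))"
          using trace_pos[OF op_poly_M[OF T(1)]] by (auto simp: complex_nonneg_Reals_iff)
        also have "op_poly k T = op_poly (q n) T - m *\<^sub>R ((D o\<^sub>L D) - \<epsilon> *\<^sub>R id_blinfun) + \<eta> *\<^sub>R id_blinfun"
          by (simp add: k_def op_poly_simps r)
        also have "Re (\<tau> \<dots>) = Re (\<tau> (op_poly (q n) T)) - m * (Re (\<tau> (D o\<^sub>L D)) - \<epsilon>) + \<eta>"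
          by (simp add: trace_add trace_diff trace_scaleR trace_id M_intros D op_poly_M T)
        finally show ?case by simp
      qed
      from tendsto_lowerbound[OF tr this] show ?thesis by simp
    qed
    then have "m * (Re (\<tau> (D o\<^sub>L D)) - \<epsilon>) \<le> 0" by (rule field_le_epsilon)
    then show ?thesis using m(1) by (simp add: mult_le_0_iff)
  qed
  then have "Re (\<tau> (D o\<^sub>L D)) \<le> 0" by (simp add: field_le_epsilon)
  then have "D = 0" using faithful_square D by blast
  then show ?thesis by (simp add: D_def)
qed

end

section \<open>Two-by-two block operators\<close>

text \<open>The operator matrix with rows \<open>a b\<close> and \<open>c d\<close>, written with
  elementary tensors so that it visibly belongs to \<open>tensor_M2\<close> when its entries lie in
  the algebra.\<close>

definition blk :: "('a::chilbert \<Rightarrow>\<^sub>L 'a) \<Rightarrow> ('a \<Rightarrow>\<^sub>L 'a) \<Rightarrow> ('a \<Rightarrow>\<^sub>L 'a) \<Rightarrow> ('a \<Rightarrow>\<^sub>L 'a) \<Rightarrow> (('a ^ 2) \<Rightarrow>\<^sub>L ('a ^ 2))" where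
  "blk a b c d = a \<otimes>\<^sub>M matrix_unit 1 1 + b \<otimes>\<^sub>M matrix_unit 1 2
     + c \<otimes>\<^sub>M matrix_unit 2 1 + d \<otimes>\<^sub>M matrix_unit 2 2"

lemma blk_nth [simp]:
  "blinfun_apply (blk a b c d) v $ 1 = blinfun_apply a (v $ 1) + blinfun_apply b (v $ 2)"
  "blinfun_apply (blk a b c d) v $ 2 = blinfun_apply c (v $ 1) + blinfun_apply d (v $ 2)"
  by (simp_all add: blk_def plus_blinfun.rep_eq op_tensor.rep_eq sum_2 matrix_unit_def scaleC_one)

lemma blk_eqI:
  assumes "\<And>v. blinfun_apply T v $ 1 = blinfun_apply a (v $ 1) + blinfun_apply b (v $ 2)"
    and "\<And>v. blinfun_apply T v $ 2 = blinfun_apply c (v $ 1) + blinfun_apply d (v $ 2)"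
  shows "T = blk a b c d"
  by (rule blinfun_eqI) (simp add: vec_eq_iff forall_2 assms)

lemma blk_eq_iff: "blk a b c d = blk a' b' c' d' \<longleftrightarrow> a = a' \<and> b = b' \<and> c = c' \<and> d = d'"
proof
  assume eq: "blk a b c d = blk a' b' c' d'"
  have "blinfun_apply (blk a b c d) v $ i = blinfun_apply (blk a' b' c' d') v $ i" for v i
    using eq by simp
  note this[of "axis _ _" 1, simplified axis_def blk_nth, simplified]
    this[of "axis _ _" 2, simplified axis_def blk_nth, simplified]
  from this[of 1] this[of 2] show "a = a' \<and> b = b' \<and> c = c' \<and> d = d'"
    by (auto intro!: blinfun_eqI)
qed auto

lemma ex_blk: "\<exists>a b c d. T = blk a b c d"
proof -
  define e where "e i j = Blinfun (\<lambda>x. blinfun_apply T (axis j x) $ i)" for i j :: 2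
  have ax: "bounded_linear (axis j :: 'a \<Rightarrow> 'a ^ 2)" for j
  proof (rule bounded_linear_intro[of _ 1])
    show "norm (axis j x) \<le> norm x * 1" for x :: 'a
      by (simp add: norm_vec_def L2_set_def axis_def if_distrib sum_2 exhaust_2 cong: if_cong)
  qed (auto simp: axis_def vec_eq_iff)
  have e: "blinfun_apply (e i j) x = blinfun_apply T (axis j x) $ i" for i j x
    unfolding e_def
    by (subst bounded_linear_Blinfun_apply)
      (auto intro!: bounded_linear_compose[OF bounded_linear_vec_nth]
        bounded_linear_compose[OF blinfun.bounded_linear_right ax])
  have "v = axis 1 (v $ 1) + axis 2 (v $ 2)" for v :: "'a ^ 2"
    by (simp add: vec_eq_iff forall_2 axis_def)
  then have "blinfun_apply T v = blinfun_apply T (axis 1 (v $ 1)) + blinfun_apply T (axis 2 (v $ 2))" for v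
    by (metis blinfun.add_right)
  then have "T = blk (e 1 1) (e 1 2) (e 2 1) (e 2 2)"
    by (intro blk_eqI) (metis e vector_add_component)+
  then show ?thesis by blast
qed

lemma blk_compose:
  "blk a b c d o\<^sub>L blk a' b' c' d' =
    blk ((a o\<^sub>L a') + (b o\<^sub>L c')) ((a o\<^sub>L b') + (b o\<^sub>L d')) ((c o\<^sub>L a') + (d o\<^sub>L c')) ((c o\<^sub>L b') + (d o\<^sub>L d'))"
  by (rule blk_eqI) (simp_all add: blinfun.bilinear_simps algebra_simps)

lemma blk_add: "blk a b c d + blk a' b' c' d' = blk (a + a') (b + b') (c + c') (d + d')"
  by (rule blk_eqI) (simp_all add: blinfun.bilinear_simps algebra_simps)

lemma blk_diff: "blk a b c d - blk a' b' c' d' = blk (a - a') (b - b') (c - c') (d - d')"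
  by (rule blk_eqI) (simp_all add: blinfun.bilinear_simps algebra_simps)

lemma blk_scaleR: "r *\<^sub>R blk a b c d = blk (r *\<^sub>R a) (r *\<^sub>R b) (r *\<^sub>R c) (r *\<^sub>R d)"
  by (rule blk_eqI) (simp_all add: blinfun.bilinear_simps algebra_simps)

lemma blk_scaleC:
  "scaleC_op z (blk a b c d) = blk (scaleC_op z a) (scaleC_op z b) (scaleC_op z c) (scaleC_op z d)"
  by (rule blk_eqI) (simp_all add: scaleC_op.rep_eq scaleC_vec_def scaleC_add_right)

lemma blk_id: "id_blinfun = blk id_blinfun 0 0 id_blinfun"
  by (rule blk_eqI) simp_all

lemma blk_zero: "0 = blk 0 0 0 0"
  by (rule blk_eqI) simp_all

lemmas blk_simps = blk_compose blk_add blk_diff blk_scaleR blk_scaleC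

lemma op_tensor_eq_blk:
  "A \<otimes>\<^sub>M X = blk (scaleC_op (X $ 1 $ 1) A) (scaleC_op (X $ 1 $ 2) A) (scaleC_op (X $ 2 $ 1) A) (scaleC_op (X $ 2 $ 2) A)"
  by (rule blk_eqI) (simp_all add: op_tensor.rep_eq sum_2 scaleC_op.rep_eq)

lemma cinner_vec2: "cinner v w = cinner (v $ 1) (w $ 1) + cinner (v $ 2) (w $ (2::2))"
  by (simp add: cinner_vec_def sum_2)

lemma scaleC_op_one: "scaleC_op 1 A = A"
  by (rule blinfun_eqI) (simp add: scaleC_op.rep_eq scaleC_one)

lemma scaleC_op_zero: "scaleC_op 0 A = 0"
  by (rule blinfun_eqI) (simp add: scaleC_op.rep_eq)

lemma scaleC_op_zero_right: "scaleC_op z 0 = 0"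
  by (rule blinfun_eqI) (simp add: scaleC_op.rep_eq)

text \<open>Complex linearity as a commutation relation, so that for block operators it can be read
  off entrywise from \<open>blk_compose\<close>.\<close>

lemma bop_iff_commute:
  "T \<in> bop \<longleftrightarrow> (\<forall>z. T o\<^sub>L scaleC_op z id_blinfun = scaleC_op z id_blinfun o\<^sub>L T)"
proof -
  have "(T o\<^sub>L scaleC_op z id_blinfun = scaleC_op z id_blinfun o\<^sub>L T) \<longleftrightarrow>
      (\<forall>x. blinfun_apply (T o\<^sub>L scaleC_op z id_blinfun) x = blinfun_apply (scaleC_op z id_blinfun o\<^sub>L T) x)" for z
    by (metis blinfun_eqI)
  then show ?thesis by (simp add: bop_def scaleC_op.rep_eq)
qed

lemma bop_blk:
  fixes a b c d :: "'a::chilbert \<Rightarrow>\<^sub>L 'a"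
  shows "blk a b c d \<in> bop \<longleftrightarrow> a \<in> bop \<and> b \<in> bop \<and> c \<in> bop \<and> d \<in> bop"
proof -
  have "(scaleC_op z id_blinfun :: ('a ^ 2) \<Rightarrow>\<^sub>L ('a ^ 2)) = blk (scaleC_op z id_blinfun) 0 0 (scaleC_op z id_blinfun)" for z
    by (rule blk_eqI) (simp_all add: scaleC_op.rep_eq scaleC_vec_def)
  then show ?thesis
    unfolding bop_iff_commute by (simp add: blk_compose blk_eq_iff) blast
qed

lemma adj_blk:
  assumes "a \<in> bop" "b \<in> bop" "c \<in> bop" "d \<in> bop"
  shows "adj (blk a b c d) = blk (adj a) (adj c) (adj b) (adj d)"
  by (rule adj_eqI) (simp add: cinner_vec2 cinner_simps cinner_adj_right assms)

lemma op_le_blk_diag: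
  assumes "op_le 0 (blk a b c d)"
  shows "op_le 0 a" "op_le 0 d"
proof -
  have *: "cinner (blinfun_apply (blk a b c d) v) v \<in> \<real>\<^sub>\<ge>\<^sub>0" for v
    using assms by (simp add: op_le_def)
  show "op_le 0 a"
    unfolding op_le_def
  proof
    show "cinner (blinfun_apply (a - 0) x) x \<in> \<real>\<^sub>\<ge>\<^sub>0" for x
      using *[of "axis 1 x"] by (simp add: cinner_vec2 axis_def)
  qed
  show "op_le 0 d"
    unfolding op_le_def
  proof
    show "cinner (blinfun_apply (d - 0) x) x \<in> \<real>\<^sub>\<ge>\<^sub>0" for x
      using *[of "axis 2 x"] by (simp add: cinner_vec2 axis_def)
  qed
qed

lemma op_le_blk_corner: "op_le 0 a \<Longrightarrow> op_le 0 (blk a 0 0 0)"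
  by (simp add: op_le_def cinner_vec2)

text \<open>The form of such an operator is a pure cross term. Replacing \<open>x\<close> by
  \<open>- x\<close> changes its sign, so it vanishes; replacing \<open>x\<close> by
  \<open>\<i> *\<^sub>C x\<close> then separates the contributions of \<open>b\<close> and
  \<open>c\<close>.\<close>

lemma blk_off_diagonal_zero:
  assumes bop: "b \<in> bop" "c \<in> bop" and pos: "op_le 0 (blk 0 b c 0)"
  shows "b = 0 \<and> c = 0"
proof -
  have nn: "cinner (blinfun_apply b y) x + cinner (blinfun_apply c x) y \<in> \<real>\<^sub>\<ge>\<^sub>0" for x y
  proof -
    have "cinner (blinfun_apply (blk 0 b c 0) (axis 1 x + axis 2 y)) (axis 1 x + axis 2 y) \<in> \<real>\<^sub>\<ge>\<^sub>0"
      using pos by (simp add: op_le_def)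
    then show ?thesis by (simp add: cinner_vec2 axis_def)
  qed
  have eq: "cinner (blinfun_apply b y) x + cinner (blinfun_apply c x) y = 0" for x y
    using nn[of y x] nn[of y "-x"]
    by (simp add: blinfun.bilinear_simps cinner_simps complex_nonneg_Reals_iff complex_eq_iff)
  have "cinner (blinfun_apply b y) x = 0" "cinner (blinfun_apply c x) y = 0" for x y
    using eq[of y x] eq[of y "\<i> *\<^sub>C x"]
    by (simp_all add: bopD[OF bop(2)] cinner_simps complex_eq_iff)
  then have "cinner (blinfun_apply b y) (blinfun_apply b y) = 0" "cinner (blinfun_apply c y) (blinfun_apply c y) = 0" for y
    by blast+
  then show ?thesis by (auto intro!: blinfun_eqI simp: cinner_self)
qed

lemma op_poly_blk_diag: "op_poly q (blk a 0 0 d) = blk (op_poly q a) 0 0 (op_poly q d)"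
proof (induction q)
  case 0
  show ?case by (simp add: blk_zero)
next
  case (pCons c q)
  then show ?case by (simp add: op_poly_pCons blk_id blk_simps)
qed

section \<open>The tensor product with two-by-two matrices\<close>

lemma commutantD: "T \<in> commutant X \<Longrightarrow> S \<in> X \<Longrightarrow> T o\<^sub>L S = S o\<^sub>L T"
  by (simp add: commutant_def)

lemma commutant_antimono: "X \<subseteq> Y \<Longrightarrow> commutant Y \<subseteq> commutant X"
  by (auto simp: commutant_def)

lemma subset_double_commutant: "X \<subseteq> bop \<Longrightarrow> X \<subseteq> commutant (commutant X)"
  by (auto simp: commutant_def)

lemma triple_commutant:
  assumes "X \<subseteq> bop" shows "commutant (commutant (commutant X)) = commutant X"
proof
  show "commutant (commutant (commutant X)) \<subseteq> commutant X"
    by (rule commutant_antimono[OF subset_double_commutant[OF assms]])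
  show "commutant X \<subseteq> commutant (commutant (commutant X))"
    by (rule subset_double_commutant) (auto simp: commutant_def)
qed

context traced_algebra
begin

lemma elementary_tensors_bop: "{A \<otimes>\<^sub>M X | A X. A \<in> M} \<subseteq> (bop :: (('a ^ 2) \<Rightarrow>\<^sub>L ('a ^ 2)) set)"
  using M_bop scaleC_M by (auto simp: op_tensor_eq_blk bop_blk)

text \<open>For \<open>C\<close> in the commutant of \<open>M\<close>, the operator
  \<open>blk C 0 0 C\<close> commutes with all elementary tensors. Commuting with these puts every
  entry into the double commutant of \<open>M\<close>, which is \<open>M\<close>.\<close>

lemma tensor_M2_eq: "tensor_M2 M = {blk a b c d | a b c d. a \<in> M \<and> b \<in> M \<and> c \<in> M \<and> d \<in> M}"
proof
  let ?S = "{A \<otimes>\<^sub>M X | A X. A \<in> M} :: (('a ^ 2) \<Rightarrow>\<^sub>L ('a ^ 2)) set"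
  have sub: "?S \<subseteq> tensor_M2 M"
    unfolding tensor_M2_def by (rule subset_double_commutant[OF elementary_tensors_bop])
  show "{blk a b c d | a b c d. a \<in> M \<and> b \<in> M \<and> c \<in> M \<and> d \<in> M} \<subseteq> tensor_M2 M"
  proof clarify
    fix a b c d assume "a \<in> M" "b \<in> M" "c \<in> M" "d \<in> M"
    then have "a \<otimes>\<^sub>M matrix_unit 1 1 \<in> tensor_M2 M" "b \<otimes>\<^sub>M matrix_unit 1 2 \<in> tensor_M2 M"
      "c \<otimes>\<^sub>M matrix_unit 2 1 \<in> tensor_M2 M" "d \<otimes>\<^sub>M matrix_unit 2 2 \<in> tensor_M2 M"
      using sub by blast+
    then show "blk a b c d \<in> tensor_M2 M"
      unfolding blk_def tensor_M2_def by (intro commutant_add)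
  qed
  show "tensor_M2 M \<subseteq> {blk a b c d | a b c d. a \<in> M \<and> b \<in> M \<and> c \<in> M \<and> d \<in> M}"
  proof
    fix T assume T: "T \<in> tensor_M2 M"
    obtain a b c d where blk: "T = blk a b c d" using ex_blk by blast
    have "T \<in> bop" using T by (simp add: tensor_M2_def commutant_def)
    then have bop: "a \<in> bop" "b \<in> bop" "c \<in> bop" "d \<in> bop" by (simp_all add: blk bop_blk)
    have "a o\<^sub>L C = C o\<^sub>L a \<and> b o\<^sub>L C = C o\<^sub>L b \<and> c o\<^sub>L C = C o\<^sub>L c \<and> d o\<^sub>L C = C o\<^sub>L d"
      if C: "C \<in> commutant M" for C
    proof -
      have "blk C 0 0 C \<in> commutant ?S"
      proof -
        have "blk C 0 0 C \<in> bop" using C by (simp add: bop_blk bop_zero commutant_def)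
        moreover have "blk C 0 0 C o\<^sub>L A \<otimes>\<^sub>M X = A \<otimes>\<^sub>M X o\<^sub>L blk C 0 0 C" if "A \<in> M" for A X
        proof -
          have "C o\<^sub>L scaleC_op z A = scaleC_op z A o\<^sub>L C" for z
            using C scaleC_M[OF that] by (auto simp: commutant_def)
          then show ?thesis by (simp add: op_tensor_eq_blk blk_compose)
        qed
        ultimately show ?thesis by (auto simp: commutant_def)
      qed
      then have "T o\<^sub>L blk C 0 0 C = blk C 0 0 C o\<^sub>L T"
        using T commutantD unfolding tensor_M2_def by blast
      then show ?thesis by (simp add: blk blk_compose blk_eq_iff)
    qed
    then have "a \<in> M" "b \<in> M" "c \<in> M" "d \<in> M"
      using bop by (subst M_eq, simp add: commutant_def[of "commutant M"])+
    then show "T \<in> {blk a b c d | a b c d. a \<in> M \<and> b \<in> M \<and> c \<in> M \<and> d \<in> M}"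
      using blk by blast
  qed
qed

lemma blk_in_tensor_M2: "blk a b c d \<in> tensor_M2 M \<longleftrightarrow> a \<in> M \<and> b \<in> M \<and> c \<in> M \<and> d \<in> M"
  by (auto simp: tensor_M2_eq blk_eq_iff)

lemma tensor_M2_cases:
  assumes "T \<in> tensor_M2 M"
  obtains a b c d where "T = blk a b c d" "a \<in> M" "b \<in> M" "c \<in> M" "d \<in> M"
  using assms by (auto simp: tensor_M2_eq)

lemma von_neumann_tensor_M2: "von_neumann_algebra (tensor_M2 M)"
  unfolding von_neumann_algebra_def
proof (intro conjI ballI)
  show "tensor_M2 M \<subseteq> bop" by (auto simp: tensor_M2_def commutant_def)
  show "adj T \<in> tensor_M2 M" if "T \<in> tensor_M2 M" for T
    using that by (elim tensor_M2_cases) (simp add: adj_blk M_bop blk_in_tensor_M2 adj_M)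
  show "commutant (commutant (tensor_M2 M)) = tensor_M2 M"
    unfolding tensor_M2_def
    by (subst triple_commutant[OF elementary_tensors_bop]) (auto simp: commutant_def)
qed

text \<open>The tensor product of \<open>\<tau>\<close> with the normalized matrix trace. The
  description extracts the blocks of \<open>T\<close>, and the restriction makes the functional
  extensional, as a tracial state has to be.\<close>

definition block_trace :: "(('a ^ 2) \<Rightarrow>\<^sub>L ('a ^ 2)) \<Rightarrow> complex" where
  "block_trace = (\<lambda>T\<in>tensor_M2 M. THE t. \<exists>a b c d. T = blk a b c d \<and> t = (\<tau> a + \<tau> d) / 2)"

lemma block_trace_blk:
  assumes "a \<in> M" "b \<in> M" "c \<in> M" "d \<in> M"
  shows "block_trace (blk a b c d) = (\<tau> a + \<tau> d) / 2"
proof -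
  have "block_trace (blk a b c d) = (THE t. \<exists>a' b' c' d'. blk a b c d = blk a' b' c' d' \<and> t = (\<tau> a' + \<tau> d') / 2)"
    using assms by (simp add: block_trace_def blk_in_tensor_M2)
  also have "\<dots> = (\<tau> a + \<tau> d) / 2"
    by (rule the_equality) (auto simp: blk_eq_iff)
  finally show ?thesis .
qed

lemma tracial_block_trace: "tracial_state (tensor_M2 M) block_trace"
  unfolding tracial_state_def
proof (intro conjI ballI allI impI)
  show "block_trace \<in> extensional (tensor_M2 M)" by (simp add: block_trace_def)
  show "block_trace id_blinfun = 1"
    by (simp add: blk_id[where 'a='a] block_trace_blk M_intros trace_id)
next
  fix S T assume "S \<in> tensor_M2 M" "T \<in> tensor_M2 M"
  then obtain a b c d a' b' c' d' where
    *: "S = blk a b c d" "a \<in> M" "b \<in> M" "c \<in> M" "d \<in> M"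
      "T = blk a' b' c' d'" "a' \<in> M" "b' \<in> M" "c' \<in> M" "d' \<in> M"
    by (metis tensor_M2_cases)
  show "block_trace (S + T) = block_trace S + block_trace T"
    by (simp add: * blk_add block_trace_blk M_intros trace_add field_simps)
  show "block_trace (S o\<^sub>L T) = block_trace (T o\<^sub>L S)"
    using * trace_commute[of a a'] trace_commute[of b c'] trace_commute[of c b'] trace_commute[of d d']
    by (simp add: blk_compose block_trace_blk M_intros trace_add field_simps)
next
  fix z T assume "T \<in> tensor_M2 M"
  then show "block_trace (scaleC_op z T) = z * block_trace T"
    by (elim tensor_M2_cases) (simp add: blk_scaleC block_trace_blk M_intros trace_scaleC field_simps)
next
  fix T assume "T \<in> tensor_M2 M" "op_le 0 T"
  then obtain a b c d where *: "T = blk a b c d" "a \<in> M" "b \<in> M" "c \<in> M" "d \<in> M"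
    by (metis tensor_M2_cases)
  have "\<tau> a \<in> \<real>\<^sub>\<ge>\<^sub>0" "\<tau> d \<in> \<real>\<^sub>\<ge>\<^sub>0"
    using op_le_blk_diag \<open>op_le 0 T\<close> * trace_pos by metis+
  then show "block_trace T \<in> \<real>\<^sub>\<ge>\<^sub>0"
    by (simp add: * block_trace_blk complex_nonneg_Reals_iff)
qed

lemma faithful_block_trace: "faithful_state (tensor_M2 M) block_trace"
  unfolding faithful_state_def
proof (intro ballI impI)
  fix T assume T: "T \<in> tensor_M2 M" "op_le 0 T \<and> block_trace T = 0"
  then obtain a b c d where *: "T = blk a b c d" "a \<in> M" "b \<in> M" "c \<in> M" "d \<in> M"
    by (metis tensor_M2_cases)
  have pos: "op_le 0 a" "op_le 0 d" using op_le_blk_diag T * by metis+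
  then have "\<tau> a \<in> \<real>\<^sub>\<ge>\<^sub>0" "\<tau> d \<in> \<real>\<^sub>\<ge>\<^sub>0" using trace_pos * by metis+
  moreover have "\<tau> a + \<tau> d = 0" using T * by (simp add: block_trace_blk)
  ultimately have "\<tau> a = 0" "\<tau> d = 0"
    by (auto simp: complex_nonneg_Reals_iff complex_eq_iff)
  then have "a = 0" "d = 0" using faithful pos * by (auto simp: faithful_state_def)
  then show "T = 0"
    using blk_off_diagonal_zero[of b c] T * M_bop by (auto simp: blk_zero)
qed

text \<open>A trace kills off-diagonal blocks and agrees on the two corners, so it is determined by
  its values on one corner, where it induces a tracial state of \<open>M\<close>.\<close>

lemma tracial_state_tensor_M2_unique:
  assumes uniq: "\<And>\<rho>. tracial_state M \<rho> \<Longrightarrow> \<rho> = \<tau>" and \<sigma>: "tracial_state (tensor_M2 M) \<sigma>"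
  shows "\<sigma> = block_trace"
proof -
  have add: "\<sigma> (S + T) = \<sigma> S + \<sigma> T" if "S \<in> tensor_M2 M" "T \<in> tensor_M2 M" for S T
    using \<sigma> that by (auto simp: tracial_state_def)
  have commute: "\<sigma> (S o\<^sub>L T) = \<sigma> (T o\<^sub>L S)" if "S \<in> tensor_M2 M" "T \<in> tensor_M2 M" for S T
    using \<sigma> that by (auto simp: tracial_state_def)
  have scale: "\<sigma> (scaleC_op z T) = z * \<sigma> T" if "T \<in> tensor_M2 M" for z T
    using \<sigma> that by (auto simp: tracial_state_def)
  have zero: "\<sigma> 0 = 0"
    using scale[of 0 0] by (simp add: blk_zero blk_in_tensor_M2 zero_M scaleC_op_zero blk_scaleC)
  \<comment> \<open>An off-diagonal entry multiplied by the corner projection is itself in one order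
    and 0 in the other.\<close>
  have off: "\<sigma> (blk 0 b c 0) = 0" if "b \<in> M" "c \<in> M" for b c
  proof -
    have "\<sigma> (blk 0 b 0 0) = 0"
      using commute[of "blk id_blinfun 0 0 0" "blk 0 b 0 0"] that zero
      by (simp add: blk_compose blk_in_tensor_M2 M_intros flip: blk_zero)
    moreover have "\<sigma> (blk 0 0 c 0) = 0"
      using commute[of "blk id_blinfun 0 0 0" "blk 0 0 c 0"] that zero
      by (simp add: blk_compose blk_in_tensor_M2 M_intros flip: blk_zero)
    ultimately show ?thesis
      using add[of "blk 0 b 0 0" "blk 0 0 c 0"] that by (simp add: blk_add blk_in_tensor_M2 zero_M)
  qed
  have corner: "\<sigma> (blk 0 0 0 d) = \<sigma> (blk d 0 0 0)" if "d \<in> M" for d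
    using commute[of "blk 0 0 id_blinfun 0" "blk 0 d 0 0"] that
    by (simp add: blk_compose blk_in_tensor_M2 M_intros)
  have split: "\<sigma> (blk a b c d) = \<sigma> (blk a 0 0 0) + \<sigma> (blk d 0 0 0)"
    if "a \<in> M" "b \<in> M" "c \<in> M" "d \<in> M" for a b c d
    using add[of "blk a 0 0 0" "blk 0 b c d"] add[of "blk 0 b c 0" "blk 0 0 0 d"] that off corner
    by (simp add: blk_add blk_in_tensor_M2 zero_M)
  \<comment> \<open>The factor 2 normalizes the functional, since the corner projection has trace
    1/2.\<close>
  define \<rho> where "\<rho> = (\<lambda>a\<in>M. 2 * \<sigma> (blk a 0 0 0))"
  have "tracial_state M \<rho>"
    unfolding tracial_state_def
  proof (intro conjI ballI allI impI)
    show "\<rho> \<in> extensional M" by (simp add: \<rho>_def)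
    show "\<rho> (a + b) = \<rho> a + \<rho> b" if "a \<in> M" "b \<in> M" for a b
      using add[of "blk a 0 0 0" "blk b 0 0 0"] that
      by (simp add: \<rho>_def blk_add blk_in_tensor_M2 M_intros)
    show "\<rho> (scaleC_op z a) = z * \<rho> a" if "a \<in> M" for z a
      using scale[of "blk a 0 0 0" z] that
      by (simp add: \<rho>_def blk_scaleC blk_in_tensor_M2 M_intros scaleC_op_zero_right)
    show "\<rho> a \<in> \<real>\<^sub>\<ge>\<^sub>0" if "a \<in> M" "op_le 0 a" for a
      using \<sigma> that op_le_blk_corner[of a]
      by (auto simp: \<rho>_def tracial_state_def blk_in_tensor_M2 zero_M complex_nonneg_Reals_iff)
    show "\<rho> id_blinfun = 1"
      using split[of id_blinfun 0 0 id_blinfun] \<sigma>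
      by (simp add: \<rho>_def M_intros tracial_state_def flip: blk_id)
    show "\<rho> (a o\<^sub>L b) = \<rho> (b o\<^sub>L a)" if "a \<in> M" "b \<in> M" for a b
      using commute[of "blk a 0 0 0" "blk b 0 0 0"] that
      by (simp add: \<rho>_def blk_compose blk_in_tensor_M2 M_intros)
  qed
  then have \<rho>: "\<rho> = \<tau>" by (rule uniq)
  show ?thesis
  proof (rule extensionalityI)
    show "\<sigma> \<in> extensional (tensor_M2 M)" using \<sigma> by (simp add: tracial_state_def)
    show "block_trace \<in> extensional (tensor_M2 M)" by (simp add: block_trace_def)
    fix T assume "T \<in> tensor_M2 M"
    then obtain a b c d where *: "T = blk a b c d" "a \<in> M" "b \<in> M" "c \<in> M" "d \<in> M"
      by (metis tensor_M2_cases)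
    have "\<tau> a = 2 * \<sigma> (blk a 0 0 0)" "\<tau> d = 2 * \<sigma> (blk d 0 0 0)"
      using * by (simp_all add: \<rho>_def flip: \<rho>)
    then show "\<sigma> T = block_trace T"
      using * split by (simp add: block_trace_blk)
  qed
qed

end

lemma finite_factor_traced_algebra:
  assumes "finite_factor N"
  shows "traced_algebra N (trace_of N)"
proof
  show "tracial_state N (trace_of N)"
    using assms unfolding finite_factor_def trace_of_def by (metis theI')
qed (use assms in \<open>auto simp: finite_factor_def factor_def\<close>)

lemma finite_factor_trace_of_tensor_M2:
  assumes N: "finite_factor N"
  shows "trace_of (tensor_M2 N) = traced_algebra.block_trace N (trace_of N)"
proof -
  interpret traced_algebra N "trace_of N" by (rule finite_factor_traced_algebra[OF N])
  have "\<rho> = trace_of N" if "tracial_state N \<rho>" for \<rho>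
    using N that trace unfolding finite_factor_def by blast
  then show ?thesis
    unfolding trace_of_def[of "tensor_M2 N"]
    using tracial_state_tensor_M2_unique tracial_block_trace by (intro the_equality) blast+
qed

lemma finite_factor_traced_tensor_M2:
  assumes "finite_factor N"
  shows "traced_algebra (tensor_M2 N) (trace_of (tensor_M2 N))"
proof -
  interpret traced_algebra N "trace_of N" by (rule finite_factor_traced_algebra[OF assms])
  show ?thesis
    unfolding finite_factor_trace_of_tensor_M2[OF assms]
    by standard (rule von_neumann_tensor_M2 tracial_block_trace faithful_block_trace)+
qed

section \<open>Metric characterization of equidistant projections\<close>

text \<open>The graph of \<open>u powr s\<close> against its tangent at 1, by the mean value theorem
  and the monotonicity of the derivative on either side of 1.\<close>

lemma powr_Bernoulli_strict:
  fixes u s :: real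
  assumes "u \<ge> 0" "u \<noteq> 1" "s > 0"
  shows "s > 1 \<Longrightarrow> u powr s > 1 + s * (u - 1)" and "s < 1 \<Longrightarrow> u powr s < 1 + s * (u - 1)"
proof -
  have "(s > 1 \<longrightarrow> u powr s > 1 + s * (u - 1)) \<and> (s < 1 \<longrightarrow> u powr s < 1 + s * (u - 1))"
  proof -
    consider "u = 0" | "0 < u" "u < 1" | "u > 1" using assms by linarith
    then show ?thesis
    proof cases
      case 1
      then show ?thesis by simp
    next
      case 2
      have "\<exists>z>u. z < 1 \<and> 1 powr s - u powr s = (1 - u) * (s * z powr (s - 1))"
        using 2 by (intro MVT2) (auto intro!: derivative_eq_intros simp: field_simps powr_diff)
      then obtain z where z: "u < z" "z < 1" "1 - u powr s = (1 - u) * (s * z powr (s - 1))" by auto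
      have "z powr (s - 1) < 1" if "s > 1" using z 2 that powr_less_mono2[of "s - 1" z 1] by simp
      then have "s > 1 \<longrightarrow> (1 - u) * (s * z powr (s - 1)) < (1 - u) * (s * 1)"
        using 2 assms by (intro impI mult_strict_left_mono) auto
      moreover have "z powr (s - 1) > 1" if "s < 1" using z 2 that powr_less_mono2_neg[of "s - 1" z 1] by simp
      then have "s < 1 \<longrightarrow> (1 - u) * (s * z powr (s - 1)) > (1 - u) * (s * 1)"
        using 2 assms by (intro impI mult_strict_left_mono) auto
      ultimately show ?thesis using z(3) by (auto simp: algebra_simps)
    next
      case 3
      have "\<exists>z>1. z < u \<and> u powr s - 1 powr s = (u - 1) * (s * z powr (s - 1))"
        using 3 by (intro MVT2) (auto intro!: derivative_eq_intros simp: field_simps powr_diff)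
      then obtain z where z: "1 < z" "z < u" "u powr s - 1 = (u - 1) * (s * z powr (s - 1))" by auto
      have "z powr (s - 1) > 1" if "s > 1" using z that powr_less_mono2[of "s - 1" 1 z] by simp
      then have "s > 1 \<longrightarrow> (u - 1) * (s * z powr (s - 1)) > (u - 1) * (s * 1)"
        using 3 assms by (intro impI mult_strict_left_mono) auto
      moreover have "z powr (s - 1) < 1" if "s < 1" using z that powr_less_mono2_neg[of "s - 1" 1 z] by simp
      then have "s < 1 \<longrightarrow> (u - 1) * (s * z powr (s - 1)) < (u - 1) * (s * 1)"
        using 3 assms by (intro impI mult_strict_left_mono) auto
      ultimately show ?thesis using z(3) by (auto simp: algebra_simps)
    qed
  qed
  then show "s > 1 \<Longrightarrow> u powr s > 1 + s * (u - 1)" and "s < 1 \<Longrightarrow> u powr s < 1 + s * (u - 1)"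
    by auto
qed

text \<open>Bernoulli's inequality is applied at \<open>2 * t\<close> and
  \<open>2 * (1 - t)\<close>, whose deviations from 1 cancel in the sum.\<close>

lemma powr_symmetric_strict:
  fixes t s :: real
  assumes "t \<in> {0..1}" "t \<noteq> 1/2" "s > 0"
  shows "s > 1 \<Longrightarrow> t powr s + (1 - t) powr s > 2 * (1/2) powr s"
    and "s < 1 \<Longrightarrow> t powr s + (1 - t) powr s < 2 * (1/2) powr s"
proof -
  have half: "u powr s = (1/2) powr s * (2 * u) powr s" if "u \<ge> 0" for u
    using powr_mult[of "1/2" "2 * u" s] that by simp
  have t: "t powr s = (1/2) powr s * (2 * t) powr s"
    "(1 - t) powr s = (1/2) powr s * (2 * (1 - t)) powr s"
    using assms by (intro half; simp)+
  have pos: "(1/2::real) powr s > 0" by simp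
  have "0 \<le> 2 * t" "2 * t \<noteq> 1" "0 \<le> 2 * (1 - t)" "2 * (1 - t) \<noteq> 1" using assms by auto
  note B = powr_Bernoulli_strict[OF this(1,2) \<open>s > 0\<close>] powr_Bernoulli_strict[OF this(3,4) \<open>s > 0\<close>]
  show "t powr s + (1 - t) powr s > 2 * (1/2) powr s" if "s > 1"
  proof -
    have "2 < (2 * t) powr s + (2 * (1 - t)) powr s"
      using B(1,3)[OF that] by (simp add: algebra_simps)
    from mult_strict_left_mono[OF this pos] show ?thesis unfolding t by (simp add: algebra_simps)
  qed
  show "t powr s + (1 - t) powr s < 2 * (1/2) powr s" if "s < 1"
  proof -
    have "(2 * t) powr s + (2 * (1 - t)) powr s < 2"
      using B(2,4)[OF that] by (simp add: algebra_simps)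
    from mult_strict_left_mono[OF this pos] show ?thesis unfolding t by (simp add: algebra_simps)
  qed
qed

section \<open>Powers of multiples, complementary squares, traces of \<open>A o\<^sub>L B\<close>
  and \<open>B o\<^sub>L A\<close>\<close>

lemma op_poly_scalar: "op_poly q (c *\<^sub>R id_blinfun) = poly q c *\<^sub>R id_blinfun"
  by (induction q) (simp_all add: op_poly_pCons compose_simps scaleR_left_distrib)

lemma op_powr_scaleR:
  fixes T :: "'a::chilbert \<Rightarrow>\<^sub>L 'a"
  assumes T: "T \<in> bop" "op_le 0 T" and "c > 0" "s > 0"
  shows "op_powr (c *\<^sub>R T) s = c powr s *\<^sub>R op_powr T s"
proof -
  obtain g where g: "uniform_limit {0..norm T} (\<lambda>n. poly (g n)) (\<lambda>t. t powr s) sequentially"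
    using powr_polynomial_approximation[OF \<open>s > 0\<close>] by blast
  define h where "h n = smult (c powr s) (pcompose (g n) [:0, 1/c:])" for n
  have sa: "selfadjoint (c *\<^sub>R T)" using selfadjoint_of_positive[OF T] by (rule selfadjoint_scaleR)
  have cT: "c *\<^sub>R T \<in> bop" "op_le 0 (c *\<^sub>R T)" "op_le (c *\<^sub>R T) ((c * norm T) *\<^sub>R id_blinfun)"
    using T \<open>c > 0\<close> op_le_norm[OF sa, of "c * norm T"] selfadjoint_of_positive[OF T]
    by (auto simp: bop_scaleR op_le_iff_selfadjoint selfadjoint_zero sa blinfun.bilinear_simps cinner_simps)
  have "uniform_limit {0..c * norm T} (\<lambda>n. poly (h n)) (\<lambda>t. t powr s) sequentially"
    unfolding uniform_limit_iff
  proof (intro allI impI)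
    fix e :: real assume "e > 0"
    then have "\<forall>\<^sub>F n in sequentially. \<forall>t\<in>{0..norm T}. dist (poly (g n) t) (t powr s) < e / c powr s"
      using g \<open>c > 0\<close> unfolding uniform_limit_iff by simp
    then show "\<forall>\<^sub>F n in sequentially. \<forall>t\<in>{0..c * norm T}. dist (poly (h n) t) (t powr s) < e"
    proof eventually_elim
      case (elim n)
      show ?case
      proof
        fix t assume t: "t \<in> {0..c * norm T}"
        then have "t / c \<in> {0..norm T}" using \<open>c > 0\<close> by (simp add: field_simps)
        then have "dist (poly (g n) (t / c)) ((t / c) powr s) < e / c powr s" using elim by blast
        then have "c powr s * \<bar>poly (g n) (t / c) - (t / c) powr s\<bar> < e"
          using \<open>c > 0\<close> by (simp add: dist_real_def field_simps)
        moreover have "poly (h n) t - t powr s = c powr s * (poly (g n) (t / c) - (t / c) powr s)"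
          using t \<open>c > 0\<close> by (simp add: h_def poly_pcompose powr_divide right_diff_distrib)
        ultimately show "dist (poly (h n) t) (t powr s) < e"
          using \<open>c > 0\<close> by (simp add: dist_real_def abs_mult)
      qed
    qed
  qed
  then have "(\<lambda>n. op_poly (h n) (c *\<^sub>R T)) \<longlonglongrightarrow> op_powr (c *\<^sub>R T) s"
    by (rule tendsto_op_powr[OF cT])
  moreover have "op_poly (h n) (c *\<^sub>R T) = c powr s *\<^sub>R op_poly (g n) T" for n
    using \<open>c > 0\<close> by (simp add: h_def op_poly_smult op_poly_pcompose op_poly_pCons compose_simps)
  moreover have "(\<lambda>n. c powr s *\<^sub>R op_poly (g n) T) \<longlonglongrightarrow> c powr s *\<^sub>R op_powr T s"
    by (intro tendsto_intros tendsto_op_powr[OF T positive_le_norm[OF T] g])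
  ultimately show ?thesis using LIMSEQ_unique by auto
qed

lemma op_powr_scalar:
  assumes "c \<ge> 0" "s > 0"
  shows "op_powr (c *\<^sub>R (id_blinfun :: 'a::chilbert \<Rightarrow>\<^sub>L 'a)) s = c powr s *\<^sub>R id_blinfun"
proof -
  obtain g where g: "uniform_limit {0..c} (\<lambda>n. poly (g n)) (\<lambda>t. t powr s) sequentially"
    using powr_polynomial_approximation[OF \<open>s > 0\<close>] by blast
  have c: "c *\<^sub>R id_blinfun \<in> bop" "op_le 0 (c *\<^sub>R (id_blinfun :: 'a \<Rightarrow>\<^sub>L 'a))"
    "op_le (c *\<^sub>R (id_blinfun :: 'a \<Rightarrow>\<^sub>L 'a)) (c *\<^sub>R id_blinfun)"
    using \<open>c \<ge> 0\<close> by (auto simp: bop_scaleR bop_id op_le_iff_selfadjoint selfadjoint_zero selfadjoint_scaleR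
        selfadjoint_id blinfun.bilinear_simps cinner_simps cinner_self)
  have "(\<lambda>n. poly (g n) c *\<^sub>R (id_blinfun :: 'a \<Rightarrow>\<^sub>L 'a)) \<longlonglongrightarrow> op_powr (c *\<^sub>R id_blinfun) s"
    using tendsto_op_powr[OF c g] by (simp add: op_poly_scalar)
  moreover have "(\<lambda>n. poly (g n) c) \<longlonglongrightarrow> c powr s"
    using g \<open>c \<ge> 0\<close> by (intro tendsto_uniform_limitI[OF g]) auto
  then have "(\<lambda>n. poly (g n) c *\<^sub>R (id_blinfun :: 'a \<Rightarrow>\<^sub>L 'a)) \<longlonglongrightarrow> c powr s *\<^sub>R id_blinfun"
    by (intro tendsto_intros)
  ultimately show ?thesis using LIMSEQ_unique by blast
qed

text \<open>Both squares expand into \<open>P\<close>, \<open>E\<close> and the mixed products,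
  which enter with opposite signs and cancel in the sum.\<close>

lemma complementary_squares:
  assumes "P o\<^sub>L P = P" "E o\<^sub>L E = E"
  shows "((P - (id_blinfun - E)) o\<^sub>L (P - (id_blinfun - E))) = id_blinfun - ((P - E) o\<^sub>L (P - E))"
  by (simp add: compose_simps assms algebra_simps)

text \<open>The intertwining relation \<open>r(A B) A = A r(B A)\<close> reduces the claim to one
  use of the trace property; the constant terms agree.\<close>

lemma (in traced_algebra) trace_op_poly_commute:
  assumes "A \<in> M" "B \<in> M"
  shows "\<tau> (op_poly q (A o\<^sub>L B)) = \<tau> (op_poly q (B o\<^sub>L A))"
proof (cases q)
  case (pCons c r)
  have shift: "op_poly r (A o\<^sub>L B) o\<^sub>L A = A o\<^sub>L op_poly r (B o\<^sub>L A)" for r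
  proof (induction r)
    case (pCons c r)
    then show ?case by (simp add: op_poly_pCons compose_simps blinfun_compose_assoc)
  qed simp
  have "(A o\<^sub>L B) o\<^sub>L op_poly r (A o\<^sub>L B) = (A o\<^sub>L op_poly r (B o\<^sub>L A)) o\<^sub>L B"
    by (metis op_poly_commute[of "A o\<^sub>L B" "A o\<^sub>L B" r] blinfun_compose_assoc shift)
  then have "\<tau> ((A o\<^sub>L B) o\<^sub>L op_poly r (A o\<^sub>L B)) = \<tau> (B o\<^sub>L (A o\<^sub>L op_poly r (B o\<^sub>L A)))"
    using trace_commute[of "A o\<^sub>L op_poly r (B o\<^sub>L A)" B] assms by (simp add: M_intros op_poly_M)
  then show ?thesis
    using assms by (simp add: pCons op_poly_pCons trace_add M_intros op_poly_M blinfun_compose_assoc)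
qed

locale trace_of_algebra = traced_algebra M "trace_of M" for M
begin

lemma Lp_norm_powr:
  assumes "A \<in> M" "p > 0"
  shows "Lp_norm M p A powr p = Re (trace_of M (op_powr (adj A o\<^sub>L A) (p / 2)))"
proof -
  have "0 \<le> Re (trace_of M (op_powr (adj A o\<^sub>L A) (p / 2)))"
    using assms M_bop by (intro Re_trace_op_powr_nonneg) (auto simp: M_intros op_le_zero_adj_compose)
  then show ?thesis
    using assms by (simp add: Lp_norm_def op_powr_modulus[OF M_bop] powr_powr)
qed

lemma Lp_norm_nonneg: "Lp_norm M p A \<ge> 0"
  by (simp add: Lp_norm_def)

lemma Lp_norm_eqI:
  assumes "p > 0" "c \<ge> 0" "Lp_norm M p A powr p = c powr p"
  shows "Lp_norm M p A = c"
  using assms Lp_norm_nonneg by (metis less_irrefl powr_less_mono2 linorder_neqE_linordered_idom)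

lemma Lp_norm_2_eq_iff:
  assumes "A \<in> M" "selfadjoint A" "c \<ge> 0"
  shows "Lp_norm M 2 A = sqrt c \<longleftrightarrow> Re (trace_of M (A o\<^sub>L A)) = c"
proof -
  have b: "A \<in> bop" using assms M_bop by blast
  have "op_powr (adj A o\<^sub>L A) 1 = A o\<^sub>L A"
    using op_powr_1[of "adj A o\<^sub>L A"] op_le_zero_adj_compose[OF b] assms(2) b
    by (auto simp: selfadjoint_def bop_compose)
  then have "(Lp_norm M 2 A)\<^sup>2 = Re (trace_of M (A o\<^sub>L A))"
    using Lp_norm_powr[OF assms(1), of 2] Lp_norm_nonneg[of 2 A] by simp
  then show ?thesis
    using \<open>c \<ge> 0\<close> Lp_norm_nonneg[of 2 A] by (metis real_sqrt_pow2 real_sqrt_unique real_sqrt_abs abs_of_nonneg)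
qed

lemma Lp_norm_of_scalar_square:
  assumes "A \<in> M" "p > 0" "c \<ge> 0" "adj A o\<^sub>L A = c *\<^sub>R id_blinfun"
  shows "Lp_norm M p A = c powr (1/2)"
  using assms by (intro Lp_norm_eqI)
    (simp_all add: Lp_norm_powr op_powr_scalar trace_scaleR id_M trace_id powr_powr)

section \<open>Distances between projections of trace one half\<close>

lemma half_projectionD:
  assumes "P \<in> half_projections M"
  shows "P \<in> M" "selfadjoint P" "P o\<^sub>L P = P" "trace_of M P = 1/2"
  using assms M_bop by (auto simp: half_projections_def selfadjoint_def)

lemma half_projectionI:
  "P \<in> M \<Longrightarrow> selfadjoint P \<Longrightarrow> P o\<^sub>L P = P \<Longrightarrow> trace_of M P = 1/2 \<Longrightarrow> P \<in> half_projections M"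
  by (auto simp: half_projections_def selfadjoint_def)

lemma half_projection_complement:
  assumes "E \<in> half_projections M" shows "id_blinfun - E \<in> half_projections M"
  using half_projectionD[OF assms]
  by (intro half_projectionI)
    (auto simp: M_intros compose_simps trace_diff trace_id intro: selfadjoint_diff selfadjoint_id)

lemma half_projections_diff:
  assumes P: "P \<in> half_projections M" and E: "E \<in> half_projections M"
  shows "P - E \<in> M" "selfadjoint (P - E)" "adj (P - E) = P - E"
    "op_le 0 ((P - E) o\<^sub>L (P - E))" "op_le ((P - E) o\<^sub>L (P - E)) id_blinfun"
proof -
  note P = half_projectionD[OF P] and E' = half_projectionD[OF half_projection_complement[OF E]]
    and E = half_projectionD[OF E]
  show *: "P - E \<in> M" "selfadjoint (P - E)" using P E by (auto intro: diff_M selfadjoint_diff)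
  then show **: "adj (P - E) = P - E" by (simp add: selfadjoint_def)
  show "op_le 0 ((P - E) o\<^sub>L (P - E))"
    using op_le_zero_adj_compose[OF selfadjoint_bop[OF *(2)]] ** by simp
  have sa: "selfadjoint (P - (id_blinfun - E))" using P E' by (auto intro: selfadjoint_diff)
  have "op_le 0 ((P - (id_blinfun - E)) o\<^sub>L (P - (id_blinfun - E)))"
    using op_le_zero_adj_compose[OF selfadjoint_bop[OF sa]] sa by (simp add: selfadjoint_def)
  then show "op_le ((P - E) o\<^sub>L (P - E)) id_blinfun"
    unfolding complementary_squares[OF P(3) E(3)] op_le_def by simp
qed

lemma half_projections_Lp_norm:
  assumes "P \<in> half_projections M" "E \<in> half_projections M" "p > 0"
  shows "Lp_norm M p (P - E) powr p = Re (trace_of M (op_powr ((P - E) o\<^sub>L (P - E)) (p / 2)))"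
  using Lp_norm_powr[OF half_projections_diff(1)[OF assms(1,2)] assms(3)]
    half_projections_diff(3)[OF assms(1,2)] by simp

text \<open>On \<open>[0,1]\<close> the function \<open>1 - t powr (p / 2)\<close> is nonnegative
  and vanishes only at 1. So distance 1 forces the square of \<open>P - E\<close> to be the
  identity, and the complementary square to be 0.\<close>

lemma Lp_distance_1_iff:
  assumes P: "P \<in> half_projections M" and E: "E \<in> half_projections M" and p: "p > 0"
  shows "Lp_norm M p (P - E) = 1 \<longleftrightarrow> P = id_blinfun - E"
proof
  note D = half_projections_diff[OF P E]
  let ?a = "(P - E) o\<^sub>L (P - E)"
  assume "Lp_norm M p (P - E) = 1"
  then have tr: "Re (trace_of M (op_powr ?a (p / 2))) = 1"
    using half_projections_Lp_norm[OF P E p] by simp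
  obtain g where g: "uniform_limit {0..1} (\<lambda>n. poly (g n)) (\<lambda>t. t powr (p / 2)) sequentially"
    using powr_polynomial_approximation[of "p / 2"] p by auto
  have "?a = 1 *\<^sub>R id_blinfun"
  proof (rule scalar_of_trace_eq_zero)
    show "?a \<in> M" using D by (simp add: compose_M)
    show "op_le 0 ?a" "op_le ?a id_blinfun" by fact+
    have "uniform_limit {0..1} (\<lambda>n t. 1 - poly (g n) t) (\<lambda>t. 1 - t powr (p / 2)) sequentially"
      by (intro uniform_limit_intros g)
    then show "uniform_limit {0..1} (\<lambda>n. poly ([:1:] - g n)) (\<lambda>t. 1 - t powr (p / 2)) sequentially"
      by (simp add: poly_diff[abs_def])
    show "continuous_on {0..1} (\<lambda>t. 1 - t powr (p / 2))"
      using p by (intro continuous_intros continuous_on_powr') auto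
    show "0 \<le> 1 - t powr (p / 2)" if "t \<in> {0..1}" for t
      using that p powr_mono2[of "p / 2" t 1] by simp
    show "t = 1" if "t \<in> {0..1}" "1 - t powr (p / 2) = 0" for t
      using that p powr_less_mono2[of "p / 2" t 1] by force
    have "(\<lambda>n. Re (trace_of M (op_poly (g n) ?a))) \<longlonglongrightarrow> 1"
      using tendsto_Re_trace_op_powr[of ?a 1 g "p / 2"] D g tr by (simp add: compose_M)
    then have "(\<lambda>n. 1 - Re (trace_of M (op_poly (g n) ?a))) \<longlonglongrightarrow> 1 - 1"
      by (intro tendsto_intros)
    then show "(\<lambda>n. Re (trace_of M (op_poly ([:1:] - g n) ?a))) \<longlonglongrightarrow> 0"
      using D by (simp add: op_poly_diff op_poly_const trace_diff trace_id M_intros op_poly_M)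
  qed simp
  then have "((P - (id_blinfun - E)) o\<^sub>L (P - (id_blinfun - E))) = 0"
    using complementary_squares[of P E] half_projectionD[OF P] half_projectionD[OF E] by simp
  then have "P - (id_blinfun - E) = 0"
    using half_projections_diff(2)[OF P half_projection_complement[OF E]] selfadjoint_square_eq_zero by blast
  then show "P = id_blinfun - E" by simp
next
  assume eq: "P = id_blinfun - E"
  have "adj (P - E) o\<^sub>L (P - E) = 1 *\<^sub>R id_blinfun"
    using half_projectionD[OF E] half_projections_diff(3)[OF P E]
    by (simp add: eq compose_simps)
  then show "Lp_norm M p (P - E) = 1"
    using Lp_norm_of_scalar_square[of "P - E" p 1] half_projections_diff(1)[OF P E] p by simp
qed

lemma equidistant_iff_Lp:
  assumes P: "P \<in> half_projections M" and E: "E \<in> half_projections M" and p: "p > 0" "p \<noteq> 2"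
  shows "(P - E) o\<^sub>L (P - E) = (1/2) *\<^sub>R id_blinfun \<longleftrightarrow>
    Lp_norm M p (P - E) = (1/2) powr (1/2) \<and> Lp_norm M p (P - (id_blinfun - E)) = (1/2) powr (1/2)"
proof
  note E' = half_projection_complement[OF E]
  note D = half_projections_diff[OF P E] and D' = half_projections_diff[OF P E']
  note compl = complementary_squares[of P E, OF half_projectionD(3)[OF P] half_projectionD(3)[OF E]]
  let ?a = "(P - E) o\<^sub>L (P - E)"
  {
    assume half: "?a = (1/2) *\<^sub>R id_blinfun"
    have "id_blinfun - (1/2) *\<^sub>R id_blinfun = (1/2) *\<^sub>R (id_blinfun :: 'a \<Rightarrow>\<^sub>L 'a)"
      by (simp add: diff_eq_eq flip: scaleR_left_distrib)
    then show "Lp_norm M p (P - E) = (1/2) powr (1/2) \<and> Lp_norm M p (P - (id_blinfun - E)) = (1/2) powr (1/2)"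
      using Lp_norm_of_scalar_square[OF D(1) p(1), of "1/2"] Lp_norm_of_scalar_square[OF D'(1) p(1), of "1/2"]
        half compl D(3) D'(3) by simp
  }
  assume *: "Lp_norm M p (P - E) = (1/2) powr (1/2) \<and> Lp_norm M p (P - (id_blinfun - E)) = (1/2) powr (1/2)"
  define s where "s = p / 2"
  have s: "s > 0" "s \<noteq> 1" using p by (auto simp: s_def)
  obtain g where g: "uniform_limit {0..1} (\<lambda>n. poly (g n)) (\<lambda>t. t powr s) sequentially"
    using powr_polynomial_approximation[of s] s by auto
  have aM: "?a \<in> M" using D by (simp add: compose_M)
  \<comment> \<open>The \<open>p\<close>-th power of the prescribed distance, and half the value of
    \<open>t powr s + (1 - t) powr s\<close> at 1/2.\<close>
  define C where "C = (1/2::real) powr s"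
  have l1: "(\<lambda>n. Re (trace_of M (op_poly (g n) ?a))) \<longlonglongrightarrow> C"
    using tendsto_Re_trace_op_powr[of ?a 1 g s] D g * half_projections_Lp_norm[OF P E p(1)]
    by (simp add: compose_M s_def C_def powr_powr)
  have l2: "(\<lambda>n. Re (trace_of M (op_poly (g n) (id_blinfun - ?a)))) \<longlonglongrightarrow> C"
    using tendsto_Re_trace_op_powr[of "id_blinfun - ?a" 1 g s] D' g * half_projections_Lp_norm[OF P E' p(1)]
    by (simp add: compose_M s_def C_def powr_powr compl M_intros D(1))
  \<comment> \<open>The sign makes \<open>h\<close> nonnegative both in the convex case
    \<open>s > 1\<close> and in the concave case \<open>s < 1\<close>.\<close>
  define \<sigma> :: real where "\<sigma> = (if s > 1 then 1 else - 1)"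
  define h where "h t = \<sigma> * (t powr s + (1 - t) powr s - 2 * C)" for t
  \<comment> \<open>Composition with \<open>1 - X\<close> evaluates \<open>g n\<close> at the
    complementary square, so the limits \<open>l1\<close> and \<open>l2\<close> combine.\<close>
  define q where "q n = smult \<sigma> (g n + pcompose (g n) [:1, - 1:] - [:2 * C:])" for n
  show "?a = (1/2) *\<^sub>R id_blinfun"
  proof (rule scalar_of_trace_eq_zero)
    show "?a \<in> M" by fact
    show "op_le 0 ?a" "op_le ?a id_blinfun" by fact+
    have "uniform_limit {0..1} (\<lambda>n t. poly (g n) (1 - t)) (\<lambda>t. (1 - t) powr s) sequentially"
      unfolding uniform_limit_iff
    proof (intro allI impI)
      fix e :: real assume "e > 0"
      from uniform_limitD[OF g this]
      show "\<forall>\<^sub>F n in sequentially. \<forall>t\<in>{0..1}. dist (poly (g n) (1 - t)) ((1 - t) powr s) < e"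
        by eventually_elim auto
    qed
    then have "uniform_limit {0..1} (\<lambda>n t. \<sigma> * (poly (g n) t + poly (g n) (1 - t) - 2 * C))
        (\<lambda>t. \<sigma> * (t powr s + (1 - t) powr s - 2 * C)) sequentially"
      by (intro uniform_limit_intros g)
    then show "uniform_limit {0..1} (\<lambda>n. poly (q n)) h sequentially"
      by (simp add: q_def h_def[abs_def] poly_pcompose poly_smult[abs_def] poly_add[abs_def] poly_diff[abs_def])
    show "continuous_on {0..1} h"
      unfolding h_def using s by (intro continuous_intros continuous_on_powr') auto
    have strict: "h t > 0" if "t \<in> {0..1}" "t \<noteq> 1/2" for t
      using powr_symmetric_strict[OF that s(1)] s(2) by (auto simp: h_def \<sigma>_def C_def)
    moreover have "h (1/2) = 0" by (simp add: h_def C_def)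
    ultimately show "0 \<le> h t" if "t \<in> {0..1}" for t
      using that by (metis less_imp_le order_refl)
    show "t = 1/2" if "t \<in> {0..1}" "h t = 0" for t
      using that strict by (metis less_irrefl)
    have "op_poly (q n) ?a = \<sigma> *\<^sub>R (op_poly (g n) ?a + op_poly (g n) (id_blinfun - ?a) - (2 * C) *\<^sub>R id_blinfun)" for n
      by (simp add: q_def op_poly_simps op_poly_pcompose op_poly_pCons compose_minus_right)
    then have "Re (trace_of M (op_poly (q n) ?a)) =
        \<sigma> * (Re (trace_of M (op_poly (g n) ?a)) + Re (trace_of M (op_poly (g n) (id_blinfun - ?a))) - 2 * C)" for n
      by (simp add: trace_add trace_diff trace_scaleR trace_id M_intros op_poly_M aM)
    moreover have "(\<lambda>n. \<sigma> * (Re (trace_of M (op_poly (g n) ?a)) +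
        Re (trace_of M (op_poly (g n) (id_blinfun - ?a))) - 2 * C)) \<longlonglongrightarrow> \<sigma> * (C + C - 2 * C)"
      by (intro tendsto_intros l1 l2)
    ultimately show "(\<lambda>n. Re (trace_of M (op_poly (q n) ?a))) \<longlonglongrightarrow> 0" by simp
  qed simp
qed

end

context trace_of_algebra
begin

text \<open>For the exponent 2 a distance thus carries the same information as the real part of the
  trace of a product.\<close>

lemma Re_trace_diff_square:
  assumes P: "P \<in> half_projections M" and E: "E \<in> half_projections M"
  shows "Re (trace_of M ((P - E) o\<^sub>L (P - E))) = 1 - 2 * Re (trace_of M (P o\<^sub>L E))"
proof -
  note P = half_projectionD[OF P] and E = half_projectionD[OF E]
  have "(P - E) o\<^sub>L (P - E) = P - (P o\<^sub>L E) - ((E o\<^sub>L P) - E)"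
    by (simp add: compose_simps P E)
  then show ?thesis
    using trace_commute[of E P] by (simp add: trace_diff P E M_intros)
qed

text \<open>For \<open>p = 2\<close> the distance to \<open>id - E\<close> is determined by the one to \<open>E\<close> and so carries no new
  information. Instead, \<open>2P - 1\<close> anticommutes with \<open>2E - 1\<close> iff their normalized sum is again
  a symmetry \<open>2R - 1\<close>, and in the Hilbert space norm \<open>R\<close> is determined by its distances to \<open>E\<close> and \<open>P\<close>.\<close>

lemma equidistant_iff_L2:
  assumes P: "P \<in> half_projections M" and E: "E \<in> half_projections M"
  defines "d \<equiv> (1 - 1 / sqrt 2) / 2"
  shows "(P - E) o\<^sub>L (P - E) = (1/2) *\<^sub>R id_blinfun \<longleftrightarrow>
    Lp_norm M 2 (P - E) = sqrt (1/2) \<and>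
    (\<exists>R\<in>half_projections M. Lp_norm M 2 (R - E) = sqrt d \<and> Lp_norm M 2 (R - P) = sqrt d)"
    (is "?l \<longleftrightarrow> ?r")
proof -
  \<comment> \<open>With \<open>W = P + E - 1\<close>, the normalized sum of the two symmetries is
    \<open>2 * c\<close> times \<open>W\<close>.\<close>
  define c where "c = 1 / sqrt 2"
  have cc: "c * c = 1/2" by (simp add: c_def)
  have c: "0 < c" "c \<le> 1" by (auto simp: c_def)
  have d: "d = (1 - c) / 2" "d \<ge> 0" using c by (auto simp: d_def c_def)
  have iff: "Lp_norm M 2 (A - B) = sqrt t \<longleftrightarrow> 1 - 2 * Re (trace_of M (A o\<^sub>L B)) = t"
    if "A \<in> half_projections M" "B \<in> half_projections M" "t \<ge> 0" for A B t
    using Lp_norm_2_eq_iff[OF half_projections_diff(1,2)[OF that(1,2)] that(3)]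
      Re_trace_diff_square[OF that(1,2)] by simp
  note P' = half_projectionD[OF P] and E' = half_projectionD[OF E]
  define W where "W = P - (id_blinfun - E)"
  have W: "W \<in> M" "selfadjoint W" "trace_of M W = 0"
    by (simp_all add: W_def M_intros trace_diff trace_id selfadjoint_diff selfadjoint_id P' E')
  have WW: "W o\<^sub>L W = id_blinfun - ((P - E) o\<^sub>L (P - E))"
    unfolding W_def by (rule complementary_squares[OF P'(3) E'(3)])
  have sum_half: "(1/2) *\<^sub>R X + (1/2) *\<^sub>R X = X" for X :: "'a \<Rightarrow>\<^sub>L 'a"
    by (simp flip: scaleR_left_distrib)
  \<comment> \<open>The candidate for \<open>R\<close>, with \<open>2 R0 - 1\<close> the normalized
    sum of the symmetries. It is idempotent exactly when \<open>W\<close> squares to 1/2, and its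
    squared distances to \<open>E\<close> and \<open>P\<close> are then \<open>d\<close>.\<close>
  define R0 where "R0 = (1/2) *\<^sub>R id_blinfun + c *\<^sub>R W"
  have R0: "R0 \<in> M" "selfadjoint R0" "trace_of M R0 = 1/2"
    using W by (auto simp: R0_def M_intros trace_add trace_scaleR trace_id
        intro!: selfadjoint_add selfadjoint_scaleR selfadjoint_id)
  have R0_sq: "R0 o\<^sub>L R0 = (1/4) *\<^sub>R id_blinfun + c *\<^sub>R W + (1/2) *\<^sub>R (W o\<^sub>L W)"
  proof -
    have "R0 o\<^sub>L R0 = (1/4) *\<^sub>R id_blinfun + ((1/2) *\<^sub>R (c *\<^sub>R W) + (1/2) *\<^sub>R (c *\<^sub>R W)) + (c * c) *\<^sub>R (W o\<^sub>L W)"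
      by (simp add: R0_def compose_simps algebra_simps)
    then show ?thesis unfolding sum_half cc .
  qed
  show ?thesis
  proof
    assume l: ?l
    have "W o\<^sub>L W = (1/2) *\<^sub>R id_blinfun"
      unfolding WW l using sum_half[of id_blinfun] by (metis add_diff_cancel_left')
    then have "R0 o\<^sub>L R0 = ((1/4) *\<^sub>R id_blinfun + (1/4) *\<^sub>R id_blinfun) + c *\<^sub>R W"
      by (simp add: R0_sq)
    then have "R0 o\<^sub>L R0 = R0"
      by (simp add: R0_def flip: scaleR_left_distrib)
    then have R: "R0 \<in> half_projections M" using R0 by (intro half_projectionI)
    have PE: "Re (trace_of M (P o\<^sub>L E)) = 1/4"
      using Re_trace_diff_square[OF P E] l by (simp add: trace_scaleR id_M trace_id)
    have EP: "Re (trace_of M (E o\<^sub>L P)) = 1/4" using PE trace_commute[OF P'(1) E'(1)] by simp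
    have RE: "R0 o\<^sub>L E = (1/2) *\<^sub>R E + c *\<^sub>R (P o\<^sub>L E)" and RP: "R0 o\<^sub>L P = (1/2) *\<^sub>R P + c *\<^sub>R (E o\<^sub>L P)"
      by (simp_all add: R0_def W_def compose_simps P' E')
    have "Re (trace_of M (R0 o\<^sub>L E)) = 1/4 + c / 4" "Re (trace_of M (R0 o\<^sub>L P)) = 1/4 + c / 4"
      unfolding RE RP by (simp_all add: trace_add trace_scaleR M_intros P' E' PE EP)
    then show ?r
      using R d PE by (auto simp: iff P E field_simps intro!: bexI[of _ R0])
  next
    assume ?r
    then obtain R where R: "R \<in> half_projections M"
      and dist: "1 - 2 * Re (trace_of M (P o\<^sub>L E)) = 1/2"
        "1 - 2 * Re (trace_of M (R o\<^sub>L E)) = d" "1 - 2 * Re (trace_of M (R o\<^sub>L P)) = d"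
      using iff[OF P E] iff[OF _ E d(2)] iff[OF _ P d(2)] by auto
    note R' = half_projectionD[OF R]
    \<comment> \<open>The traces of \<open>R\<close>, \<open>R o\<^sub>L R0\<close> and
      \<open>R0 o\<^sub>L R0\<close> all have real part 1/2. So \<open>Z\<close> has zero Hilbert
      space norm and \<open>R0\<close> inherits idempotence from \<open>R\<close>.\<close>
    define Z where "Z = R - R0"
    have Z: "Z \<in> M" "selfadjoint Z" using R' R0 by (auto simp: Z_def M_intros selfadjoint_diff)
    have tWW: "Re (trace_of M (W o\<^sub>L W)) = 1/2"
      unfolding WW using Re_trace_diff_square[OF P E] dist(1)
      by (simp add: trace_diff trace_id M_intros P' E')
    have tRE: "Re (trace_of M (R o\<^sub>L E)) = (1 - d) / 2" and tRP: "Re (trace_of M (R o\<^sub>L P)) = (1 - d) / 2"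
      using dist by auto
    have RR0: "R o\<^sub>L R0 = (1/2) *\<^sub>R R + c *\<^sub>R ((R o\<^sub>L P) - (R - (R o\<^sub>L E)))"
      by (simp add: R0_def W_def compose_simps)
    have "Re (trace_of M (R o\<^sub>L R0)) = 1/4 + c * (1/2 - d)"
      unfolding RR0
      by (simp add: trace_add trace_diff trace_scaleR M_intros R' P' E' tRP tRE)
    then have tRR0: "Re (trace_of M (R o\<^sub>L R0)) = 1/2"
      using cc by (simp add: d field_simps)
    have tR0: "Re (trace_of M (R0 o\<^sub>L R0)) = 1/2"
      unfolding R0_sq using tWW by (simp add: trace_add trace_scaleR trace_id M_intros W)
    have "Z o\<^sub>L Z = R - (R o\<^sub>L R0) - ((R0 o\<^sub>L R) - (R0 o\<^sub>L R0))"
      by (simp add: Z_def compose_simps R')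
    then have "Re (trace_of M (Z o\<^sub>L Z)) = 0"
      using trace_commute[OF R0(1) R'(1)] tR0 tRR0 by (simp add: trace_diff M_intros R' R0)
    then have "Z = 0" using faithful_square[OF Z] by simp
    then have "R0 o\<^sub>L R0 = R0" using R' by (simp add: Z_def)
    then have "(1/4) *\<^sub>R id_blinfun + c *\<^sub>R W + (1/2) *\<^sub>R (W o\<^sub>L W) = (1/2) *\<^sub>R id_blinfun + c *\<^sub>R W"
      unfolding R0_sq unfolding R0_def .
    then have "(1/2) *\<^sub>R (W o\<^sub>L W) = (1/2) *\<^sub>R id_blinfun - (1/4) *\<^sub>R id_blinfun"
      by (simp add: algebra_simps)
    also have "\<dots> = (1/4) *\<^sub>R id_blinfun"
      by (simp flip: scaleR_left_diff_distrib)
    finally have "(1/2) *\<^sub>R (W o\<^sub>L W) = (1/4) *\<^sub>R id_blinfun" .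
    then have "2 *\<^sub>R ((1/2) *\<^sub>R (W o\<^sub>L W)) = 2 *\<^sub>R ((1/4) *\<^sub>R id_blinfun)" by simp
    then have "id_blinfun - ((P - E) o\<^sub>L (P - E)) = (1/2) *\<^sub>R id_blinfun" by (simp add: WW)
    then show ?l using sum_half[of id_blinfun] by (metis add_diff_cancel_left' diff_diff_eq2 diff_eq_eq)
  qed
qed

end

text \<open>The right-hand sides of the two characterizations mention only distances. Both
  directions matter later: one produces unitaries in the target, the other gives
  surjectivity.\<close>

lemma equidistant_isometry_iff:
  fixes \<phi> :: "('a::chilbert \<Rightarrow>\<^sub>L 'a) \<Rightarrow> ('b::chilbert \<Rightarrow>\<^sub>L 'b)"
  assumes "trace_of_algebra M1" "trace_of_algebra M2" and p: "p > 0"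
    and \<phi>: "surj_Lp_isometry p M1 M2 (half_projections M1) (half_projections M2) \<phi>"
    and P: "P \<in> half_projections M1" and E: "E \<in> half_projections M1"
  shows "(P - E) o\<^sub>L (P - E) = (1/2) *\<^sub>R id_blinfun \<longleftrightarrow> (\<phi> P - \<phi> E) o\<^sub>L (\<phi> P - \<phi> E) = (1/2) *\<^sub>R id_blinfun"
proof -
  interpret m1: trace_of_algebra M1 by fact
  interpret m2: trace_of_algebra M2 by fact
  have iso: "Lp_norm M2 p (\<phi> A - \<phi> B) = Lp_norm M1 p (A - B)"
    if "A \<in> half_projections M1" "B \<in> half_projections M1" for A B
    using \<phi> that by (simp add: surj_Lp_isometry_def)
  have img: "\<phi> ` half_projections M1 = half_projections M2"
    using \<phi> by (simp add: surj_Lp_isometry_def)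
  then have PE: "\<phi> P \<in> half_projections M2" "\<phi> E \<in> half_projections M2" using P E by auto
  show ?thesis
  proof (cases "p = 2")
    case True
    show ?thesis
      \<comment> \<open>Writing the target projections as the image of \<open>\<phi>\<close> lets
        the auxiliary projection \<open>R\<close> be pulled back.\<close>
      unfolding m1.equidistant_iff_L2[OF P E] m2.equidistant_iff_L2[OF PE] img[symmetric] bex_simps
      using iso P E by (simp add: True)
  next
    case False
    have E': "id_blinfun - E \<in> half_projections M1" by (rule m1.half_projection_complement[OF E])
    then have "\<phi> (id_blinfun - E) \<in> half_projections M2" using img by blast
    moreover have "Lp_norm M2 p (\<phi> (id_blinfun - E) - \<phi> E) = 1"
      unfolding iso[OF E' E] using m1.Lp_distance_1_iff[OF E' E p] by simp
    ultimately have "\<phi> (id_blinfun - E) = id_blinfun - \<phi> E"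
      using m2.Lp_distance_1_iff[OF _ PE(2) p] by blast
    then show ?thesis
      unfolding m1.equidistant_iff_Lp[OF P E p False] m2.equidistant_iff_Lp[OF PE p False]
      using iso[OF P E] iso[OF P E'] by simp
  qed
qed

section \<open>Unitaries and equidistant projections\<close>

text \<open>For unitary \<open>V\<close> this is the orthogonal projection onto the vectors
  \<open>(V y, y)\<close>, the graph of \<open>V\<close> with its coordinates exchanged.\<close>

definition unitary_projection :: "('a::chilbert \<Rightarrow>\<^sub>L 'a) \<Rightarrow> (('a ^ 2) \<Rightarrow>\<^sub>L ('a ^ 2))" where
  "unitary_projection V = blk ((1/2) *\<^sub>R id_blinfun) ((1/2) *\<^sub>R V) ((1/2) *\<^sub>R adj V) ((1/2) *\<^sub>R id_blinfun)"

lemma unitary_projection_eq: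
  "(1 / 2) *\<^sub>R (id_blinfun \<otimes>\<^sub>M (matrix_unit 1 1 + matrix_unit 2 2)
      + V \<otimes>\<^sub>M matrix_unit 1 2 + adj V \<otimes>\<^sub>M matrix_unit 2 1) = unitary_projection V"
  by (simp add: unitary_projection_def op_tensor_eq_blk matrix_unit_def blk_simps scaleC_op_one scaleC_op_zero)

lemma corner_eq: "id_blinfun \<otimes>\<^sub>M matrix_unit 1 1 = blk id_blinfun 0 0 0"
  by (simp add: op_tensor_eq_blk matrix_unit_def scaleC_op_one scaleC_op_zero)

locale finite_factor_algebra =
  fixes N :: "('a::chilbert \<Rightarrow>\<^sub>L 'a) set"
  assumes finite_factor: "finite_factor N"

sublocale finite_factor_algebra \<subseteq> trace_of_algebra N
  unfolding trace_of_algebra_def by (rule finite_factor_traced_algebra[OF finite_factor])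

sublocale finite_factor_algebra \<subseteq> tensor: trace_of_algebra "tensor_M2 N"
  unfolding trace_of_algebra_def by (rule finite_factor_traced_tensor_M2[OF finite_factor])

context finite_factor_algebra
begin

lemma trace_blk:
  assumes "a \<in> N" "b \<in> N" "c \<in> N" "d \<in> N"
  shows "trace_of (tensor_M2 N) (blk a b c d) = (trace_of N a + trace_of N d) / 2"
  unfolding finite_factor_trace_of_tensor_M2[OF finite_factor] using assms by (rule block_trace_blk)

lemma corner_half_projection: "blk id_blinfun 0 0 0 \<in> half_projections (tensor_M2 N)"
proof (rule tensor.half_projectionI)
  show "blk id_blinfun 0 0 0 \<in> tensor_M2 N" by (simp add: blk_in_tensor_M2 M_intros)
  have "adj (0 :: 'a \<Rightarrow>\<^sub>L 'a) = 0" by (rule adj_eqI) simp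
  then show "selfadjoint (blk id_blinfun 0 0 (0 :: 'a \<Rightarrow>\<^sub>L 'a))"
    by (simp add: selfadjoint_def bop_blk adj_blk bop_id bop_zero)
  show "trace_of (tensor_M2 N) (blk id_blinfun 0 0 0) = 1/2"
    using trace_diff[OF zero_M zero_M] by (simp add: trace_blk M_intros trace_id)
qed (simp add: blk_compose)

lemma unitary_groupD:
  assumes "V \<in> unitary_group N"
  shows "V \<in> N" "V \<in> bop" "adj V o\<^sub>L V = id_blinfun" "V o\<^sub>L adj V = id_blinfun"
  using assms M_bop by (auto simp: unitary_group_def)

text \<open>Subtracting the corner changes the upper left entry from 1/2 to -1/2, so in the square
  the off-diagonal terms cancel.\<close>

lemma unitary_projection_equidistant:
  assumes V: "V \<in> unitary_group N"
  shows "unitary_projection V \<in> half_projections (tensor_M2 N)"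
    and "(unitary_projection V - blk id_blinfun 0 0 0) o\<^sub>L (unitary_projection V - blk id_blinfun 0 0 0)
      = (1/2) *\<^sub>R id_blinfun"
proof -
  note V = unitary_groupD[OF V]
  have quarter: "(1/4) *\<^sub>R X + (1/4) *\<^sub>R X = (1/2) *\<^sub>R X" for X :: "'a \<Rightarrow>\<^sub>L 'a"
    by (simp flip: scaleR_left_distrib)
  have minus_half: "(1/2) *\<^sub>R X - X = (- (1/2)) *\<^sub>R X" for X :: "'a \<Rightarrow>\<^sub>L 'a"
    using scaleR_left_diff_distrib[of "1/2" 1 X] by simp
  show "unitary_projection V \<in> half_projections (tensor_M2 N)"
  proof (rule tensor.half_projectionI)
    show "unitary_projection V \<in> tensor_M2 N"
      by (simp add: unitary_projection_def blk_in_tensor_M2 M_intros V)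
    show "selfadjoint (unitary_projection V)"
      by (simp add: unitary_projection_def selfadjoint_def bop_blk adj_blk bop_scaleR bop_id V adj_bop
          adj_scaleR adj_adj)
    show "unitary_projection V o\<^sub>L unitary_projection V = unitary_projection V"
      by (simp add: unitary_projection_def blk_compose compose_simps V quarter)
    show "trace_of (tensor_M2 N) (unitary_projection V) = 1/2"
      by (simp add: unitary_projection_def trace_blk M_intros V trace_scaleR trace_id)
  qed
  show "(unitary_projection V - blk id_blinfun 0 0 0) o\<^sub>L (unitary_projection V - blk id_blinfun 0 0 0)
      = (1/2) *\<^sub>R id_blinfun"
    by (simp add: unitary_projection_def blk_diff blk_compose blk_id[where 'a='a] blk_scaleR minus_half
        compose_simps V quarter)
qed

text \<open>The equation fixes both diagonal blocks as 1/2; the diagonal entries of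
  \<open>P o\<^sub>L P = P\<close> then say that \<open>2 *\<^sub>R b\<close> is unitary.\<close>

lemma equidistant_imp_unitary_projection:
  assumes P: "P \<in> half_projections (tensor_M2 N)"
    and eq: "(P - blk id_blinfun 0 0 0) o\<^sub>L (P - blk id_blinfun 0 0 0) = (1/2) *\<^sub>R id_blinfun"
  obtains V where "V \<in> unitary_group N" "P = unitary_projection V"
proof -
  note P' = tensor.half_projectionD[OF P]
  obtain a b c d where blk: "P = blk a b c d" and mem: "a \<in> N" "b \<in> N" "c \<in> N" "d \<in> N"
    using P'(1) by (rule tensor_M2_cases)
  let ?E = "blk id_blinfun 0 0 (0 :: 'a \<Rightarrow>\<^sub>L 'a)"
  \<comment> \<open>Idempotence makes this expression linear in \<open>P\<close>, and its
    off-diagonal blocks cancel.\<close>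
  have "(P - ?E) o\<^sub>L (P - ?E) = P - (P o\<^sub>L ?E) - ((?E o\<^sub>L P) - ?E)"
    by (simp add: compose_simps P' tensor.half_projectionD[OF corner_half_projection])
  also have "\<dots> = blk (id_blinfun - a) 0 0 d"
    by (simp add: blk blk_compose blk_diff)
  finally have "blk (id_blinfun - a) 0 0 d = blk ((1/2) *\<^sub>R id_blinfun) 0 0 ((1/2) *\<^sub>R id_blinfun)"
    using eq by (simp add: blk_id[where 'a='a] blk_scaleR)
  then have ad: "id_blinfun - a = (1/2) *\<^sub>R id_blinfun" and d: "d = (1/2) *\<^sub>R id_blinfun"
    by (simp_all add: blk_eq_iff)
  have half: "id_blinfun - (1/2) *\<^sub>R id_blinfun = (1/2) *\<^sub>R (id_blinfun :: 'a \<Rightarrow>\<^sub>L 'a)"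
    by (simp add: diff_eq_eq flip: scaleR_left_distrib)
  have a: "a = (1/2) *\<^sub>R id_blinfun" using ad half by (metis diff_diff_eq2 add_diff_cancel_left')
  have c: "c = adj b"
    using P'(2) mem M_bop by (simp add: blk selfadjoint_def adj_blk blk_eq_iff)
  define V where "V = 2 *\<^sub>R b"
  have b: "b = (1/2) *\<^sub>R V" by (simp add: V_def)
  have VN: "V \<in> N" "V \<in> bop" using mem M_bop by (auto simp: V_def M_intros)
  have c': "c = (1/2) *\<^sub>R adj V" using VN by (simp add: c b adj_scaleR)
  have "(a o\<^sub>L a) + (b o\<^sub>L c) = a" "(c o\<^sub>L b) + (d o\<^sub>L d) = d"
    using P'(3) by (simp_all add: blk blk_compose blk_eq_iff)
  then have "(1/4) *\<^sub>R id_blinfun + (1/4) *\<^sub>R (V o\<^sub>L adj V) = (1/2) *\<^sub>R id_blinfun"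
    "(1/4) *\<^sub>R id_blinfun + (1/4) *\<^sub>R (adj V o\<^sub>L V) = (1/2) *\<^sub>R id_blinfun"
    by (simp_all add: a b c' d compose_simps add.commute)
  then have "4 *\<^sub>R ((1/4) *\<^sub>R id_blinfun + (1/4) *\<^sub>R (V o\<^sub>L adj V)) = 4 *\<^sub>R ((1/2) *\<^sub>R id_blinfun)"
    "4 *\<^sub>R ((1/4) *\<^sub>R id_blinfun + (1/4) *\<^sub>R (adj V o\<^sub>L V)) = 4 *\<^sub>R ((1/2) *\<^sub>R id_blinfun)"
    by simp_all
  then have "id_blinfun + (V o\<^sub>L adj V) = id_blinfun + id_blinfun" "id_blinfun + (adj V o\<^sub>L V) = id_blinfun + id_blinfun"
    by (simp_all add: scaleR_right_distrib scaleR_2)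
  then have "V \<in> unitary_group N" using VN by (simp add: unitary_group_def)
  moreover have "P = unitary_projection V"
    by (simp add: blk unitary_projection_def a b c' d)
  ultimately show ?thesis using that by blast
qed

section \<open>Comparison of the distances in \<open>N\<close> and
  \<open>tensor_M2 N\<close>\<close>

lemma Lp_norm_half:
  assumes D: "D \<in> N" and p: "p > 0"
  shows "Lp_norm N p ((1/2) *\<^sub>R D) = (1/2) * Lp_norm N p D"
proof (rule Lp_norm_eqI[OF p])
  show "0 \<le> 1/2 * Lp_norm N p D" using Lp_norm_nonneg[of p D] by simp
  have b: "D \<in> bop" using D M_bop by blast
  have DD: "adj D o\<^sub>L D \<in> bop" "op_le 0 (adj D o\<^sub>L D)" "adj D o\<^sub>L D \<in> N"
    using b D by (auto simp: bop_compose adj_bop op_le_zero_adj_compose M_intros)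
  have "adj ((1/2) *\<^sub>R D) o\<^sub>L ((1/2) *\<^sub>R D) = (1/4) *\<^sub>R (adj D o\<^sub>L D)"
    by (simp add: adj_scaleR b compose_simps)
  then have "Lp_norm N p ((1/2) *\<^sub>R D) powr p = (1/4) powr (p/2) * Lp_norm N p D powr p"
    using Lp_norm_powr[OF D p] Lp_norm_powr[OF scaleR_M[OF D] p, of "1/2"] p
      op_powr_scaleR[OF DD(1,2), of "1/4" "p/2"] op_powr_M[OF DD(3,2), of "p/2"]
    by (simp add: trace_scaleR)
  also have "(1/4::real) powr (p/2) = (1/2) powr p"
    using powr_powr[of "1/2::real" 2 "p/2"] by (simp add: power2_eq_square)
  finally show "Lp_norm N p ((1/2) *\<^sub>R D) powr p = (1/2 * Lp_norm N p D) powr p"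
    using Lp_norm_nonneg[of p D] powr_mult[of "1/2" "Lp_norm N p D" p] by simp
qed

text \<open>The difference \<open>X\<close> is off-diagonal with blocks \<open>D\<close> and
  \<open>adj D\<close>. The diagonal blocks of \<open>adj X o\<^sub>L X\<close> have equal
  polynomial traces, so their average is the trace computed in \<open>N\<close>.\<close>

lemma Lp_norm_unitary_projection_diff:
  assumes V: "V \<in> unitary_group N" and W: "W \<in> unitary_group N" and p: "p > 0"
  shows "Lp_norm (tensor_M2 N) p (unitary_projection V - unitary_projection W) = (1/2) * Lp_norm N p (V - W)"
proof -
  define D where "D = (1/2) *\<^sub>R (V - W)"
  have VW: "V \<in> N" "W \<in> N" "V \<in> bop" "W \<in> bop" using V W unitary_groupD by blast+
  have D: "D \<in> N" "D \<in> bop" using VW M_bop by (auto simp: D_def M_intros)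
  have aD: "adj D \<in> N" "adj D \<in> bop" using D adj_M adj_bop by blast+
  have adjD: "(1/2) *\<^sub>R adj V - (1/2) *\<^sub>R adj W = adj D"
    unfolding D_def adj_scaleR[OF bop_diff[OF VW(3,4)]] adj_diff[OF VW(3,4)] by (rule scaleR_diff_right[symmetric])
  define X where "X = unitary_projection V - unitary_projection W"
  have X: "X = blk 0 D (adj D) 0"
    by (simp add: X_def unitary_projection_def blk_diff adjD) (simp add: D_def scaleR_diff_right)
  have z: "adj (0 :: 'a \<Rightarrow>\<^sub>L 'a) = 0" by (rule adj_eqI) simp
  have XX: "adj X o\<^sub>L X = blk (D o\<^sub>L adj D) 0 0 (adj D o\<^sub>L D)"
    by (simp add: X adj_blk D aD bop_zero adj_adj blk_compose z)
  have XM: "X \<in> tensor_M2 N" by (simp add: X blk_in_tensor_M2 D aD zero_M)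
  have XXp: "adj X o\<^sub>L X \<in> tensor_M2 N" "op_le 0 (adj X o\<^sub>L X)"
    using XM tensor.M_bop by (auto simp: tensor.M_intros op_le_zero_adj_compose)
  have DDp: "adj D o\<^sub>L D \<in> N" "op_le 0 (adj D o\<^sub>L D)"
    using D aD by (auto simp: M_intros op_le_zero_adj_compose)
  \<comment> \<open>A common bound allows the same polynomials to approximate the power in both
    algebras.\<close>
  define R where "R = max (norm (adj X o\<^sub>L X)) (norm (adj D o\<^sub>L D))"
  have R: "op_le (adj X o\<^sub>L X) (R *\<^sub>R id_blinfun)" "op_le (adj D o\<^sub>L D) (R *\<^sub>R id_blinfun)"
    using XXp DDp M_bop tensor.M_bop selfadjoint_of_positive by (auto simp: R_def intro!: op_le_norm)
  obtain g where g: "uniform_limit {0..R} (\<lambda>n. poly (g n)) (\<lambda>t. t powr (p/2)) sequentially"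
    using powr_polynomial_approximation[of "p/2"] p by auto
  have "trace_of (tensor_M2 N) (op_poly (g n) (adj X o\<^sub>L X)) = trace_of N (op_poly (g n) (adj D o\<^sub>L D))" for n
    using trace_op_poly_commute[OF D(1) aD(1), of "g n"]
    by (simp add: XX op_poly_blk_diag trace_blk op_poly_M M_intros D aD)
  then have "(\<lambda>n. Re (trace_of N (op_poly (g n) (adj D o\<^sub>L D)))) \<longlonglongrightarrow> Re (trace_of (tensor_M2 N) (op_powr (adj X o\<^sub>L X) (p/2)))"
    using tensor.tendsto_Re_trace_op_powr[OF XXp R(1) g] by simp
  then have "Re (trace_of (tensor_M2 N) (op_powr (adj X o\<^sub>L X) (p/2))) = Re (trace_of N (op_powr (adj D o\<^sub>L D) (p/2)))"
    using tendsto_Re_trace_op_powr[OF DDp R(2) g] LIMSEQ_unique by blast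
  then have "Lp_norm (tensor_M2 N) p X powr p = Lp_norm N p D powr p"
    by (simp add: Lp_norm_powr[OF D(1) p] tensor.Lp_norm_powr[OF XM p])
  then have "Lp_norm (tensor_M2 N) p X = Lp_norm N p D"
    by (rule tensor.Lp_norm_eqI[OF p Lp_norm_nonneg])
  then show ?thesis
    using Lp_norm_half[of "V - W" p] p VW by (simp add: X_def D_def diff_M)
qed

end

theorem lemma3p2:
  fixes p :: real
    and N1 :: "('a::chilbert \<Rightarrow>\<^sub>L 'a) set"
    and N2 :: "('b::chilbert \<Rightarrow>\<^sub>L 'b) set"
    and \<phi> :: "(('a ^ 2) \<Rightarrow>\<^sub>L ('a ^ 2)) \<Rightarrow> (('b ^ 2) \<Rightarrow>\<^sub>L ('b ^ 2))"
  assumes "p > 0"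
    and "finite_factor N1"
    and "finite_factor N2"
    and "surj_Lp_isometry p (tensor_M2 N1) (tensor_M2 N2)
           (half_projections (tensor_M2 N1)) (half_projections (tensor_M2 N2)) \<phi>"
    and "\<phi> (id_blinfun \<otimes>\<^sub>M matrix_unit 1 1) = id_blinfun \<otimes>\<^sub>M matrix_unit 1 1"
  shows "\<exists>\<psi>. surj_Lp_isometry p N1 N2 (unitary_group N1) (unitary_group N2) \<psi> \<and>
    (\<forall>V\<in>unitary_group N1.
       \<phi> ((1 / 2) *\<^sub>R (id_blinfun \<otimes>\<^sub>M (matrix_unit 1 1 + matrix_unit 2 2)
             + V \<otimes>\<^sub>M matrix_unit 1 2 + adj V \<otimes>\<^sub>M matrix_unit 2 1))
       = (1 / 2) *\<^sub>R (id_blinfun \<otimes>\<^sub>M (matrix_unit 1 1 + matrix_unit 2 2)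
             + \<psi> V \<otimes>\<^sub>M matrix_unit 1 2 + adj (\<psi> V) \<otimes>\<^sub>M matrix_unit 2 1))"
proof -
  interpret n1: finite_factor_algebra N1 by (rule finite_factor_algebra.intro) fact
  interpret n2: finite_factor_algebra N2 by (rule finite_factor_algebra.intro) fact
  let ?E1 = "blk id_blinfun 0 0 (0 :: 'a \<Rightarrow>\<^sub>L 'a)" and ?E2 = "blk id_blinfun 0 0 (0 :: 'b \<Rightarrow>\<^sub>L 'b)"
  have E: "\<phi> ?E1 = ?E2" using assms(5) by (simp add: corner_eq)
  note iff = equidistant_isometry_iff[OF n1.tensor.trace_of_algebra_axioms n2.tensor.trace_of_algebra_axioms
      assms(1,4) _ n1.corner_half_projection, unfolded E]
  have img: "\<phi> ` half_projections (tensor_M2 N1) = half_projections (tensor_M2 N2)"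
    using assms(4) by (simp add: surj_Lp_isometry_def)
  \<comment> \<open>As \<open>\<phi>\<close> fixes the corner, it preserves the equation relative to
    the corner, and every solution in the target comes from a unitary.\<close>
  have "\<exists>W. W \<in> unitary_group N2 \<and> \<phi> (unitary_projection V) = unitary_projection W"
    if "V \<in> unitary_group N1" for V
    using n1.unitary_projection_equidistant[OF that] iff img n2.equidistant_imp_unitary_projection
    by (metis imageI)
  then obtain \<psi> where \<psi>: "\<And>V. V \<in> unitary_group N1 \<Longrightarrow> \<psi> V \<in> unitary_group N2"
    "\<And>V. V \<in> unitary_group N1 \<Longrightarrow> \<phi> (unitary_projection V) = unitary_projection (\<psi> V)"
    by metis
  \<comment> \<open>The unitary is the upper right block up to the factor 1/2; hence a preimage of
    the projection of \<open>W\<close> yields a preimage of \<open>W\<close> itself.\<close>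
  have inj: "V = W" if "unitary_projection V = unitary_projection W" for V W :: "'b \<Rightarrow>\<^sub>L 'b"
    using that by (simp add: unitary_projection_def blk_eq_iff)
  have "W \<in> \<psi> ` unitary_group N1" if W: "W \<in> unitary_group N2" for W
  proof -
    note Q = n2.unitary_projection_equidistant[OF W]
    obtain P where P: "P \<in> half_projections (tensor_M2 N1)" "\<phi> P = unitary_projection W"
      using Q(1) img by (metis imageE)
    then obtain V where "V \<in> unitary_group N1" "P = unitary_projection V"
      using iff[OF P(1)] Q(2) n1.equidistant_imp_unitary_projection by metis
    then show ?thesis using P \<psi> inj by (metis imageI)
  qed
  then have surj: "\<psi> ` unitary_group N1 = unitary_group N2" using \<psi>(1) by blast
  have "Lp_norm N1 p (V - W) = Lp_norm N2 p (\<psi> V - \<psi> W)"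
    if VW: "V \<in> unitary_group N1" "W \<in> unitary_group N1" for V W
  proof -
    have "Lp_norm (tensor_M2 N1) p (unitary_projection V - unitary_projection W) =
        Lp_norm (tensor_M2 N2) p (unitary_projection (\<psi> V) - unitary_projection (\<psi> W))"
      using assms(4) VW n1.unitary_projection_equidistant(1) \<psi>(2) by (simp add: surj_Lp_isometry_def)
    then show ?thesis
      by (simp add: n1.Lp_norm_unitary_projection_diff[OF VW assms(1)]
          n2.Lp_norm_unitary_projection_diff[OF \<psi>(1)[OF VW(1)] \<psi>(1)[OF VW(2)] assms(1)])
  qed
  then have "surj_Lp_isometry p N1 N2 (unitary_group N1) (unitary_group N2) \<psi>"
    using surj by (simp add: surj_Lp_isometry_def)
  then show ?thesis using \<psi>(2) unfolding unitary_projection_eq by blast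
qed

end
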